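(* Let $G$ be a connected solvable Lie group and $H$ a uniform subgroup of $G$, and let $\varrho:G\to\mathrm{GL}(V)$ be a representation on a finite-dimensional real vector space $V$. Let $A$ denote the Zariski closure of $\varrho(G)$ in $\mathrm{GL}(V)$. Then the Zariski closure $\overline{\varrho(H)}^{\rm z}$ of $\varrho(H)$ in $\mathrm{GL}(V)$ satisfies $$\overline{\varrho(H)}^{\rm z}\supseteq A_{\rm s},$$ where $A_{\rm s}$ is the maximal trigonalizable subgroup of $A$.
   Context: A uniform subgroup $H$ of a Lie group $G$ is a closed subgroup such that $G/H$ is compact. Representations of Lie groups are continuous. $A$ is a real algebraic group, i.e. $A=\mathbf{A}\cap\mathrm{GL}(V)$ for a solvable linear algebraic group $\mathbf{A}\leq\mathrm{GL}(V\otimes\mathbb{C})$ defined over $\mathbb{R}$ (the Zariski closure of $\varrho(G)$ in $\mathrm{GL}(V\otimes\mathbb{C})$). Let $\mathbf{A}_{\rm s}$ denote the maximal $\mathbb{R}$-split connected subgroup of $\mathbf{A}$, that is, the maximal Zariski-connected subgroup that is trigonalizable over $\mathbb{R}$; explicitly $\mathbf{A}_{\rm s}=\mathbf{U}\cdot\mathbf{T}_{\rm s}$, where $\mathbf{U}$ is the unipotent radical of $\mathbf{A}$, $\mathbf{T}$ is a maximal torus of $\mathbf{A}$ defined over $\mathbb{R}$, and $\mathbf{T}_{\rm s}$ is the maximal $\mathbb{R}$-split subtorus of $\mathbf{T}$. The maximal trigonalizable subgroup of $A$ is $A_{\rm s}=A\cap\mathbf{A}_{\rm s}$. *)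

theory Defs
  imports "HOL-Analysis.Analysis" "HOL-Algebra.Solvable_Groups" "HOL-Algebra.Left_Coset"
begin

section \<open>Smooth maps and Lie groups\<close>

text \<open>Intended for open sets in finite-dimensional spaces, where the existence and continuity of
  all iterated directional derivatives characterises being continuously differentiable
  \<open>k\<close> times.\<close>

primrec C_k_on :: "nat \<Rightarrow> ('a::real_normed_vector \<Rightarrow> 'b::real_normed_vector) \<Rightarrow> 'a set \<Rightarrow> bool" where
  "C_k_on 0 f S \<longleftrightarrow> continuous_on S f"
| "C_k_on (Suc k) f S \<longleftrightarrow> (\<forall>x\<in>S. f differentiable (at x)) \<and>
     (\<forall>v. C_k_on k (\<lambda>x. frechet_derivative f (at x) v) S)"

definition smooth_on :: "'a set \<Rightarrow> ('a::real_normed_vector \<Rightarrow> 'b::real_normed_vector) \<Rightarrow> bool" where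
  "smooth_on S f \<longleftrightarrow> (\<forall>k. C_k_on k f S)"

text \<open>A chart is a pair of a domain and a coordinate map, the latter being meaningful only on the
  domain. The model space is any finite-dimensional normed space, so dimension 0 is included.\<close>

locale smooth_manifold =
  fixes X :: "'p topology"
    and charts :: "('p set \<times> ('p \<Rightarrow> 'e::real_normed_vector)) set"
  assumes finite_dimensional_model: "\<exists>B::'e set. finite B \<and> span B = UNIV"
    and Hausdorff: "Hausdorff_space X"
    and second_countable: "second_countable X"
    and chart: "(U, \<phi>) \<in> charts \<Longrightarrow>
      openin X U \<and> open (\<phi> ` U) \<and> homeomorphic_map (subtopology X U) (top_of_set (\<phi> ` U)) \<phi>"
    and charts_cover: "\<Union>(fst ` charts) = topspace X"
    and charts_compatible: "(U, \<phi>) \<in> charts \<Longrightarrow> (V, \<psi>) \<in> charts \<Longrightarrow>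
      smooth_on (\<phi> ` (U \<inter> V)) (\<psi> \<circ> inv_into U \<phi>)"

locale lie_group = group G + smooth_manifold X charts
  for G (structure) and X :: "'g topology"
    and charts :: "('g set \<times> ('g \<Rightarrow> 'e::real_normed_vector)) set" +
  assumes topspace_eq_carrier: "topspace X = carrier G"
    and mult_continuous: "continuous_map (prod_topology X X) X (\<lambda>(x, y). x \<otimes> y)"
    and inv_continuous: "continuous_map X X (\<lambda>x. inv x)"
    and mult_smooth: "(U, \<phi>) \<in> charts \<Longrightarrow> (V, \<psi>) \<in> charts \<Longrightarrow> (W, \<theta>) \<in> charts \<Longrightarrow>
      smooth_on {(\<phi> x, \<psi> y) |x y. x \<in> U \<and> y \<in> V \<and> x \<otimes> y \<in> W}
        (\<lambda>(a, b). \<theta> (inv_into U \<phi> a \<otimes> inv_into V \<psi> b))"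
    and inv_smooth: "(U, \<phi>) \<in> charts \<Longrightarrow> (V, \<psi>) \<in> charts \<Longrightarrow>
      smooth_on {\<phi> x |x. x \<in> U \<and> inv x \<in> V} (\<lambda>a. \<psi> (inv (inv_into U \<phi> a)))"

definition quotient_topology :: "'a topology \<Rightarrow> ('a \<Rightarrow> 'b) \<Rightarrow> 'b topology" where
  "quotient_topology X q =
     topology (\<lambda>U. U \<subseteq> q ` topspace X \<and> openin X {x \<in> topspace X. q x \<in> U})"

lemma openin_quotient_topology:
  "openin (quotient_topology X q) U \<longleftrightarrow>
     U \<subseteq> q ` topspace X \<and> openin X {x \<in> topspace X. q x \<in> U}"
proof -
  let ?L = "\<lambda>U. U \<subseteq> q ` topspace X \<and> openin X {x \<in> topspace X. q x \<in> U}"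
  have int: "?L (S \<inter> T)" if "?L S" "?L T" for S T
  proof -
    have "{x \<in> topspace X. q x \<in> S \<inter> T} =
          {x \<in> topspace X. q x \<in> S} \<inter> {x \<in> topspace X. q x \<in> T}" by auto
    then show ?thesis using that by (auto intro: openin_Int)
  qed
  have un: "?L (\<Union>\<K>)" if "\<forall>S\<in>\<K>. ?L S" for \<K>
  proof -
    have "{x \<in> topspace X. q x \<in> \<Union>\<K>} = (\<Union>S\<in>\<K>. {x \<in> topspace X. q x \<in> S})" by auto
    moreover have "openin X (\<Union>S\<in>\<K>. {x \<in> topspace X. q x \<in> S})"
      using that by (intro openin_Union) blast
    ultimately show ?thesis using that by (simp add: Sup_le_iff)
  qed
  have "istopology ?L" unfolding istopology_def
  proof (rule conjI; intro allI impI)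
    show "?L (S \<inter> T)" if "?L S" "?L T" for S T by (rule int[OF that])
    show "?L (\<Union>\<K>)" if "\<forall>S\<in>\<K>. ?L S" for \<K> by (rule un[OF that])
  qed
  then show ?thesis by (simp add: quotient_topology_def topology_inverse')
qed

lemma quotient_map_quotient_topology: "quotient_map X (quotient_topology X q) q"
proof -
  have "openin (quotient_topology X q) (q ` topspace X)"
  proof -
    have "{x \<in> topspace X. q x \<in> q ` topspace X} = topspace X" by auto
    then show ?thesis by (simp add: openin_quotient_topology)
  qed
  then have "topspace (quotient_topology X q) = q ` topspace X"
    using openin_topspace[of "quotient_topology X q"]
    by (intro subset_antisym openin_subset) (simp_all only: openin_quotient_topology)
  then show ?thesis by (simp add: quotient_map_def openin_quotient_topology)
qed

definition uniform_subgroup :: "('g, 'm) monoid_scheme \<Rightarrow> 'g topology \<Rightarrow> 'g set \<Rightarrow> bool" where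
  "uniform_subgroup G X H \<longleftrightarrow> subgroup H G \<and> closedin X H \<and>
     compact_space (quotient_topology X (\<lambda>x. x <#\<^bsub>G\<^esub> H))"

section \<open>General linear groups and the Zariski topology\<close>

text \<open>Vector spaces over a field \<open>'k\<close> are given by their scalar multiplication, so that
  the same notions apply to \<open>V\<close> over the reals and to its complexification.\<close>

definition GL :: "('k::field \<Rightarrow> 'v::ab_group_add \<Rightarrow> 'v) \<Rightarrow> ('v \<Rightarrow> 'v) monoid" where
  "GL sc = \<lparr>carrier = {f. Vector_Spaces.linear sc sc f \<and> bij f}, mult = (\<circ>), one = id\<rparr>"

text \<open>The polynomial functions on the space of endomorphisms: the algebra generated by
  the matrix coefficients.\<close>

inductive polynomial_fun ::
  "('k::field \<Rightarrow> 'v::ab_group_add \<Rightarrow> 'v) \<Rightarrow> (('v \<Rightarrow> 'v) \<Rightarrow> 'k) \<Rightarrow> bool"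
  for sc where
  const: "polynomial_fun sc (\<lambda>f. c)"
| coefficient: "Vector_Spaces.linear sc (*) l \<Longrightarrow> polynomial_fun sc (\<lambda>f. l (f v))"
| add: "polynomial_fun sc p \<Longrightarrow> polynomial_fun sc q \<Longrightarrow> polynomial_fun sc (\<lambda>f. p f + q f)"
| mult: "polynomial_fun sc p \<Longrightarrow> polynomial_fun sc q \<Longrightarrow> polynomial_fun sc (\<lambda>f. p f * q f)"

text \<open>The open sets are the complements in the general linear group of the common zero sets of
  families of polynomials. Allowing also the inverse of the determinant as a regular function
  gives the same topology.\<close>

definition zariski :: "('k::field \<Rightarrow> 'v::ab_group_add \<Rightarrow> 'v) \<Rightarrow> ('v \<Rightarrow> 'v) topology" where
  "zariski sc = topology (\<lambda>U. \<exists>P. (\<forall>p\<in>P. polynomial_fun sc p) \<and>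
     U = carrier (GL sc) - {f. \<forall>p\<in>P. p f = 0})"

lemma openin_zariski:
  "openin (zariski sc) U \<longleftrightarrow> (\<exists>P. (\<forall>p\<in>P. polynomial_fun sc p) \<and>
     U = carrier (GL sc) - {f. \<forall>p\<in>P. p f = 0})"
proof -
  let ?L = "\<lambda>U. \<exists>P. (\<forall>p\<in>P. polynomial_fun sc p) \<and>
     U = carrier (GL sc) - {f. \<forall>p\<in>P. p f = 0}"
  have int: "?L (S \<inter> T)" if "?L S" "?L T" for S T
  proof -
    from that obtain P Q where P: "\<forall>p\<in>P. polynomial_fun sc p"
      "S = carrier (GL sc) - {f. \<forall>p\<in>P. p f = 0}"
      and Q: "\<forall>p\<in>Q. polynomial_fun sc p"
      "T = carrier (GL sc) - {f. \<forall>p\<in>Q. p f = 0}" by blast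
    define R where "R = {\<lambda>f. p f * q f |p q. p \<in> P \<and> q \<in> Q}"
    have "\<forall>r\<in>R. polynomial_fun sc r"
      using P(1) Q(1) by (auto simp: R_def intro: polynomial_fun.mult)
    moreover have R: "(\<forall>r\<in>R. r f = 0) \<longleftrightarrow> (\<forall>p\<in>P. p f = 0) \<or> (\<forall>q\<in>Q. q f = 0)" for f
    proof
      assume h: "\<forall>r\<in>R. r f = 0"
      have "p f * q f = 0" if "p \<in> P" "q \<in> Q" for p q
      proof -
        from that have "(\<lambda>f. p f * q f) \<in> R" unfolding R_def by blast
        from bspec[OF h this] show ?thesis by simp
      qed
      then show "(\<forall>p\<in>P. p f = 0) \<or> (\<forall>q\<in>Q. q f = 0)" by (metis mult_eq_0_iff)
    qed (auto simp: R_def)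
    have "S \<inter> T = carrier (GL sc) - {f. \<forall>r\<in>R. r f = 0}"
      unfolding P(2) Q(2) R by auto
    ultimately show ?thesis by blast
  qed
  have un: "?L (\<Union>\<K>)" if "\<forall>S\<in>\<K>. ?L S" for \<K>
  proof -
    from bchoice[OF that] obtain P where P: "\<forall>S\<in>\<K>. (\<forall>p\<in>P S. polynomial_fun sc p) \<and>
      S = carrier (GL sc) - {f. \<forall>p\<in>P S. p f = 0}" ..
    have "\<Union>\<K> = (\<Union>S\<in>\<K>. carrier (GL sc) - {f. \<forall>p\<in>P S. p f = 0})"
    proof -
      have "\<Union>\<K> = (\<Union>S\<in>\<K>. S)" by simp
      also have "\<dots> = (\<Union>S\<in>\<K>. carrier (GL sc) - {f. \<forall>p\<in>P S. p f = 0})"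
        by (rule SUP_cong) (use P in blast)+
      finally show ?thesis .
    qed
    also have "\<dots> = carrier (GL sc) - {f. \<forall>p\<in>(\<Union>S\<in>\<K>. P S). p f = 0}" by auto
    finally show ?thesis using P by (intro exI[of _ "\<Union>S\<in>\<K>. P S"]) blast
  qed
  have "istopology ?L" unfolding istopology_def
  proof (rule conjI; intro allI impI)
    show "?L (S \<inter> T)" if "?L S" "?L T" for S T by (rule int[OF that])
    show "?L (\<Union>\<K>)" if "\<forall>S\<in>\<K>. ?L S" for \<K> by (rule un[OF that])
  qed
  then show ?thesis by (simp add: zariski_def topology_inverse')
qed

lemma topspace_zariski: "topspace (zariski sc) = carrier (GL sc)"
proof -
  have "openin (zariski sc) (carrier (GL sc))"
    unfolding openin_zariski
    by (rule exI[of _ "{\<lambda>f. 1}"]) (auto intro: polynomial_fun.const)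
  moreover have "topspace (zariski sc) \<subseteq> carrier (GL sc)"
    using openin_topspace[of "zariski sc"] unfolding openin_zariski by blast
  ultimately show ?thesis by (intro subset_antisym openin_subset)
qed

section \<open>Complexification and the maximal split subgroup\<close>

text \<open>The complexification of a real vector space \<open>V\<close> is \<open>V \<times> V\<close>, where \<open>(v, w)\<close> stands for
  \<open>v \<otimes> 1 + w \<otimes> \<i>\<close>.\<close>

definition cscale :: "complex \<Rightarrow> 'v \<times> 'v \<Rightarrow> 'v \<times> 'v::real_vector" where
  "cscale c = (\<lambda>(v, w). (Re c *\<^sub>R v - Im c *\<^sub>R w, Re c *\<^sub>R w + Im c *\<^sub>R v))"

lemma vector_space_cscale: "vector_space cscale"
  by unfold_locales (auto simp: cscale_def algebra_simps scaleR_add_left scaleR_diff_left)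

definition complexify :: "('v \<Rightarrow> 'v) \<Rightarrow> 'v \<times> 'v \<Rightarrow> 'v \<times> 'v" where
  "complexify f = map_prod f f"

lemma complexify_GL:
  assumes "f \<in> carrier (GL (*\<^sub>R))"
  shows "complexify f \<in> carrier (GL cscale)"
proof -
  have f: "linear f" "bij f" using assms by (simp_all add: GL_def linear_def)
  have "Vector_Spaces.linear cscale cscale (complexify f)"
    unfolding Vector_Spaces.linear_iff
    by (auto simp: vector_space_cscale complexify_def cscale_def
        linear_add[OF f(1)] linear_diff[OF f(1)] linear_scale[OF f(1)])
  moreover have "bij (complexify f)"
    using f(2) by (simp add: complexify_def bij_def prod.inj_map map_prod_surj)
  ultimately show ?thesis by (simp add: GL_def)
qed

text \<open>All elements are upper triangular with respect to one and the same basis, taken from the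
  real form \<open>V\<close>.\<close>

definition trigonalizable_over_reals :: "('v \<times> 'v \<Rightarrow> 'v \<times> 'v::real_vector) set \<Rightarrow> bool" where
  "trigonalizable_over_reals S \<longleftrightarrow>
     (\<exists>bs. distinct bs \<and> independent (set bs) \<and> span (set bs) = UNIV \<and>
        (\<forall>s\<in>S. \<forall>j<length bs.
           s (bs ! j, 0) \<in> module.span cscale ((\<lambda>b. (b, 0)) ` set (take (Suc j) bs))))"

text \<open>The maximal Zariski-connected algebraic subgroup trigonalizable over the reals. If \<open>A\<close> is a
  Zariski-connected solvable group defined over the reals, there is a largest one, the product of
  the unipotent radical and the maximal split subtorus of a maximal torus defined over the
  reals. No field of definition is imposed on \<open>S\<close>: the largest such \<open>S\<close> is automatically defined
  over the reals.\<close>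

definition max_split_subgroup ::
  "('v \<times> 'v \<Rightarrow> 'v \<times> 'v::real_vector) set \<Rightarrow> ('v \<times> 'v \<Rightarrow> 'v \<times> 'v) set" where
  "max_split_subgroup A = (GREATEST S. subgroup S (GL cscale) \<and> S \<subseteq> A \<and>
     closedin (zariski cscale) S \<and> connectedin (zariski cscale) S \<and>
     trigonalizable_over_reals S)"

text \<open>For a subgroup \<open>R\<close> of \<open>GL(V)\<close> with Zariski closure \<open>A\<close> in \<open>GL(V)\<close>, these are the points of
  \<open>A\<close> lying in the maximal split subgroup of the Zariski closure of \<open>R\<close> in the general linear
  group of the complexification.\<close>

definition max_trigonalizable_subgroup :: "('v \<Rightarrow> 'v::real_vector) set \<Rightarrow> ('v \<Rightarrow> 'v) set" where
  "max_trigonalizable_subgroup R = {f \<in> zariski (*\<^sub>R) closure_of R.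
     complexify f \<in> max_split_subgroup (zariski cscale closure_of (complexify ` R))}"

text \<open>On a finite-dimensional \<open>V\<close>, continuity of all matrix coefficients is continuity for the
  usual topology of \<open>GL(V)\<close>.\<close>

definition continuous_representation ::
  "('g, 'm) monoid_scheme \<Rightarrow> 'g topology \<Rightarrow> ('g \<Rightarrow> 'v \<Rightarrow> 'v::real_vector) \<Rightarrow> bool" where
  "continuous_representation G X \<rho> \<longleftrightarrow> \<rho> \<in> hom G (GL (*\<^sub>R)) \<and>
     (\<forall>l v. Vector_Spaces.linear (*\<^sub>R) (*) l \<longrightarrow> continuous_map X euclideanreal (\<lambda>g. l (\<rho> g v)))"

end

theory Submission
  imports Defs "HOL-Computational_Algebra.Fundamental_Theorem_Algebra"
    "Jordan_Normal_Form.Determinant"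
begin

text \<open>
  Let \<open>A\<close> be the complex Zariski closure of \<open>\<rho>(G)\<close>. The proof has two independent halves: a description
  of the maximal split subgroup of \<open>A\<close> by equations, and an argument that compactness of \<open>G/H\<close> forces
  polynomials vanishing on \<open>\<rho>(H)\<close> to vanish on it.

  \<^bold>\<open>The split subgroup.\<close> By the theorem of Lie and Kolchin (\<open>triangular_basis\<close>), \<open>\<rho>(G)\<close> and hence \<open>A\<close> are
  upper triangular in some complex basis \<open>e\<^sub>j\<close>, with characters \<open>\<chi>\<^sub>j\<close> on the diagonal. The complex conjugate
  basis gives a second triangular form of \<open>A\<close>, with characters \<open>\<chi>'\<^sub>j\<close> that on \<open>\<rho>(G)\<close> are the conjugates
  of the \<open>\<chi>\<^sub>j\<close>. Let \<open>B\<close> be the subgroup of \<open>A\<close> where \<open>\<chi>\<^sub>j = \<chi>'\<^sub>j\<close> for all \<open>j\<close>. On \<open>B\<close> the real and imaginary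
  parts of the \<open>e\<^sub>j\<close> span an invariant real flag (\<open>B_trigonalizable\<close>); conversely, a group in \<open>A\<close> with an
  invariant real flag lies in \<open>B\<close>, because the step of the flag at which \<open>e\<^sub>j\<close> shows up is its own
  conjugate (\<open>trigonalizable_sub_B\<close>). So the maximal split subgroup is the identity component of \<open>B\<close>
  (\<open>max_split_eq\<close>).

  \<^bold>\<open>Density.\<close> Let \<open>p\<close> be a polynomial that vanishes on \<open>\<rho>(H)\<close>. It lies in a finite-dimensional space \<open>U\<close>
  of functions that vanish on \<open>\<rho>(H)\<close> and is stable under right translation by \<open>\<rho>(H)\<close>. As in Chevalley's
  theorem one passes to the line spanned by the exterior product of a basis \<open>u\<^sub>i\<close> of \<open>U\<close>, here realised as the
  function \<open>F(z) = det (u\<^sub>i(z\<^sub>j))\<close> of tuples of matrices. Translation by \<open>\<rho>(H)\<close> multiplies \<open>F\<close> by a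
  character, and this is the restriction of a character \<open>\<tau>\<close> of \<open>A\<close>: the one by which \<open>A\<close> acts on the
  leading term of \<open>F\<close> (\<open>leading_character\<close>). Consequently \<open>g \<mapsto> F(z \<rho>(g)) / \<tau>(\<rho>(g))\<close> is a continuous function
  on \<open>G/H\<close>, and compactness makes it bounded.

  A bounded orbit of a triangular group is very restricted: after division by \<open>\<tau>\<close>, diagonal characters
  have modulus 1, and commutators act by unipotent operators with bounded powers, so trivially.
  Therefore \<open>F\<close> is a sum of eigenvectors of \<open>\<rho>(G)\<close> whose characters \<open>\<sigma>\<close> satisfy \<open>\<bar>\<sigma>\<bar> = \<bar>\<tau>\<bar>\<close> on \<open>\<rho>(G)\<close>
  (\<open>bounded_decomposition\<close>). That equation reads \<open>\<sigma>\<sigma>' = \<tau>\<tau>'\<close>, is polynomial and extends to \<open>A\<close>; on \<open>B\<close> it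
  becomes \<open>\<sigma>\<^sup>2 = \<tau>\<^sup>2\<close>, and on the identity component \<open>\<sigma> = \<tau>\<close> (\<open>equal_modulus_rigid\<close>). So every \<open>s\<close> in the split
  subgroup also multiplies \<open>F\<close> by \<open>\<tau>(s)\<close>. Since all \<open>u\<^sub>i\<close> vanish at the identity, \<open>F\<close> vanishes at tuples
  with an entry 1, hence at tuples with an entry \<open>s\<close>; evaluated at a tuple dual to the \<open>u\<^sub>i\<close> in the
  other entries this says \<open>u\<^sub>i(s) = 0\<close>, and so \<open>p(s) = 0\<close> (\<open>vanishing_on_split_part\<close>).
\<close>

section \<open>Connectedness and compactness\<close>

text \<open>In the theorem of Lie and Kolchin this turns finiteness of the spectrum into rigidity of
  characters.\<close>
lemma continuous_finite_range_constant:
  fixes f :: "'a \<Rightarrow> 'b::metric_space"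
  assumes "connectedin X N" and "continuous_map (subtopology X N) euclidean f"
    and "finite (f ` N)" and "x \<in> N" and "y \<in> N"
  shows "f x = f y"
proof -
  have "connectedin euclidean (f ` N)"
    using connectedin_continuous_map_image[OF assms(2), of N] assms(1)
    by (auto simp: connectedin_subtopology)
  then have "connected (f ` N)" by (simp add: connectedin_iff_connected)
  then obtain c where "f ` N \<subseteq> {c}"
    using assms(3) connected_finite_iff_sing[of "f ` N"] by force
  then show ?thesis using assms(4,5) by blast
qed

text \<open>The set of commutators is a continuous image of \<open>N \<times> N\<close>, hence connected, and contains 1.
  Each product of commutators is joined to 1 by translating such connected sets, and a union of
  connected sets through 1 is connected.\<close>
lemma (in group) connectedin_derived:
  assumes top: "topspace X = carrier G"
    and mul: "continuous_map (prod_topology X X) X (\<lambda>(x, y). x \<otimes> y)"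
    and inverse: "continuous_map X X (\<lambda>x. inv x)"
    and N: "connectedin X N" and one: "\<one> \<in> N"
  shows "connectedin X (derived G N)"
proof -
  have sub: "N \<subseteq> carrier G" using N top connectedin_subset_topspace by metis
  have mult_map: "continuous_map Z X (\<lambda>z. f z \<otimes> g z)"
    if "continuous_map Z X f" "continuous_map Z X g" for Z :: "'z topology" and f g
    using continuous_map_compose[OF continuous_map_pairedI[OF that] mul] by (simp add: o_def)
  have inv_map: "continuous_map Z X (\<lambda>z. inv (f z))"
    if "continuous_map Z X f" for Z :: "'z topology" and f
    using continuous_map_compose[OF that inverse] by (simp add: o_def)
  have "continuous_map (prod_topology X X) X (\<lambda>p. fst p \<otimes> snd p \<otimes> inv (fst p) \<otimes> inv (snd p))"
    by (intro mult_map inv_map continuous_map_fst continuous_map_snd)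
  moreover have "connectedin (prod_topology X X) (N \<times> N)"
    using N by (simp add: connectedin_Times)
  ultimately have "connectedin X
      ((\<lambda>p. fst p \<otimes> snd p \<otimes> inv (fst p) \<otimes> inv (snd p)) ` (N \<times> N))"
    by (rule connectedin_continuous_map_image)
  moreover have "(\<lambda>p. fst p \<otimes> snd p \<otimes> inv (fst p) \<otimes> inv (snd p)) ` (N \<times> N) = derived_set G N"
    by (force simp: image_iff)
  ultimately have conn: "connectedin X (derived_set G N)" by simp
  have ds: "derived_set G N \<subseteq> carrier G" using derived_set_in_carrier[OF sub] .
  have one_ds: "\<one> \<in> derived_set G N" using one by (auto intro!: bexI[of _ \<one>])
  have ds_gen: "derived_set G N \<subseteq> derived G N" by (auto simp: derived_def intro!: generate.incl)
  have gen: "derived G N \<subseteq> carrier G" using derived_in_carrier[OF sub] .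
  have path: "\<exists>C. connectedin X C \<and> C \<subseteq> derived G N \<and> \<one> \<in> C \<and> x \<in> C"
    if "x \<in> generate G (derived_set G N)" for x
    using that
  proof induction
    case one then show ?case using conn one_ds ds_gen by blast
  next
    case (incl h) then show ?case using conn one_ds ds_gen by blast
  next
    case (inv h)
    have "connectedin X ((\<lambda>x. inv x) ` derived_set G N)"
      using inverse conn by (rule connectedin_continuous_map_image)
    moreover have "(\<lambda>x. inv x) ` derived_set G N \<subseteq> derived G N"
      unfolding derived_def by (intro image_subsetI generate.inv)
    moreover have "\<one> \<in> (\<lambda>x. inv x) ` derived_set G N" using imageI[OF one_ds, of "\<lambda>x. inv x"] by (simp only: inv_one)
    ultimately show ?case using inv by blast
  next
    case (eng x y)
    obtain C where C: "connectedin X C" "C \<subseteq> derived G N" "\<one> \<in> C" "x \<in> C" using eng.IH(1) by blast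
    obtain D where D: "connectedin X D" "D \<subseteq> derived G N" "\<one> \<in> D" "y \<in> D" using eng.IH(2) by blast
    have x: "x \<in> carrier G" using C gen by blast
    have "continuous_map X X (\<lambda>z. x \<otimes> z)" using x top by (intro mult_map) auto
    then have "connectedin X ((\<lambda>z. x \<otimes> z) ` D)" using D(1) by (rule connectedin_continuous_map_image)
    moreover have "x \<in> (\<lambda>z. x \<otimes> z) ` D" using D(3) x by force
    ultimately have "connectedin X (C \<union> (\<lambda>z. x \<otimes> z) ` D)"
      using C(1,4) by (intro connectedin_Un) auto
    moreover have "C \<union> (\<lambda>z. x \<otimes> z) ` D \<subseteq> derived G N"
      using C(2,4) D(2) unfolding derived_def by (auto intro: generate.eng)
    ultimately show ?case using C(3) D(4) by blast
  qed
  have "\<forall>x\<in>derived G N. \<exists>C. connectedin X C \<and> C \<subseteq> derived G N \<and> \<one> \<in> C \<and> x \<in> C"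
    using path unfolding derived_def[of G N, symmetric] by (rule ballI)
  from bchoice[OF this] obtain C where C: "\<forall>x\<in>derived G N.
      connectedin X (C x) \<and> C x \<subseteq> derived G N \<and> \<one> \<in> C x \<and> x \<in> C x" ..
  have "connectedin X (\<Union>(C ` derived G N))"
  proof (rule connectedin_Union)
    have "\<one> \<in> \<Inter>(C ` derived G N)" using C by blast
    then show "\<Inter>(C ` derived G N) \<noteq> {}" by blast
  qed (use C in blast)
  moreover have "\<Union>(C ` derived G N) = derived G N" using C by blast
  ultimately show ?thesis by simp
qed

text \<open>The function factors through the quotient map, so its range is the continuous image of a
  compact space.\<close>
lemma bounded_range_of_compact_quotient:
  fixes f :: "'a \<Rightarrow> 'b::metric_space"
  assumes "compact_space (quotient_topology X q)" and "continuous_map X euclidean f"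
    and "\<And>x y. x \<in> topspace X \<Longrightarrow> y \<in> topspace X \<Longrightarrow> q x = q y \<Longrightarrow> f x = f y"
  shows "bounded (f ` topspace X)"
proof -
  obtain g where g: "continuous_map (quotient_topology X q) euclidean g"
    "g ` topspace (quotient_topology X q) = f ` topspace X"
    using quotient_map_lift_exists[OF quotient_map_quotient_topology assms(2)] assms(3)
    by metis
  have "compactin euclidean (g ` topspace (quotient_topology X q))"
    using assms(1) g(1) image_compactin compact_space_def by blast
  then show ?thesis using g(2) by (simp add: compact_imp_bounded)
qed

section \<open>Eigenvectors modulo an invariant subspace\<close>

locale complex_fin_dim = vector_space sc
  for sc :: "complex \<Rightarrow> 'w::ab_group_add \<Rightarrow> 'w" +
  assumes fin_dim: "\<exists>B. finite B \<and> span B = UNIV"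
begin

abbreviation lin :: "('w \<Rightarrow> 'w) \<Rightarrow> bool" where "lin \<equiv> Vector_Spaces.linear sc sc"
abbreviation linf :: "('w \<Rightarrow> complex) \<Rightarrow> bool" where "linf \<equiv> Vector_Spaces.linear sc (*)"

lemma lin_simps:
  assumes "lin b"
  shows "b (x + y) = b x + b y" "b (x - y) = b x - b y" "b (sc c x) = sc c (b x)" "b 0 = 0"
    "b (- x) = - b x"
proof -
  have "module_hom sc sc b" using assms by (simp add: linear_iff_module_hom)
  then interpret module_hom sc sc b .
  show "b (x + y) = b x + b y" "b (x - y) = b x - b y" "b (sc c x) = sc c (b x)" "b 0 = 0"
    "b (- x) = - b x"
    by (simp_all add: add diff scale neg)
qed

lemma linf_simps:
  assumes "linf b"
  shows "b (x + y) = b x + b y" "b (x - y) = b x - b y" "b (sc c x) = c * b x" "b 0 = 0"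
    "b (- x) = - b x" "b (sum g I) = (\<Sum>i\<in>I. b (g i))"
proof -
  have "module_hom sc (*) b" using assms by (simp add: linear_iff_module_hom)
  then interpret module_hom sc "(*)" b .
  show "b (x + y) = b x + b y" "b (x - y) = b x - b y" "b (sc c x) = c * b x" "b 0 = 0"
    "b (- x) = - b x" "b (sum g I) = (\<Sum>i\<in>I. b (g i))"
    by (simp_all add: add diff scale neg sum)
qed

lemma vector_space_mult: "vector_space ((*) :: complex \<Rightarrow> complex \<Rightarrow> complex)"
  by unfold_locales (auto simp: algebra_simps)

lemma functional_separates:
  assumes "subspace E" and "v \<notin> E"
  shows "\<exists>l. linf l \<and> (\<forall>x\<in>E. l x = 0) \<and> l v = 1"
proof -
  obtain B where B: "B \<subseteq> E" "independent B" "E \<subseteq> span B"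
    using maximal_independent_subset by blast
  have sp: "span B = E" using B assms(1) by (simp add: span_minimal subset_antisym)
  interpret vector_space_pair sc "(*) :: complex \<Rightarrow> complex \<Rightarrow> complex"
    by (intro vector_space_pair.intro vector_space_axioms vector_space_mult)
  have "independent (insert v B)" using B assms sp by (simp add: independent_insert)
  from linear_independent_extend[OF this, of "\<lambda>x. if x = v then 1 else 0"]
  obtain l where l: "linf l" "\<forall>x\<in>insert v B. l x = (if x = v then 1 else 0)" by blast
  have "v \<notin> B" using B assms by blast
  have "l x = 0" if "x \<in> span B" for x
    using that
  proof (induction rule: span_induct_alt)
    case base then show ?case by (simp add: linf_simps[OF l(1)])
  next
    case (step c x y)
    then show ?case using l \<open>v \<notin> B\<close> by (auto simp: linf_simps[OF l(1)])
  qed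
  then show ?thesis using l sp by auto
qed

lemma card_independent_bounded: "\<exists>d. \<forall>S. independent S \<longrightarrow> finite S \<and> card S \<le> d"
proof -
  obtain B where "finite B" "span B = UNIV" using fin_dim by blast
  then show ?thesis by (metis independent_span_bound subset_UNIV)
qed

text \<open>Eigenvectors for distinct eigenvalues are independent, also modulo an invariant subspace:
  apply \<open>b - d\<close> to remove the term of the eigenvalue \<open>d\<close> and use induction.\<close>
lemma eigenvectors_mod_sum:
  assumes b: "lin b" and E: "subspace E" and inv: "\<And>v. v \<in> E \<Longrightarrow> b v \<in> E"
    and "finite S" and "\<And>c. c \<in> S \<Longrightarrow> b (v c) - sc c (v c) \<in> E"
    and "(\<Sum>c\<in>S. sc (a c) (v c)) \<in> E" and "c \<in> S"
  shows "sc (a c) (v c) \<in> E"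
  using assms(4-)
proof (induction S arbitrary: a c rule: finite_induct)
  case empty then show ?case by simp
next
  case (insert d S)
  let ?t = "\<Sum>c\<in>insert d S. sc (a c) (v c)"
  have hom: "b (sum g I) = (\<Sum>i\<in>I. b (g i))" for g :: "complex \<Rightarrow> 'w" and I
    using linear_iff_module_hom[of sc sc b] b module_hom.sum by blast
  let ?P = "\<Sum>c\<in>insert d S. sc (a c) (b (v c) - sc c (v c))"
  let ?Q = "\<Sum>c\<in>insert d S. sc (a c * (c - d)) (v c)"
  have t: "b ?t - sc d ?t \<in> E"
    by (rule subspace_diff[OF E inv[OF insert.prems(2)] subspace_scale[OF E insert.prems(2)]])
  have "sc (a c) (b (v c)) - sc d (sc (a c) (v c)) =
      sc (a c) (b (v c) - sc c (v c)) + sc (a c * (c - d)) (v c)" for c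
    by (simp add: scale_right_diff_distrib scale_left_diff_distrib algebra_simps)
  then have "(\<Sum>c\<in>insert d S. sc (a c) (b (v c)) - sc d (sc (a c) (v c))) = ?P + ?Q"
    by (simp only: sum.distrib)
  moreover have "b ?t - sc d ?t = (\<Sum>c\<in>insert d S. sc (a c) (b (v c)) - sc d (sc (a c) (v c)))"
    by (simp only: hom lin_simps[OF b] scale_sum_right sum_subtractf)
  ultimately have Q: "?Q = (b ?t - sc d ?t) - ?P" by (simp only: add_diff_cancel_left')
  have P: "?P \<in> E"
    by (rule subspace_sum[OF E]) (rule subspace_scale[OF E insert.prems(1)])
  have "?Q \<in> E" unfolding Q by (rule subspace_diff[OF E t P])
  then have *: "(\<Sum>c\<in>S. sc (a c * (c - d)) (v c)) \<in> E"
    using insert.hyps by simp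
  have S: "sc (a c) (v c) \<in> E" if "c \<in> S" for c
  proof -
    have "sc (a c * (c - d)) (v c) \<in> E"
      using insert.IH[where a = "\<lambda>c. a c * (c - d)", OF _ * that] insert.prems(1) by auto
    then have "sc (inverse (c - d)) (sc (a c * (c - d)) (v c)) \<in> E" by (rule subspace_scale[OF E])
    moreover have "c - d \<noteq> 0" using that insert.hyps by auto
    then have "inverse (c - d) * (a c * (c - d)) = a c" by simp
    ultimately show ?thesis by (simp only: scale_scale)
  qed
  then have mem: "(\<Sum>c\<in>S. sc (a c) (v c)) \<in> E" by (rule subspace_sum[OF E])
  have "?t = sc (a d) (v d) + (\<Sum>c\<in>S. sc (a c) (v c))" using insert.hyps by simp
  then have "sc (a d) (v d) = ?t - (\<Sum>c\<in>S. sc (a c) (v c))" by simp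
  then have "sc (a d) (v d) \<in> E" using subspace_diff[OF E insert.prems(2) mem] by (simp only:)
  then show ?case using S insert.prems(3) by blast
qed

lemma finite_eigenvalues_mod:
  assumes b: "lin b" and E: "subspace E" and inv: "\<And>v. v \<in> E \<Longrightarrow> b v \<in> E"
  shows "finite {c. \<exists>v. v \<notin> E \<and> b v - sc c v \<in> E}" (is "finite ?C")
proof -
  obtain d where d: "\<And>S. independent S \<Longrightarrow> finite S \<and> card S \<le> d"
    using card_independent_bounded by blast
  have "\<forall>c\<in>?C. \<exists>v. v \<notin> E \<and> b v - sc c v \<in> E" by blast
  then obtain v where v: "\<And>c. c \<in> ?C \<Longrightarrow> v c \<notin> E \<and> b (v c) - sc c (v c) \<in> E"
    by (metis (no_types, lifting))
  have zero: "a c = 0" if "finite S" "S \<subseteq> ?C" "(\<Sum>c\<in>S. sc (a c) (v c)) = 0" "c \<in> S" for S a c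
  proof -
    have "sc (a c) (v c) \<in> E"
      using eigenvectors_mod_sum[OF b E inv that(1) _ _ that(4), of v a] that(2,3) v E
      by (auto simp: subspace_0)
    then have "sc (inverse (a c)) (sc (a c) (v c)) \<in> E" using E by (rule subspace_scale[rotated])
    moreover have "v c \<notin> E" using v that(2,4) by blast
    ultimately show ?thesis by (cases "a c = 0") auto
  qed
  have inj: "inj_on v ?C"
  proof (rule inj_onI, rule ccontr)
    fix c d assume "c \<in> ?C" "d \<in> ?C" "v c = v d" "c \<noteq> d"
    then have "(\<Sum>x\<in>{c, d}. sc (if x = c then 1 else -1) (v x)) = 0" by auto
    from zero[OF _ _ this, of c] show False using \<open>c \<in> ?C\<close> \<open>d \<in> ?C\<close> by auto
  qed
  have card: "card S \<le> d" if S: "S \<subseteq> ?C" "finite S" for S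
  proof -
    have injS: "inj_on v S" using inj S(1) inj_on_subset by blast
    have "independent (v ` S)"
    proof (rule independent_if_scalars_zero)
      show "finite (v ` S)" using S by simp
      fix f x assume f: "(\<Sum>x\<in>v ` S. sc (f x) x) = 0" "x \<in> v ` S"
      then have "(\<Sum>c\<in>S. sc (f (v c)) (v c)) = 0" by (simp add: sum.reindex[OF injS])
      from zero[OF S(2,1) this] f(2) show "f x = 0" by blast
    qed
    then show ?thesis using d card_image[OF injS] by metis
  qed
  show ?thesis
    using finite_if_finite_subsets_card_bdd[of ?C d, OF card] by blast
qed

definition poly_act :: "('w \<Rightarrow> 'w) \<Rightarrow> complex poly \<Rightarrow> 'w \<Rightarrow> 'w" where
  "poly_act b p v = (\<Sum>i\<le>degree p. sc (coeff p i) ((b ^^ i) v))"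

lemma poly_act_eq:
  assumes "degree p \<le> n"
  shows "poly_act b p v = (\<Sum>i\<le>n. sc (coeff p i) ((b ^^ i) v))"
  unfolding poly_act_def
  using assms by (intro sum.mono_neutral_left) (auto simp: coeff_eq_0)

lemma poly_act_linear_factor:
  assumes b: "lin b"
  shows "poly_act b ([:- c, 1:] * q) v = b (poly_act b q v) - sc c (poly_act b q v)"
proof -
  define n where "n = degree q"
  have hom: "b (sum g I) = (\<Sum>i\<in>I. b (g i))" for g :: "nat \<Rightarrow> 'w" and I
    using linear_iff_module_hom[of sc sc b] b module_hom.sum by blast
  have deg: "degree ([:- c, 1:] * q) \<le> Suc n"
    using degree_mult_le[of "[:- c, 1:]" q] by (simp add: n_def)
  have co: "coeff ([:- c, 1:] * q) i = (case i of 0 \<Rightarrow> 0 | Suc j \<Rightarrow> coeff q j) - c * coeff q i" for i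
    by (simp add: coeff_pCons split: nat.split)
  have "poly_act b ([:- c, 1:] * q) v =
    (\<Sum>i\<le>Suc n. sc (case i of 0 \<Rightarrow> 0 | Suc j \<Rightarrow> coeff q j) ((b ^^ i) v)) -
    (\<Sum>i\<le>Suc n. sc c (sc (coeff q i) ((b ^^ i) v)))"
    unfolding poly_act_eq[OF deg] co
    by (simp only: scale_left_diff_distrib sum_subtractf scale_scale)
  also have "(\<Sum>i\<le>Suc n. sc (case i of 0 \<Rightarrow> 0 | Suc j \<Rightarrow> coeff q j) ((b ^^ i) v)) = b (poly_act b q v)"
    unfolding sum.atMost_Suc_shift poly_act_def n_def by (simp add: hom lin_simps[OF b])
  also have "(\<Sum>i\<le>Suc n. sc c (sc (coeff q i) ((b ^^ i) v))) = sc c (poly_act b q v)"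
    by (subst poly_act_eq[of q "Suc n" b v]) (simp_all add: scale_sum_right scale_right_distrib n_def)
  finally show ?thesis .
qed

lemma poly_act_nonzero_relation:
  "\<exists>q. q \<noteq> 0 \<and> poly_act b q v = 0"
proof -
  obtain d where d: "\<And>S. independent S \<Longrightarrow> finite S \<and> card S \<le> d"
    using card_independent_bounded by blast
  define w where "w i = (b ^^ i) v" for i
  show ?thesis
  proof (cases "inj_on w {..d}")
    case False
    then obtain i j where ij: "w i = w j" "i \<noteq> j" unfolding inj_on_def by blast
    define q :: "complex poly" where "q = monom 1 i - monom 1 j"
    have "coeff q i = 1" using ij by (simp add: q_def)
    then have "q \<noteq> 0" by auto
    have "degree q \<le> max i j" unfolding q_def
      by (intro degree_diff_le) (auto intro: order_trans[OF degree_monom_le])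
    then have "poly_act b q v = (\<Sum>k\<le>max i j. sc (coeff q k) (w k))"
      unfolding w_def by (rule poly_act_eq)
    also have "\<dots> = (\<Sum>k\<in>{i, j}. sc (coeff q k) (w k))"
      by (intro sum.mono_neutral_right) (auto simp: q_def)
    also have "\<dots> = 0" using ij by (simp add: q_def)
    finally show ?thesis using \<open>q \<noteq> 0\<close> by blast
  next
    case True
    then have "card (w ` {..d}) = Suc d" by (simp add: card_image)
    then have "\<not> independent (w ` {..d})" using d by fastforce
    then obtain S u x where S: "finite S" "S \<subseteq> w ` {..d}" "(\<Sum>x\<in>S. sc (u x) x) = 0" "x \<in> S" "u x \<noteq> 0"
      unfolding dependent_explicit by blast
    define a where "a i = (if w i \<in> S then u (w i) else 0)" for i
    define q :: "complex poly" where "q = (\<Sum>i\<le>d. monom (a i) i)"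
    have co: "coeff q i = (if i \<le> d then a i else 0)" for i
      unfolding q_def by (simp add: coeff_sum sum.delta' if_distrib cong: if_cong)
    obtain i where "i \<le> d" "w i = x" using S by blast
    then have "coeff q i \<noteq> 0" using S by (simp add: co a_def)
    then have "q \<noteq> 0" by auto
    have "degree q \<le> d" by (rule degree_le) (simp add: co)
    then have "poly_act b q v = (\<Sum>k\<le>d. sc (coeff q k) (w k))"
      unfolding w_def by (rule poly_act_eq)
    also have "\<dots> = (\<Sum>k\<le>d. (\<lambda>x. sc (if x \<in> S then u x else 0) x) (w k))"
      by (rule sum.cong) (auto simp: co a_def)
    also have "\<dots> = (\<Sum>x\<in>w ` {..d}. sc (if x \<in> S then u x else 0) x)"
      by (simp add: sum.reindex[OF True])
    also have "\<dots> = (\<Sum>x\<in>S. sc (if x \<in> S then u x else 0) x)"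
      using S by (intro sum.mono_neutral_right) auto
    also have "\<dots> = 0" using S(3) by simp
    finally show ?thesis using \<open>q \<noteq> 0\<close> by blast
  qed
qed

lemma poly_act_mem:
  assumes "subspace Z" and "\<And>v. v \<in> Z \<Longrightarrow> b v \<in> Z" and "v \<in> Z"
  shows "poly_act b q v \<in> Z"
proof -
  have "(b ^^ i) v \<in> Z" for i using assms by (induction i) auto
  then show ?thesis unfolding poly_act_def by (auto intro!: subspace_sum subspace_scale assms(1))
qed

text \<open>Take a nonzero polynomial of least degree that sends \<open>v\<close> into \<open>E\<close>. It has a root \<open>c\<close>, and
  dividing by the corresponding linear factor leaves a polynomial that sends \<open>v\<close> to an
  eigenvector modulo \<open>E\<close>.\<close>
lemma eigenvector_mod_exists:
  assumes b: "lin b" and E: "subspace E" 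
    and Z: "subspace Z" "\<And>v. v \<in> Z \<Longrightarrow> b v \<in> Z" and v: "v \<in> Z" "v \<notin> E"
  shows "\<exists>u c. u \<in> Z \<and> u \<notin> E \<and> b u - sc c u \<in> E"
proof -
  define P where "P q \<longleftrightarrow> q \<noteq> 0 \<and> poly_act b q v \<in> E" for q
  have ex: "\<exists>q. P q" using poly_act_nonzero_relation[of b v] E by (auto simp: P_def subspace_0)
  obtain q where q: "P q" and min: "\<And>r. P r \<Longrightarrow> degree q \<le> degree r"
    using ex ex_has_least_nat[of P _ degree] by blast
  have "degree q \<noteq> 0"
  proof
    assume "degree q = 0"
    then obtain a where a: "q = [:a:]" by (meson degree_eq_zeroE)
    then have "a \<noteq> 0" "sc a v \<in> E" using q by (auto simp: P_def poly_act_def)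
    with subspace_scale[OF E \<open>sc a v \<in> E\<close>, of "inverse a"] show False using v by simp
  qed
  then have "\<not> constant (poly q)" by (simp add: constant_degree)
  then obtain c where "poly q c = 0" using fundamental_theorem_of_algebra by blast
  then obtain r where r: "q = [:- c, 1:] * r" using poly_eq_0_iff_dvd by (metis dvdE)
  then have "r \<noteq> 0" using q by (auto simp: P_def)
  then have "degree q = Suc (degree r)" unfolding r
    by (subst degree_mult_eq) auto
  then have "\<not> P r" using min by fastforce
  then have "poly_act b r v \<notin> E" using \<open>r \<noteq> 0\<close> by (simp add: P_def)
  moreover have "b (poly_act b r v) - sc c (poly_act b r v) \<in> E"
    using q poly_act_linear_factor[OF b, of c r v] by (simp add: P_def r)
  ultimately show ?thesis using poly_act_mem[of Z b v r, OF Z v(1)] by blast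
qed

section \<open>The theorem of Lie and Kolchin\<close>

text \<open>Used to pass to a subspace that is irreducible modulo \<open>E\<close>.\<close>
lemma minimal_subspace_satisfying:
  assumes "subspace Y" "P Y"
  shows "\<exists>Z. subspace Z \<and> P Z \<and> (\<forall>Z'. subspace Z' \<longrightarrow> P Z' \<longrightarrow> Z' \<subseteq> Z \<longrightarrow> Z' = Z)"
proof -
  obtain B where B: "finite B" "span B = UNIV" using fin_dim by blast
  obtain C where C: "C \<subseteq> B" "independent C" "B \<subseteq> span C"
    using maximal_independent_subset by blast
  interpret F: finite_dimensional_vector_space sc C
    by unfold_locales (use B C span_minimal[of B "span C"] in \<open>auto intro: finite_subset\<close>)
  obtain Z where Z: "subspace Z \<and> P Z" "\<And>Z'. subspace Z' \<and> P Z' \<Longrightarrow> dim Z \<le> dim Z'"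
    using ex_has_least_nat[of "\<lambda>Z. subspace Z \<and> P Z" Y dim] assms by blast
  have "Z' = Z" if "subspace Z'" "P Z'" "Z' \<subseteq> Z" for Z'
    using F.subspace_dim_equal[of Z' Z] that Z by blast
  then show ?thesis using Z(1) by blast
qed

lemma subspace_eigenspace_mod:
  assumes E: "subspace E" and Z: "subspace Z" and b: "\<And>i. i \<in> I \<Longrightarrow> lin (b i)"
  shows "subspace {v \<in> Z. \<forall>i\<in>I. b i v - sc (c i) v \<in> E}" (is "subspace ?W")
proof (rule subspaceI)
  show "0 \<in> ?W" using Z E by (auto simp: subspace_0 lin_simps[OF b])
next
  fix x y assume xy: "x \<in> ?W" "y \<in> ?W"
  have "b i (x + y) - sc (c i) (x + y) = (b i x - sc (c i) x) + (b i y - sc (c i) y)" if "i \<in> I" for i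
    by (simp add: lin_simps[OF b[OF that]] scale_right_distrib)
  then show "x + y \<in> ?W" using xy Z E by (simp add: subspace_add)
next
  fix d x assume x: "x \<in> ?W"
  have "b i (sc d x) - sc (c i) (sc d x) = sc d (b i x - sc (c i) x)" if "i \<in> I" for i
    by (simp add: lin_simps[OF b[OF that]] scale_right_diff_distrib mult.commute)
  then show "sc d x \<in> ?W" using x Z E by (simp add: subspace_scale)
qed

text \<open>The theorem of Lie and Kolchin for continuous actions, relative to an invariant subspace
  \<open>E\<close> so that no quotient spaces have to be formed. Choose \<open>Z\<close> minimal among the invariant
  subspaces of \<open>Y\<close> properly containing \<open>E\<close>. By induction on the derived length, the derived
  group \<open>N'\<close> has a common eigenvector in \<open>Z\<close>, with character \<open>\<kappa>\<close>. Both steps that follow use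
  that a continuous function on the connected group \<open>N\<close> with values in a finite set of
  eigenvalues is constant: first, \<open>\<kappa>\<close> is invariant under conjugation by \<open>N\<close>, so its eigenspace
  is invariant and equals \<open>Z\<close>; secondly, \<open>\<kappa>\<close> is 1 on commutators. Thus \<open>N\<close> acts commutatively on
  \<open>Z\<close> modulo \<open>E\<close>, and by minimality every element acts as a scalar.\<close>
theorem common_eigenvector_mod:
  fixes G (structure)
  assumes G: "group G" and top: "topspace X = carrier G"
    and mul: "continuous_map (prod_topology X X) X (\<lambda>(x, y). x \<otimes> y)"
    and inverse: "continuous_map X X (\<lambda>x. inv x)"
    and T: "\<And>g. g \<in> carrier G \<Longrightarrow> lin (T g)"
    and T_mult: "\<And>g h v. g \<in> carrier G \<Longrightarrow> h \<in> carrier G \<Longrightarrow> T (g \<otimes> h) v = T g (T h v)"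
    and T_one: "\<And>v. T \<one> v = v"
    and cont: "\<And>l v. linf l \<Longrightarrow> continuous_map X euclidean (\<lambda>g. l (T g v))"
    and E: "subspace E"
  shows "subgroup N G \<Longrightarrow> connectedin X N \<Longrightarrow> (derived G ^^ m) N = {\<one>} \<Longrightarrow>
    (\<And>g v. g \<in> N \<Longrightarrow> v \<in> E \<Longrightarrow> T g v \<in> E) \<Longrightarrow> subspace Y \<Longrightarrow> E \<subset> Y \<Longrightarrow>
    (\<And>g v. g \<in> N \<Longrightarrow> v \<in> Y \<Longrightarrow> T g v \<in> Y) \<Longrightarrow>
    \<exists>u \<kappa>. u \<in> Y \<and> u \<notin> E \<and> (\<forall>g\<in>N. T g u - sc (\<kappa> g) u \<in> E)"
proof (induction m arbitrary: N Y)
  case 0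
  then obtain v where "v \<in> Y" "v \<notin> E" by blast
  moreover have "T \<one> v - sc 1 v \<in> E" using E by (simp add: T_one subspace_0)
  moreover have "N = {\<one>}" using 0 by simp
  ultimately show ?case by (intro exI[of _ v] exI[of _ "\<lambda>_. 1"]) auto
next
  case (Suc m)
  interpret group G by (rule G)
  define N' where "N' = derived G N"
  have NG: "N \<subseteq> carrier G" using Suc.prems(1) by (rule subgroup.subset)
  have oneN: "\<one> \<in> N" using Suc.prems(1) by (rule subgroup.one_closed)
  have invN: "inv g \<in> N" if "g \<in> N" for g using Suc.prems(1) that by (rule subgroup.m_inv_closed)
  have mN: "g \<otimes> h \<in> N" if "g \<in> N" "h \<in> N" for g h using Suc.prems(1) that by (rule subgroup.m_closed)
  have sub': "subgroup N' G" unfolding N'_def by (rule derived_is_subgroup[OF NG])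
  have N'N: "N' \<subseteq> N" unfolding N'_def by (rule derived_incl[OF order_refl Suc.prems(1)])
  have conn': "connectedin X N'" unfolding N'_def
    by (rule connectedin_derived[OF top mul inverse Suc.prems(2) oneN])
  have der': "(derived G ^^ m) N' = {\<one>}" using Suc.prems(3)
    by (simp add: N'_def funpow_swap1)
  have comm_mem: "a \<otimes> b \<otimes> inv a \<otimes> inv b \<in> N'" if "a \<in> N" "b \<in> N" for a b
    using that unfolding N'_def derived_def by (intro generate.incl) blast
  define P where "P Z \<longleftrightarrow> E \<subset> Z \<and> Z \<subseteq> Y \<and> (\<forall>g\<in>N. \<forall>v\<in>Z. T g v \<in> Z)" for Z
  have "P Y" using Suc.prems(6,7) by (auto simp: P_def)
  then obtain Z where Z: "subspace Z" "P Z"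
    and min: "\<And>Z'. subspace Z' \<Longrightarrow> P Z' \<Longrightarrow> Z' \<subseteq> Z \<Longrightarrow> Z' = Z"
    using minimal_subspace_satisfying[OF Suc.prems(5), of P] by metis
  have EZ: "E \<subset> Z" and ZY: "Z \<subseteq> Y" and TZ: "\<And>g v. g \<in> N \<Longrightarrow> v \<in> Z \<Longrightarrow> T g v \<in> Z"
    using Z(2) by (auto simp: P_def)
  note TE = Suc.prems(4)
  have T_not_E: "T g v \<notin> E" if "g \<in> N" "v \<notin> E" for g v
  proof
    assume "T g v \<in> E"
    then have "T (inv g) (T g v) \<in> E" using TE invN that by blast
    then show False using that NG by (simp add: T_mult[symmetric] T_one subset_iff)
  qed
  obtain v0 \<kappa> where v0: "v0 \<in> Z" "v0 \<notin> E" and \<kappa>: "\<And>n. n \<in> N' \<Longrightarrow> T n v0 - sc (\<kappa> n) v0 \<in> E"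
    using Suc.IH[OF sub' conn' der' _ Z(1) EZ] TE TZ N'N by blast
  obtain l where l: "linf l" "\<And>x. x \<in> E \<Longrightarrow> l x = 0" "l v0 = 1"
    using functional_separates[OF E v0(2)] by blast
  have \<kappa>_l: "\<kappa> n = l (T n v0)" if "n \<in> N'" for n
    using l(2)[OF \<kappa>[OF that]] by (simp add: linf_simps[OF l(1)] l(3))
  have mult_map: "continuous_map X X (\<lambda>z. f z \<otimes> g z)"
    if "continuous_map X X f" "continuous_map X X g" for f g
    using continuous_map_compose[OF continuous_map_pairedI[OF that] mul] by (simp add: o_def)
  have inv_map: "continuous_map X X (\<lambda>z. inv (f z))" if "continuous_map X X f" for f
    using continuous_map_compose[OF that inverse] by (simp add: o_def)
  have const: "f a = f b"
    if "continuous_map X X k" "\<And>g. g \<in> N \<Longrightarrow> k g \<in> N' \<and> f g = \<kappa> (k g)" "finite (f ` N)" "a \<in> N" "b \<in> N"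
    for f k a b
  proof -
    have "continuous_map X euclidean (\<lambda>g. l (T (k g) v0))"
      using continuous_map_compose[OF that(1) cont[OF l(1)]] by (simp add: o_def)
    then have c: "continuous_map (subtopology X N) euclidean (\<lambda>g. l (T (k g) v0))"
      by (rule continuous_map_from_subtopology)
    have eq: "l (T (k g) v0) = f g" if "g \<in> N" for g
      using \<kappa>_l that \<open>\<And>g. g \<in> N \<Longrightarrow> k g \<in> N' \<and> f g = \<kappa> (k g)\<close> by simp
    then have "(\<lambda>g. l (T (k g) v0)) ` N = f ` N" by force
    then show ?thesis
      using continuous_finite_range_constant[OF Suc.prems(2) c _ that(4,5)] that(3) eq that(4,5)
      by simp
  qed
  have conj_mem: "inv g \<otimes> n \<otimes> g \<in> N'" if "g \<in> N" "n \<in> N'" for g n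
  proof -
    have gn: "g \<in> carrier G" "n \<in> carrier G" using that N'N NG by auto
    have "inv n \<otimes> inv g \<otimes> inv (inv n) \<otimes> inv (inv g) \<in> N'"
      using comm_mem invN that N'N by blast
    then have "n \<otimes> (inv n \<otimes> inv g \<otimes> inv (inv n) \<otimes> inv (inv g)) \<in> N'"
      using sub' that(2) by (simp add: subgroup.m_closed)
    moreover have "n \<otimes> (inv n \<otimes> inv g \<otimes> inv (inv n) \<otimes> inv (inv g)) = inv g \<otimes> n \<otimes> g"
      using gn by (simp add: m_assoc[symmetric])
    ultimately show ?thesis by simp
  qed
  \<comment> \<open>Conjugates of a weight are eigenvalues of one operator, hence equal by connectedness.\<close>
  have conj: "\<kappa> (inv g \<otimes> n \<otimes> g) = \<kappa> n" if g: "g \<in> N" and n: "n \<in> N'" for g n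
  proof -
    let ?f = "\<lambda>g. \<kappa> (inv g \<otimes> n \<otimes> g)"
    have nG: "n \<in> carrier G" using n N'N NG by blast
    have nN: "n \<in> N" using n N'N by blast
    have "?f g \<in> {c. \<exists>v. v \<notin> E \<and> T n v - sc c v \<in> E}" if g: "g \<in> N" for g
    proof -
      have gG: "g \<in> carrier G" using g NG by blast
      let ?k = "inv g \<otimes> n \<otimes> g"
      have "T g (T ?k v0 - sc (\<kappa> ?k) v0) \<in> E" using TE[OF g \<kappa>[OF conj_mem[OF g n]]] .
      moreover have "T g (T ?k v0) = T n (T g v0)"
        using gG nG by (simp add: T_mult[symmetric] m_assoc[symmetric])
      ultimately have "T n (T g v0) - sc (?f g) (T g v0) \<in> E"
        by (simp add: lin_simps[OF T[OF gG]])
      then show ?thesis using T_not_E[OF g v0(2)] by blast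
    qed
    then have fin: "finite (?f ` N)"
      using finite_eigenvalues_mod[OF T[OF nG] E TE[OF nN]]
      by (meson finite_subset image_subsetI)
    have "continuous_map X X (\<lambda>g. inv g \<otimes> n \<otimes> g)"
      using nG top by (intro mult_map inv_map) auto
    from const[OF this _ fin g oneN] have "?f g = ?f \<one>" using conj_mem n by blast
    then show ?thesis using nG by simp
  qed
  define W where "W = {v \<in> Z. \<forall>n\<in>N'. T n v - sc (\<kappa> n) v \<in> E}"
  have TnG: "lin (T g)" if "g \<in> N" for g using T that NG by blast
  have "subspace W" unfolding W_def
    by (rule subspace_eigenspace_mod[OF E Z(1)]) (use TnG N'N in blast)
  moreover have "P W"
  proof -
    have "E \<subseteq> W"
    proof
      fix x assume x: "x \<in> E"
      have "T n x - sc (\<kappa> n) x \<in> E" if "n \<in> N'" for n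
        using x that TE N'N E by (intro subspace_diff subspace_scale) auto
      then show "x \<in> W" using x EZ by (auto simp: W_def)
    qed
    moreover have "v0 \<in> W" using v0 \<kappa> by (simp add: W_def)
    moreover have "T g v \<in> W" if g: "g \<in> N" and v: "v \<in> W" for g v
    proof -
      have gG: "g \<in> carrier G" using g NG by blast
      have "T n (T g v) - sc (\<kappa> n) (T g v) \<in> E" if n: "n \<in> N'" for n
      proof -
        have nG: "n \<in> carrier G" using n N'N NG by blast
        let ?k = "inv g \<otimes> n \<otimes> g"
        have "T ?k v - sc (\<kappa> ?k) v \<in> E" using v conj_mem[OF g n] by (simp add: W_def)
        then have "T g (T ?k v - sc (\<kappa> n) v) \<in> E" using TE[OF g] conj[OF g n] by simp
        moreover have "T g (T ?k v) = T n (T g v)"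
          using gG nG by (simp add: T_mult[symmetric] m_assoc[symmetric])
        ultimately show ?thesis by (simp add: lin_simps[OF TnG[OF g]])
      qed
      then show ?thesis using TZ g v by (simp add: W_def)
    qed
    moreover have "W \<subseteq> Z" by (auto simp: W_def)
    ultimately show ?thesis using v0 ZY unfolding P_def by blast
  qed
  moreover have "W \<subseteq> Z" by (auto simp: W_def)
  ultimately have "W = Z" by (rule min)
  then have \<kappa>Z: "T n v - sc (\<kappa> n) v \<in> E" if "v \<in> Z" "n \<in> N'" for v n
    using that by (auto simp: W_def)
  have eig: "\<exists>u c. u \<in> Z \<and> u \<notin> E \<and> T b u - sc c u \<in> E" if b: "b \<in> N" for b
    using eigenvector_mod_exists[OF TnG[OF b] E Z(1) TZ[OF b] v0] .
  have ba: "a \<otimes> b = (a \<otimes> b \<otimes> inv a \<otimes> inv b) \<otimes> (b \<otimes> a)" if "a \<in> N" "b \<in> N" for a b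
  proof -
    have G: "a \<in> carrier G" "b \<in> carrier G" using that NG by auto
    then have "inv b \<otimes> (b \<otimes> a) = a" by (simp add: m_assoc[symmetric])
    then show ?thesis using G by (simp add: m_assoc)
  qed
  have split: "T a (T b v) = T (a \<otimes> b \<otimes> inv a \<otimes> inv b) (T b (T a v))" if "a \<in> N" "b \<in> N" for a b v
  proof -
    have G: "a \<in> carrier G" "b \<in> carrier G" using that NG by auto
    have "T (a \<otimes> b) v = T ((a \<otimes> b \<otimes> inv a \<otimes> inv b) \<otimes> (b \<otimes> a)) v" using ba[OF that] by simp
    then show ?thesis using G by (simp add: T_mult)
  qed
  have \<kappa>1: "\<kappa> \<one> = 1" using \<kappa>_l[of \<one>] sub' by (simp add: subgroup.one_closed T_one l(3))
  \<comment> \<open>A commutator acts by a scalar that permutes the eigenvalues of \<open>b\<close>.\<close>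
  have comm: "\<kappa> (a \<otimes> b \<otimes> inv a \<otimes> inv b) = 1" if a: "a \<in> N" and b: "b \<in> N" for a b
  proof -
    let ?f = "\<lambda>a. \<kappa> (a \<otimes> b \<otimes> inv a \<otimes> inv b)"
    let ?C = "{c. \<exists>v. v \<notin> E \<and> T b v - sc c v \<in> E}"
    have bG: "b \<in> carrier G" using b NG by blast
    obtain u \<beta> where u: "u \<in> Z" "u \<notin> E" "T b u - sc \<beta> u \<in> E" using eig[OF b] by blast
    have \<beta>: "\<beta> \<noteq> 0" using u(3) T_not_E[OF b u(2)] by auto
    have f: "?f a \<in> (\<lambda>x. \<beta> / x) ` ?C" if a: "a \<in> N" for a
    proof -
      let ?c = "a \<otimes> b \<otimes> inv a \<otimes> inv b"
      let ?w = "T a u"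
      have c: "?c \<in> N'" using comm_mem[OF a b] .
      have "T a (T b u - sc \<beta> u) \<in> E" using TE[OF a u(3)] .
      then have 1: "T a (T b u) - sc \<beta> ?w \<in> E" by (simp add: lin_simps[OF TnG[OF a]])
      have 2: "T a (T b u) - sc (\<kappa> ?c) (T b ?w) \<in> E"
        unfolding split[OF a b] using \<kappa>Z[OF TZ[OF b TZ[OF a u(1)]] c] .
      have "\<kappa> ?c \<noteq> 0"
      proof
        assume "\<kappa> ?c = 0"
        then have "T ?c v0 \<in> E" using \<kappa>[OF c] by simp
        then show False using T_not_E v0(2) c N'N by blast
      qed
      moreover have 3: "sc (\<kappa> ?c) (T b ?w) - sc \<beta> ?w \<in> E"
        using subspace_diff[OF E 1 2] by simp
      ultimately have "T b ?w - sc (\<beta> / \<kappa> ?c) ?w \<in> E"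
        using subspace_scale[OF E 3, of "inverse (\<kappa> ?c)"]
        by (simp add: scale_right_diff_distrib field_simps)
      then have "\<beta> / \<kappa> ?c \<in> ?C" using T_not_E[OF a u(2)] by blast
      moreover have "\<kappa> ?c = \<beta> / (\<beta> / \<kappa> ?c)" using \<beta> by simp
      ultimately show ?thesis by blast
    qed
    then have fin: "finite (?f ` N)"
      using finite_imageI[OF finite_eigenvalues_mod[OF T[OF bG] E TE[OF b]], of "\<lambda>x. \<beta> / x"]
      by (meson finite_subset image_subsetI)
    have "continuous_map X X (\<lambda>a. a \<otimes> b \<otimes> inv a \<otimes> inv b)"
      using bG top by (intro mult_map inv_map) auto
    from const[OF this _ fin a oneN] have "?f a = ?f \<one>" using comm_mem b by blast
    then show ?thesis using bG \<kappa>1 by simp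
  qed
  have commute: "T a (T b v) - T b (T a v) \<in> E" if "a \<in> N" "b \<in> N" "v \<in> Z" for a b v
    using \<kappa>Z[OF TZ[OF that(2) TZ[OF that(1,3)]] comm_mem[OF that(1,2)]]
    by (simp add: split[OF that(1,2)] comm[OF that(1,2)])
  have "\<exists>\<beta>. T b v0 - sc \<beta> v0 \<in> E" if b: "b \<in> N" for b
  proof -
    obtain u \<beta> where u: "u \<in> Z" "u \<notin> E" "T b u - sc \<beta> u \<in> E" using eig[OF b] by blast
    define W where "W = {v \<in> Z. T b v - sc \<beta> v \<in> E}"
    have "subspace W"
      using subspace_eigenspace_mod[OF E Z(1), of "{b}" T "\<lambda>_. \<beta>"] TnG[OF b] by (simp add: W_def)
    moreover have "P W"
    proof -
      have "E \<subseteq> W"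
      proof
        fix x assume x: "x \<in> E"
        have "T b x - sc \<beta> x \<in> E"
          by (rule subspace_diff[OF E TE[OF b x] subspace_scale[OF E x]])
        then show "x \<in> W" using x EZ by (auto simp: W_def)
      qed
      moreover have "u \<in> W" using u by (simp add: W_def)
      moreover have "T a v \<in> W" if a: "a \<in> N" and v: "v \<in> W" for a v
      proof -
        have vZ: "v \<in> Z" using v by (simp add: W_def)
        have "T a (T b v - sc \<beta> v) \<in> E" using v TE[OF a] by (simp add: W_def)
        then have 1: "T a (T b v) - sc \<beta> (T a v) \<in> E" by (simp add: lin_simps[OF TnG[OF a]])
        have "T b (T a v) - sc \<beta> (T a v) \<in> E"
          using subspace_diff[OF E 1 commute[OF a b vZ]] by simp
        then show ?thesis using TZ[OF a vZ] by (simp add: W_def)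
      qed
      moreover have "W \<subseteq> Z" by (auto simp: W_def)
      ultimately show ?thesis using u ZY unfolding P_def by blast
    qed
    moreover have "W \<subseteq> Z" by (auto simp: W_def)
    ultimately have "W = Z" by (rule min)
    then show ?thesis using v0(1) by (auto simp: W_def)
  qed
  then obtain \<beta> where "\<And>b. b \<in> N \<Longrightarrow> T b v0 - sc (\<beta> b) v0 \<in> E" by metis
  then show ?case using v0 ZY by blast
qed

end

text \<open>A basis given with its coordinate functionals. The flag that it spans is \<open>E\<close> below, and
  \<open>diag j\<close> is a character on upper triangular operators.\<close>
locale dual_basis = complex_fin_dim sc
  for sc :: "complex \<Rightarrow> 'w::ab_group_add \<Rightarrow> 'w" +
  fixes e :: "nat \<Rightarrow> 'w" and l :: "nat \<Rightarrow> 'w \<Rightarrow> complex" and n :: nat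
  assumes l_lin: "i < n \<Longrightarrow> linf (l i)"
    and l_dual: "i < n \<Longrightarrow> j < n \<Longrightarrow> l i (e j) = (if i = j then 1 else 0)"
    and expand: "v = (\<Sum>i<n. sc (l i v) (e i))"
begin

definition upper :: "('w \<Rightarrow> 'w) \<Rightarrow> bool" where
  "upper a \<longleftrightarrow> (\<forall>j<n. \<forall>i<n. j < i \<longrightarrow> l i (a (e j)) = 0)"

definition diag :: "nat \<Rightarrow> ('w \<Rightarrow> 'w) \<Rightarrow> complex" where
  "diag j a = l j (a (e j))"

lemma apply_expand:
  assumes "linf f" shows "f v = (\<Sum>i<n. l i v * f (e i))"
  by (subst expand[of v]) (simp add: linf_simps[OF assms])

lemma polynomial_diag: "j < n \<Longrightarrow> polynomial_fun sc (diag j)"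
  unfolding diag_def[abs_def] using l_lin by (rule polynomial_fun.coefficient)

lemma diag_mult:
  assumes a: "upper a" "lin a" and b: "upper b" and j: "j < n"
  shows "diag j (a \<circ> b) = diag j a * diag j b"
proof -
  have la: "linf (\<lambda>v. l j (a v))"
    using Vector_Spaces.linear_compose[OF a(2) l_lin[OF j]] by (simp add: o_def)
  have "diag j (a \<circ> b) = (\<Sum>i<n. l i (b (e j)) * l j (a (e i)))"
    unfolding diag_def o_def by (rule apply_expand[OF la])
  also have "\<dots> = (\<Sum>i<n. if i = j then diag j a * diag j b else 0)"
    using a b j unfolding upper_def diag_def
    by (intro sum.cong) (auto, metis linorder_neqE_nat)
  finally show ?thesis using j by simp
qed

definition E :: "nat \<Rightarrow> 'w set" where "E j = span (e ` {..<j})"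

lemma E_mono: "i \<le> j \<Longrightarrow> E i \<subseteq> E j"
  unfolding E_def by (intro span_mono image_mono) auto

lemma subspace_E: "subspace (E j)" by (simp add: E_def)

lemma mem_E: 
  assumes "j \<le> n" shows "v \<in> E j \<longleftrightarrow> (\<forall>i<n. j \<le> i \<longrightarrow> l i v = 0)"
proof
  assume "v \<in> E j"
  then show "\<forall>i<n. j \<le> i \<longrightarrow> l i v = 0"
    unfolding E_def
  proof (induction rule: span_induct_alt)
    case base then show ?case using l_lin by (simp add: linf_simps)
  next
    case (step c x y)
    then show ?case using l_lin l_dual assms by (auto simp: linf_simps)
  qed
next
  assume z: "\<forall>i<n. j \<le> i \<longrightarrow> l i v = 0"
  have "sc (l i v) (e i) \<in> E j" if "i < n" for i
  proof (cases "i < j")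
    case True then show ?thesis unfolding E_def by (intro span_scale span_base) auto
  next
    case False then show ?thesis using z that by (simp add: subspace_0[OF subspace_E])
  qed
  then have "(\<Sum>i<n. sc (l i v) (e i)) \<in> E j" by (intro subspace_sum[OF subspace_E]) auto
  then show "v \<in> E j" by (subst expand[of v])
qed

lemma upper_iff: "upper a \<longleftrightarrow> (\<forall>j<n. a (e j) \<in> E (Suc j))"
  unfolding upper_def using mem_E by (metis Suc_leI Suc_le_eq)

lemma upper_E:
  assumes "upper a" "lin a" "j \<le> n" "v \<in> E j" shows "a v \<in> E j"
  using assms(4) unfolding E_def
proof (induction rule: span_induct_alt)
  case base then show ?case by (simp add: lin_simps[OF assms(2)] span_zero)
next
  case (step c x y)
  then obtain i where i: "x = e i" "i < j" by auto
  then have "a x \<in> E (Suc i)" using assms(1,3) by (simp add: upper_iff)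
  then have "a x \<in> E j" using E_mono[of "Suc i" j] i by auto
  then show ?case using step.IH
    by (simp add: lin_simps[OF assms(2)] span_add span_scale E_def)
qed

lemma upper_diag_E:
  assumes "upper a" "lin a" "j < n" "v \<in> E (Suc j)" shows "a v - sc (diag j a) v \<in> E j"
proof -
  have j: "Suc j \<le> n" "j \<le> n" using assms by auto
  have av: "a v \<in> E (Suc j)" by (rule upper_E[OF assms(1,2) j(1) assms(4)])
  have "l j (a v) = diag j a * l j v"
  proof -
    have la: "linf (\<lambda>v. l j (a v))"
      using Vector_Spaces.linear_compose[OF assms(2) l_lin[OF assms(3)]] by (simp add: o_def)
    have "l j (a v) = (\<Sum>i<n. l i v * l j (a (e i)))" by (rule apply_expand[OF la])
    also have "\<dots> = (\<Sum>i<n. if i = j then diag j a * l j v else 0)"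
    proof (rule sum.cong)
      fix i assume i: "i \<in> {..<n}"
      show "l i v * l j (a (e i)) = (if i = j then diag j a * l j v else 0)"
      proof (cases i j rule: linorder_cases)
        case less then show ?thesis using assms(1,3) i by (simp add: upper_def)
      next
        case equal then show ?thesis by (simp add: diag_def)
      next
        case greater
        then have "l i v = 0" using assms(4) i mem_E[OF j(1)] by simp
        then show ?thesis using greater by simp
      qed
    qed simp
    finally show ?thesis using assms(3) by simp
  qed
  then have "l i (a v - sc (diag j a) v) = 0" if "i < n" "j \<le> i" for i
    using that av assms(4) mem_E[OF j(1)] l_lin[OF that(1)]
    by (cases "i = j") (auto simp: linf_simps)
  then show ?thesis using mem_E[OF j(2)] by blast
qed

text \<open>If the diagonal entries before \<open>j\<close> are nonzero, \<open>a\<close> maps \<open>E j\<close> onto itself; were the entry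
  at \<open>j\<close> zero, \<open>a (e j)\<close> would be in \<open>E j\<close> as well, against injectivity.\<close>
lemma diag_nonzero:
  assumes a: "upper a" "lin a" "inj a" and j: "j < n"
  shows "diag j a \<noteq> 0"
proof -
  have step: "diag j a \<noteq> 0" if j: "j < n" and sur: "E j \<subseteq> a ` E j" for j
  proof
    assume "diag j a = 0"
    moreover have "e j \<in> E (Suc j)" unfolding E_def by (intro span_base) auto
    ultimately have "a (e j) \<in> E j" using upper_diag_E[OF a(1,2) j, of "e j"] by simp
    then obtain u where "u \<in> E j" "a (e j) = a u" using sur by blast
    then have "e j \<in> E j" using injD[OF a(3), of "e j" u] by simp
    then have "l j (e j) = 0" using mem_E[of j "e j"] j by auto
    then show False using l_dual[OF j j] by simp
  qed
  have "j \<le> n \<longrightarrow> E j \<subseteq> a ` E j" for j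
  proof (induction j)
    case 0
    have "a 0 = 0" by (simp add: lin_simps[OF a(2)])
    then show ?case by (force simp: E_def)
  next
    case (Suc j)
    show ?case
    proof
      assume j: "Suc j \<le> n"
      then have sur: "E j \<subseteq> a ` E j" and jn: "j < n" using Suc by auto
      have d: "diag j a \<noteq> 0" by (rule step[OF jn sur])
      have ej: "e j \<in> E (Suc j)" unfolding E_def by (intro span_base) auto
      from subsetD[OF sur upper_diag_E[OF a(1,2) jn ej]]
      obtain u where u: "a (e j) - sc (diag j a) (e j) = a u" "u \<in> E j" by (rule imageE)
      let ?w = "sc (inverse (diag j a)) (e j - u)"
      have "a ?w = sc (inverse (diag j a)) (a (e j) - a u)" by (simp add: lin_simps[OF a(2)])
      also have "a (e j) - a u = sc (diag j a) (e j)" unfolding u(1)[symmetric] by simp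
      also have "sc (inverse (diag j a)) (sc (diag j a) (e j)) = e j" using d by simp
      finally have aw: "a ?w = e j" .
      have w: "?w \<in> E (Suc j)"
        using ej u(2) E_mono[of j "Suc j"] by (intro subspace_scale[OF subspace_E] subspace_diff[OF subspace_E]) auto
      have "e j \<in> a ` E (Suc j)" by (rule image_eqI[where f = a and x = "?w", OF aw[symmetric] w])
      moreover have "e i \<in> a ` E (Suc j)" if "i < j" for i
      proof -
        have "e i \<in> E j" unfolding E_def using that by (intro span_base) auto
        moreover have "a ` E j \<subseteq> a ` E (Suc j)" by (rule image_mono[OF E_mono]) simp
        ultimately show ?thesis using sur by blast
      qed
      ultimately have "e ` {..<Suc j} \<subseteq> a ` E (Suc j)" by (auto simp: less_Suc_eq)
      moreover have "subspace (a ` E (Suc j))"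
        using module_hom.subspace_image[of sc sc a] a(2) subspace_E
        by (simp add: linear_iff_module_hom[symmetric])
      ultimately show "E (Suc j) \<subseteq> a ` E (Suc j)" unfolding E_def[of "Suc j"] by (rule span_minimal)
    qed
  qed
  then have "E j \<subseteq> a ` E j" using j by simp
  then show ?thesis by (rule step[OF j])
qed

end

text \<open>Take a triangular independent family of maximal length. If it did not span, a common
  eigenvector modulo its span would extend it.\<close>
theorem (in complex_fin_dim) triangular_basis:
  fixes G (structure)
  assumes G: "group G" and top: "topspace X = carrier G"
    and mul: "continuous_map (prod_topology X X) X (\<lambda>(x, y). x \<otimes> y)"
    and inverse: "continuous_map X X (\<lambda>x. inv x)"
    and T: "\<And>g. g \<in> carrier G \<Longrightarrow> lin (T g)"
    and T_mult: "\<And>g h v. g \<in> carrier G \<Longrightarrow> h \<in> carrier G \<Longrightarrow> T (g \<otimes> h) v = T g (T h v)"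
    and T_one: "\<And>v. T \<one> v = v"
    and cont: "\<And>l v. linf l \<Longrightarrow> continuous_map X euclidean (\<lambda>g. l (T g v))"
    and conn: "connected_space X" and solv: "solvable G"
  shows "\<exists>e l n. dual_basis sc e l n \<and>
    (\<forall>g\<in>carrier G. \<forall>j<n. T g (e j) \<in> span (e ` {..<Suc j}))"
proof -
  interpret group G by (rule G)
  obtain m where m: "(derived G ^^ m) (carrier G) = {\<one>}"
    using solv solvable_iff_trivial_derived_seq by blast
  have conn': "connectedin X (carrier G)" using conn top connectedin_topspace by metis
  define Q where "Q e n \<longleftrightarrow> (\<forall>i<n. e i \<notin> span (e ` {..<i}) \<and>
    (\<forall>g\<in>carrier G. T g (e i) \<in> span (e ` {..<Suc i})))" for e and n :: nat
  have indep: "independent (e ` {..<j}) \<and> inj_on e {..<j}" if "Q e n" "j \<le> n" for e n j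
    using that(2)
  proof (induction j)
    case 0 then show ?case by (simp add: independent_empty)
  next
    case (Suc j)
    have "e j \<notin> span (e ` {..<j})" using that(1) Suc.prems by (simp add: Q_def)
    then show ?case using Suc by (auto simp: lessThan_Suc independent_insert span_base)
  qed
  obtain d where d: "\<And>S. independent S \<Longrightarrow> finite S \<and> card S \<le> d"
    using card_independent_bounded by blast
  have bound: "n \<le> d" if "Q e n" for e n
    using indep[OF that order_refl] d[of "e ` {..<n}"] card_image[of e "{..<n}"] by simp
  have "\<exists>n. (\<exists>e. Q e n) \<and> (\<forall>k. (\<exists>e. Q e k) \<longrightarrow> k \<le> n)"
    by (rule Nat.ex_has_greatest_nat[where P = "\<lambda>n. \<exists>e. Q e n" and k = 0 and b = d]) (use bound in \<open>auto simp: Q_def\<close>)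
  then obtain n e where Q: "Q e n" and max: "\<And>k e. Q e k \<Longrightarrow> k \<le> n" by blast
  let ?E = "span (e ` {..<n})"
  have TE: "T g v \<in> ?E" if g: "g \<in> carrier G" and v: "v \<in> ?E" for g v
    using v
  proof (induction rule: span_induct_alt)
    case base then show ?case by (simp add: lin_simps[OF T[OF g]] span_zero)
  next
    case (step c x y)
    then obtain i where i: "x = e i" "i < n" by auto
    then have "T g x \<in> span (e ` {..<Suc i})" using Q g by (simp add: Q_def)
    moreover have "span (e ` {..<Suc i}) \<subseteq> ?E" using i by (intro span_mono image_mono) auto
    ultimately show ?case using step.IH by (auto simp: lin_simps[OF T[OF g]] intro!: span_add span_scale)
  qed
  have full: "?E = UNIV"
  proof (rule ccontr)
    assume "?E \<noteq> UNIV"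
    then have "?E \<subset> UNIV" by blast
    have "\<exists>u \<kappa>. u \<in> UNIV \<and> u \<notin> ?E \<and> (\<forall>g\<in>carrier G. T g u - sc (\<kappa> g) u \<in> ?E)"
      using G top mul inverse T T_mult T_one cont subspace_span subgroup_self conn' m TE subspace_UNIV
        \<open>?E \<subset> UNIV\<close> UNIV_I by (rule common_eigenvector_mod)
    then obtain u \<kappa> where u: "u \<notin> ?E" "\<forall>g\<in>carrier G. T g u - sc (\<kappa> g) u \<in> ?E"
      by (elim exE conjE)
    define e1 where "e1 = e(n := u)"
    have im: "e1 ` {..<i} = e ` {..<i}" if "i \<le> n" for i
      using that by (auto simp: e1_def)
    have imS: "e1 ` {..<Suc n} = insert u (e ` {..<n})"
      using im[of n] by (simp only: lessThan_Suc image_insert) (simp add: e1_def)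
    have "Q e1 (Suc n)" unfolding Q_def
    proof (intro allI impI)
      fix i assume "i < Suc n"
      show "e1 i \<notin> span (e1 ` {..<i}) \<and> (\<forall>g\<in>carrier G. T g (e1 i) \<in> span (e1 ` {..<Suc i}))"
      proof (cases "i < n")
        case True
        then show ?thesis using Q im[of i] im[of "Suc i"] by (simp add: Q_def e1_def)
      next
        case False
        then have i: "i = n" using \<open>i < Suc n\<close> by simp
        have "T g u \<in> span (insert u (e ` {..<n}))" if "g \<in> carrier G" for g
          using bspec[OF u(2) that] unfolding span_breakdown_eq by (rule exI)
        then show ?thesis using u(1) im[of n] imS by (simp add: i e1_def)
      qed
    qed
    from max[OF this] show False by simp
  qed
  have ind: "independent (e ` {..<n})" and inj: "inj_on e {..<n}" using indep[OF Q order_refl] by auto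
  define l where "l i v = representation (e ` {..<n}) v (e i)" for i v
  have "dual_basis sc e l n"
  proof (intro dual_basis.intro dual_basis_axioms.intro complex_fin_dim_axioms)
    show "linf (l i)" for i unfolding Vector_Spaces.linear_iff
      using ind full by (simp add: vector_space_axioms vector_space_mult l_def representation_add representation_scale)
    show "l i (e j) = (if i = j then 1 else 0)" if "i < n" "j < n" for i j
      using that inj by (simp add: l_def representation_basis[OF ind] inj_on_eq_iff)
  next
    fix v
    have "(\<Sum>b\<in>e ` {..<n}. sc (representation (e ` {..<n}) v b) b) = v"
      by (rule sum_representation_eq[OF ind]) (use full in auto)
    then have "(\<Sum>i<n. sc (l i v) (e i)) = v" by (simp add: sum.reindex[OF inj] l_def)
    then show "v = (\<Sum>i<n. sc (l i v) (e i))" by (rule sym)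
  qed
  moreover have "\<forall>g\<in>carrier G. \<forall>j<n. T g (e j) \<in> span (e ` {..<Suc j})"
    using Q by (simp add: Q_def)
  ultimately show ?thesis by (intro exI[of _ e] exI[of _ l] exI[of _ n] conjI)
qed

section \<open>Polynomials and the Zariski topology\<close>

lemma (in complex_fin_dim) polynomial_fun_left:
  assumes "polynomial_fun sc p" "lin b" shows "polynomial_fun sc (\<lambda>x. p (b \<circ> x))"
  using assms(1)
proof induction
  case (coefficient l v)
  have "linf (l \<circ> b)" by (rule Vector_Spaces.linear_compose[OF assms(2) coefficient])
  from polynomial_fun.coefficient[OF this, of v] show ?case by simp
qed (auto intro: polynomial_fun.intros)

lemma (in complex_fin_dim) polynomial_fun_right:
  assumes "polynomial_fun sc p" shows "polynomial_fun sc (\<lambda>x. p (x \<circ> b))"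
  using assms(1)
proof induction
  case (coefficient l v)
  from polynomial_fun.coefficient[OF this, of "b v"] show ?case by simp
qed (auto intro: polynomial_fun.intros)

lemma polynomial_fun_scale: "polynomial_fun sc p \<Longrightarrow> polynomial_fun sc (\<lambda>x. c * p x)"
  by (auto intro: polynomial_fun.intros)

lemma polynomial_fun_diff: "polynomial_fun sc p \<Longrightarrow> polynomial_fun sc q \<Longrightarrow> polynomial_fun sc (\<lambda>x. p x - q x)"
  using polynomial_fun.add[OF _ polynomial_fun_scale[of sc q "-1"], of p] by simp

lemma closedin_zariski_zero_set:
  assumes "polynomial_fun sc p" shows "closedin (zariski sc) {a \<in> carrier (GL sc). p a = 0}"
proof -
  have "carrier (GL sc) - {a \<in> carrier (GL sc). p a = 0} = carrier (GL sc) - {f. \<forall>q\<in>{p}. q f = 0}"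
    by auto
  then have "openin (zariski sc) (carrier (GL sc) - {a \<in> carrier (GL sc). p a = 0})"
    unfolding openin_zariski using assms by (intro exI[of _ "{p}"]) auto
  then show ?thesis unfolding closedin_def topspace_zariski by auto
qed

lemma zariski_closure_of:
  assumes "S \<subseteq> carrier (GL sc)"
  shows "zariski sc closure_of S =
    {a \<in> carrier (GL sc). \<forall>p. polynomial_fun sc p \<longrightarrow> (\<forall>s\<in>S. p s = 0) \<longrightarrow> p a = 0}" (is "_ = ?C")
proof
  show "zariski sc closure_of S \<subseteq> ?C"
  proof
    fix a assume a: "a \<in> zariski sc closure_of S"
    then have aG: "a \<in> carrier (GL sc)" by (simp add: in_closure_of topspace_zariski)
    have "p a = 0" if p: "polynomial_fun sc p" "\<forall>s\<in>S. p s = 0" for p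
    proof -
      have "S \<subseteq> {a \<in> carrier (GL sc). p a = 0}" using assms p(2) by auto
      then have "zariski sc closure_of S \<subseteq> {a \<in> carrier (GL sc). p a = 0}"
        by (rule closure_of_minimal[OF _ closedin_zariski_zero_set[OF p(1)]])
      then show ?thesis using a by auto
    qed
    then show "a \<in> ?C" using aG by simp
  qed
  show "?C \<subseteq> zariski sc closure_of S"
  proof
    fix a assume a: "a \<in> ?C"
    have "\<exists>y. y \<in> S \<and> y \<in> T" if T: "a \<in> T" "openin (zariski sc) T" for T
    proof -
      obtain P where P: "\<forall>p\<in>P. polynomial_fun sc p" "T = carrier (GL sc) - {f. \<forall>p\<in>P. p f = 0}"
        using T(2) unfolding openin_zariski by (elim exE conjE)
      have "\<exists>p\<in>P. p a \<noteq> 0" using T(1) unfolding P(2) by simp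
      then obtain p where p: "p \<in> P" "p a \<noteq> 0" by (elim bexE)
      have pol: "polynomial_fun sc p" using P(1) p(1) by (rule bspec)
      have "(\<forall>s\<in>S. p s = 0) \<longrightarrow> p a = 0" using a pol by simp
      then have "\<exists>s\<in>S. p s \<noteq> 0" using p(2) by auto
      then obtain s where s: "s \<in> S" "p s \<noteq> 0" by (elim bexE)
      have "s \<in> T" unfolding P(2) using subsetD[OF assms s(1)] s(2) p(1) by auto
      then show ?thesis using s(1) by (intro exI conjI)
    qed
    then show "a \<in> zariski sc closure_of S" using a by (simp add: in_closure_of topspace_zariski)
  qed
qed

lemma (in complex_fin_dim) carrier_GL_iff: "f \<in> carrier (GL sc) \<longleftrightarrow> lin f \<and> bij f"
  by (simp add: GL_def)

lemma (in complex_fin_dim) inverse_GL: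
  assumes "f \<in> carrier (GL sc)"
  shows "inv_into UNIV f \<in> carrier (GL sc)" "inv_into UNIV f \<circ> f = id" "f \<circ> inv_into UNIV f = id"
proof -
  have f: "lin f" "bij f" using assms by (simp_all add: carrier_GL_iff)
  then have ss: "f (inv_into UNIV f v) = v" "inv_into UNIV f (f v) = v" for v
    by (simp_all add: bij_is_surj surj_f_inv_f bij_is_inj)
  have "inv_into UNIV f (a + b) = inv_into UNIV f a + inv_into UNIV f b" for a b
    using ss(2)[of "inv_into UNIV f a + inv_into UNIV f b"] by (simp add: lin_simps[OF f(1)] ss(1))
  moreover have "inv_into UNIV f (sc c a) = sc c (inv_into UNIV f a)" for c a
    using ss(2)[of "sc c (inv_into UNIV f a)"] by (simp add: lin_simps[OF f(1)] ss(1))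
  ultimately show "inv_into UNIV f \<in> carrier (GL sc)"
    using f(2) by (simp add: carrier_GL_iff Vector_Spaces.linear_iff vector_space_axioms bij_imp_bij_inv)
  show "inv_into UNIV f \<circ> f = id" "f \<circ> inv_into UNIV f = id" using ss by auto
qed

lemma (in complex_fin_dim) group_GL: "group (GL sc)"
proof (rule groupI)
  show "\<one>\<^bsub>GL sc\<^esub> \<in> carrier (GL sc)"
    by (simp add: GL_def Vector_Spaces.linear_iff vector_space_axioms)
  fix x y assume x: "x \<in> carrier (GL sc)" and y: "y \<in> carrier (GL sc)"
  have "lin (x \<circ> y)" using x y unfolding carrier_GL_iff by (intro Vector_Spaces.linear_compose) auto
  then show "x \<otimes>\<^bsub>GL sc\<^esub> y \<in> carrier (GL sc)"
    using x y unfolding carrier_GL_iff by (simp add: GL_def bij_comp)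
  show "\<one>\<^bsub>GL sc\<^esub> \<otimes>\<^bsub>GL sc\<^esub> x = x" by (simp add: GL_def)
  show "\<exists>y\<in>carrier (GL sc). y \<otimes>\<^bsub>GL sc\<^esub> x = \<one>\<^bsub>GL sc\<^esub>"
    using inverse_GL[OF x] by (intro bexI[of _ "inv_into UNIV x"]) (simp_all add: GL_def)
qed (simp add: GL_def o_assoc)

lemma (in complex_fin_dim) inv_GL:
  assumes "f \<in> carrier (GL sc)" shows "inv\<^bsub>GL sc\<^esub> f = inv_into UNIV f"
  using group.inv_equality[OF group_GL _ assms inverse_GL(1)[OF assms]] inverse_GL(2)[OF assms]
  by (simp add: GL_def)

lemma (in complex_fin_dim) continuous_translation:
  assumes "f \<in> carrier (GL sc)" shows "continuous_map (zariski sc) (zariski sc) (\<lambda>x. f \<circ> x)"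
  unfolding continuous_map
proof (intro conjI allI impI)
  have f: "lin f" using assms by (simp add: carrier_GL_iff)
  have mem: "f \<circ> x \<in> carrier (GL sc)" if "x \<in> carrier (GL sc)" for x
    using group.is_monoid[OF group_GL, THEN monoid.m_closed, OF assms that] by (simp add: GL_def)
  show "(\<lambda>x. f \<circ> x) ` topspace (zariski sc) \<subseteq> topspace (zariski sc)"
    using mem by (auto simp: topspace_zariski)
  fix U assume "openin (zariski sc) U"
  then obtain P where P: "\<forall>p\<in>P. polynomial_fun sc p" "U = carrier (GL sc) - {f. \<forall>p\<in>P. p f = 0}"
    unfolding openin_zariski by blast
  have "{x \<in> topspace (zariski sc). f \<circ> x \<in> U} =
    carrier (GL sc) - {x. \<forall>q\<in>(\<lambda>p x. p (f \<circ> x)) ` P. q x = 0}"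
    using mem by (auto simp: topspace_zariski P(2))
  moreover have "\<forall>q\<in>(\<lambda>p x. p (f \<circ> x)) ` P. polynomial_fun sc q"
    using P(1) polynomial_fun_left[OF _ f] by blast
  ultimately show "openin (zariski sc) {x \<in> topspace (zariski sc). f \<circ> x \<in> U}"
    unfolding openin_zariski by blast
qed

section \<open>Spaces of functions with triangular translations\<close>

text \<open>A monoid \<open>A\<close> of maps acts from the right on a set \<open>D\<close> of points. \<open>Ch\<close> stands for the
  algebraic characters of \<open>A\<close> and \<open>Reg\<close> for the regular functions on it. The locale is used for
  matrices and for tuples of matrices.\<close>
locale right_action =
  fixes A :: "('u \<Rightarrow> 'u) set" and D :: "'z set" and act :: "'z \<Rightarrow> ('u \<Rightarrow> 'u) \<Rightarrow> 'z"
    and Ch Reg :: "(('u \<Rightarrow> 'u) \<Rightarrow> complex) set"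
  assumes comp_A: "a \<in> A \<Longrightarrow> b \<in> A \<Longrightarrow> a \<circ> b \<in> A" and id_A: "id \<in> A"
    and act_D: "x \<in> D \<Longrightarrow> a \<in> A \<Longrightarrow> act x a \<in> D"
    and act_act: "x \<in> D \<Longrightarrow> a \<in> A \<Longrightarrow> b \<in> A \<Longrightarrow> act (act x a) b = act x (a \<circ> b)"
    and act_id: "x \<in> D \<Longrightarrow> act x id = x"
    and Ch_mult: "\<tau> \<in> Ch \<Longrightarrow> a \<in> A \<Longrightarrow> b \<in> A \<Longrightarrow> \<tau> (a \<circ> b) = \<tau> a * \<tau> b"
    and Ch_nonzero: "\<tau> \<in> Ch \<Longrightarrow> a \<in> A \<Longrightarrow> \<tau> a \<noteq> 0"
    and Ch_prod: "\<tau> \<in> Ch \<Longrightarrow> \<sigma> \<in> Ch \<Longrightarrow> (\<lambda>a. \<tau> a * \<sigma> a) \<in> Ch"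
    and Ch_one: "(\<lambda>_. 1) \<in> Ch"
    and Ch_Reg: "Ch \<subseteq> Reg"
    and Reg_const: "(\<lambda>_. c) \<in> Reg"
    and Reg_add: "p \<in> Reg \<Longrightarrow> q \<in> Reg \<Longrightarrow> (\<lambda>a. p a + q a) \<in> Reg"
    and Reg_mult: "p \<in> Reg \<Longrightarrow> q \<in> Reg \<Longrightarrow> (\<lambda>a. p a * q a) \<in> Reg"
begin

text \<open>Right translation. Off \<open>D\<close> the value is 0, so that functions that agree on \<open>D\<close> are not
  distinguished after translation.\<close>
definition R :: "('u \<Rightarrow> 'u) \<Rightarrow> ('z \<Rightarrow> complex) \<Rightarrow> 'z \<Rightarrow> complex" where
  "R a f = (\<lambda>x. if x \<in> D then f (act x a) else 0)"

definition reg :: "('z \<Rightarrow> complex) \<Rightarrow> bool" where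
  "reg f \<longleftrightarrow> (\<forall>x\<in>D. \<exists>p\<in>Reg. \<forall>a\<in>A. f (act x a) = p a)"

text \<open>Complex linear subspaces of the space of functions.\<close>
definition sub :: "('z \<Rightarrow> complex) set \<Rightarrow> bool" where
  "sub W \<longleftrightarrow> (\<lambda>_. 0) \<in> W \<and> (\<forall>f\<in>W. \<forall>g\<in>W. \<forall>c. (\<lambda>x. f x + c * g x) \<in> W)"

definition extend :: "('z \<Rightarrow> complex) set \<Rightarrow> ('z \<Rightarrow> complex) \<Rightarrow> ('z \<Rightarrow> complex) set" where
  "extend W f = {(\<lambda>x. w x + c * f x) |w c. w \<in> W}"

text \<open>The subspaces that are built from 0 by adding one function at a time, each an
  eigenfunction of \<open>A\<close> modulo the preceding ones: the finite-dimensional spaces of functions on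
  which \<open>A\<close> acts triangularly with diagonal characters in \<open>Ch\<close>. Induction over this predicate
  replaces arguments with triangular bases.\<close>
inductive flag :: "('z \<Rightarrow> complex) set \<Rightarrow> bool" where
  zero: "flag {\<lambda>_. 0}"
| step: "flag W \<Longrightarrow> \<tau> \<in> Ch \<Longrightarrow> reg f \<Longrightarrow> (\<And>a. a \<in> A \<Longrightarrow> (\<lambda>x. R a f x - \<tau> a * f x) \<in> W) \<Longrightarrow>
    flag (extend W f)"

definition in_flag :: "('z \<Rightarrow> complex) \<Rightarrow> bool" where
  "in_flag f \<longleftrightarrow> (\<exists>W. flag W \<and> f \<in> W)"

lemma mem_cong: "f \<in> W \<Longrightarrow> (\<And>x. g x = f x) \<Longrightarrow> g \<in> W"
  by (metis ext)

lemma sub_combine: "sub W \<Longrightarrow> f \<in> W \<Longrightarrow> g \<in> W \<Longrightarrow> (\<lambda>x. f x + c * g x) \<in> W"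
  by (simp add: sub_def)

lemma sub_zero: "sub W \<Longrightarrow> (\<lambda>_. 0) \<in> W"
  by (simp add: sub_def)

lemma sub_scale: "sub W \<Longrightarrow> f \<in> W \<Longrightarrow> (\<lambda>x. c * f x) \<in> W"
  using sub_combine[OF _ sub_zero, of W f c] by simp

lemma sub_add: "sub W \<Longrightarrow> f \<in> W \<Longrightarrow> g \<in> W \<Longrightarrow> (\<lambda>x. f x + g x) \<in> W"
  using sub_combine[of W f g 1] by simp

lemma sub_diff: "sub W \<Longrightarrow> f \<in> W \<Longrightarrow> g \<in> W \<Longrightarrow> (\<lambda>x. f x - g x) \<in> W"
  using sub_combine[of W f g "-1"] by simp

lemma sub_sum: "finite I \<Longrightarrow> sub W \<Longrightarrow> (\<And>i. i \<in> I \<Longrightarrow> f i \<in> W) \<Longrightarrow> (\<lambda>x. \<Sum>i\<in>I. f i x) \<in> W"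
proof (induction I rule: finite_induct)
  case empty then show ?case by (simp add: sub_zero)
next
  case (insert i I)
  then show ?case using sub_add[of W "f i" "\<lambda>x. \<Sum>i\<in>I. f i x"] by simp
qed

lemma sub_extend: "sub W \<Longrightarrow> sub (extend W f)"
  unfolding sub_def
proof (intro conjI ballI allI)
  assume W: "(\<lambda>_. 0) \<in> W \<and> (\<forall>f\<in>W. \<forall>g\<in>W. \<forall>c. (\<lambda>x. f x + c * g x) \<in> W)"
  show "(\<lambda>_. 0) \<in> extend W f" using W unfolding extend_def
    by (intro CollectI exI[of _ "\<lambda>_. 0"] exI[of _ 0]) auto
  fix g h c assume "g \<in> extend W f" "h \<in> extend W f"
  then obtain w v a b where g: "g = (\<lambda>x. w x + a * f x)" "w \<in> W" and h: "h = (\<lambda>x. v x + b * f x)" "v \<in> W"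
    unfolding extend_def by blast
  show "(\<lambda>x. g x + c * h x) \<in> extend W f" unfolding extend_def
    by (intro CollectI exI[of _ "\<lambda>x. w x + c * v x"] exI[of _ "a + c * b"])
      (use W g h in \<open>auto simp: algebra_simps\<close>)
qed

lemma extend_base: "w \<in> W \<Longrightarrow> w \<in> extend W f"
  unfolding extend_def by (intro CollectI exI[of _ w] exI[of _ 0]) auto

lemma extend_new: "sub W \<Longrightarrow> f \<in> extend W f"
  unfolding extend_def sub_def by (intro CollectI exI[of _ "\<lambda>_. 0"] exI[of _ 1]) auto

lemma flag_sub: "flag W \<Longrightarrow> sub W"
  by (induction rule: flag.induct) (auto intro: sub_extend simp: sub_def[of "{_}"])

lemma R_linear: "R a (\<lambda>x. f x + c * g x) = (\<lambda>x. R a f x + c * R a g x)"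
  by (auto simp: R_def)

lemma R_diff: "R a (\<lambda>x. f x - c * g x) = (\<lambda>x. R a f x - c * R a g x)"
  by (auto simp: R_def)

lemma R_scale: "R a (\<lambda>x. c * g x) = (\<lambda>x. c * R a g x)"
  by (auto simp: R_def)

lemma R_comp: "a \<in> A \<Longrightarrow> b \<in> A \<Longrightarrow> R (a \<circ> b) f = R a (R b f)"
  by (auto simp: R_def act_D act_act)

lemma extend_invariant:
  assumes "sub W" and inv: "\<And>w. w \<in> W \<Longrightarrow> R a w \<in> W"
    and f: "(\<lambda>x. R a f x - t * f x) \<in> W" and "g \<in> extend W f"
  shows "(\<lambda>x. R a g x - t * g x) \<in> W"
proof -
  obtain w c where g: "g = (\<lambda>x. w x + c * f x)" "w \<in> W" using assms(4) unfolding extend_def by blast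
  have "(\<lambda>x. (R a w x + - t * w x) + c * (R a f x - t * f x)) \<in> W"
    using sub_combine[OF assms(1) sub_combine[OF assms(1) inv[OF g(2)] g(2)] f] .
  then show ?thesis by (rule mem_cong) (auto simp: g(1) R_linear algebra_simps)
qed

lemma flag_invariant: "flag W \<Longrightarrow> f \<in> W \<Longrightarrow> a \<in> A \<Longrightarrow> R a f \<in> W"
proof (induction arbitrary: f rule: flag.induct)
  case zero then show ?case by (auto simp: R_def)
next
  case (step W \<tau> g)
  have "(\<lambda>x. R a f x - \<tau> a * f x) \<in> W"
    by (rule extend_invariant[OF flag_sub[OF step.hyps(1)] step.IH[OF _ step.prems(2)]
          step.hyps(4)[OF step.prems(2)] step.prems(1)])
  then have "(\<lambda>x. (R a f x - \<tau> a * f x) + \<tau> a * f x) \<in> extend W g"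
    using sub_combine[OF sub_extend[OF flag_sub[OF step.hyps(1)]] extend_base step.prems(1)] by blast
  then show ?case by simp
qed

lemma flag_step_diff:
  assumes "flag W" "\<And>a. a \<in> A \<Longrightarrow> (\<lambda>x. R a f x - \<tau> a * f x) \<in> W" "g \<in> extend W f" "a \<in> A"
  shows "(\<lambda>x. R a g x - \<tau> a * g x) \<in> W"
  using extend_invariant[OF flag_sub[OF assms(1)]] flag_invariant[OF assms(1)] assms by blast

text \<open>If \<open>\<tau> g\<close> is \<open>R g\<close> modulo functions supported in \<open>D\<close>, with \<open>\<tau>\<close> a nonzero number, \<open>g\<close> is
  supported in \<open>D\<close>, because translates are.\<close>
lemma flag_supported: "flag W \<Longrightarrow> f \<in> W \<Longrightarrow> x \<notin> D \<Longrightarrow> f x = 0"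
proof (induction arbitrary: f rule: flag.induct)
  case zero then show ?case by simp
next
  case (step W \<tau> g)
  have "R id g x - \<tau> id * g x = 0" using step.IH[OF step.hyps(4)[OF id_A] step.prems(2)] by simp
  then have "g x = 0" using step.prems(2) Ch_nonzero[OF step.hyps(2) id_A] by (simp add: R_def)
  then show ?case using step.prems step.IH by (auto simp: extend_def)
qed

lemma reg_zero: "reg (\<lambda>_. 0)"
  unfolding reg_def using Reg_const[of 0] by (intro ballI bexI[of _ "\<lambda>_. 0"]) auto

lemma reg_combine:
  assumes "reg f" "reg g" shows "reg (\<lambda>x. f x + c * g x)"
  unfolding reg_def
proof
  fix x assume x: "x \<in> D"
  obtain p q where "p \<in> Reg" "\<forall>a\<in>A. f (act x a) = p a" "q \<in> Reg" "\<forall>a\<in>A. g (act x a) = q a"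
    using assms x unfolding reg_def by blast
  then show "\<exists>p\<in>Reg. \<forall>a\<in>A. f (act x a) + c * g (act x a) = p a"
    by (intro bexI[of _ "\<lambda>a. p a + c * q a"]) (auto intro!: Reg_add Reg_mult Reg_const)
qed

lemma reg_mult:
  assumes "reg f" "reg g" shows "reg (\<lambda>x. f x * g x)"
  unfolding reg_def
proof
  fix x assume x: "x \<in> D"
  obtain p q where "p \<in> Reg" "\<forall>a\<in>A. f (act x a) = p a" "q \<in> Reg" "\<forall>a\<in>A. g (act x a) = q a"
    using assms x unfolding reg_def by blast
  then show "\<exists>p\<in>Reg. \<forall>a\<in>A. f (act x a) * g (act x a) = p a"
    by (intro bexI[of _ "\<lambda>a. p a * q a"]) (auto intro!: Reg_mult)
qed

lemma flag_reg: "flag W \<Longrightarrow> f \<in> W \<Longrightarrow> reg f"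
proof (induction arbitrary: f rule: flag.induct)
  case zero then show ?case by (simp add: reg_zero)
next
  case (step W \<tau> g)
  then show ?case by (auto simp: extend_def intro!: reg_combine)
qed

lemma flag_join:
  assumes "flag V" "flag W" shows "\<exists>Z. flag Z \<and> V \<subseteq> Z \<and> W \<subseteq> Z"
  using assms(2)
proof (induction rule: flag.induct)
  case zero
  then show ?case using assms(1) sub_zero[OF flag_sub[OF assms(1)]] by (intro exI[of _ V]) auto
next
  case (step W \<tau> f)
  then obtain Z where Z: "flag Z" "V \<subseteq> Z" "W \<subseteq> Z" by blast
  have "flag (extend Z f)" using step Z by (intro flag.step[of Z \<tau>]) auto
  moreover have "extend W f \<subseteq> extend Z f" using Z(3) unfolding extend_def by blast
  moreover have "V \<subseteq> extend Z f" using Z(2) extend_base by blast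
  ultimately show ?case by blast
qed

text \<open>With \<open>R f = \<tau> f + w\<close> and \<open>R g = \<sigma> g + v\<close> one has
  \<open>R (f g) = \<tau>\<sigma> f g + (\<tau> f v + \<sigma> w g + w v)\<close>, and the bracket consists of products that come
  earlier in the lexicographic order on pairs. This makes all polynomials in triangular
  functions triangular.\<close>
lemma flag_product:
  assumes Y: "flag Y" and "flag W"
  shows "\<exists>Z. flag Z \<and> (\<forall>w\<in>W. \<forall>y\<in>Y. (\<lambda>x. w x * y x) \<in> Z)"
  using assms(2)
proof (induction rule: flag.induct)
  case zero
  then show ?case using flag.zero by (intro exI[of _ "{\<lambda>_. 0}"]) simp
next
  case (step W \<tau> f)
  then obtain Z0 where Z0: "flag Z0" "\<And>w y. w \<in> W \<Longrightarrow> y \<in> Y \<Longrightarrow> (\<lambda>x. w x * y x) \<in> Z0" by blast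
  have "Y' \<subseteq> Y \<longrightarrow> (\<exists>Z. flag Z \<and> Z0 \<subseteq> Z \<and> (\<forall>y\<in>Y'. (\<lambda>x. f x * y x) \<in> Z))"
    if "flag Y'" for Y'
    using that
  proof (induction rule: flag.induct)
    case zero
    then show ?case using Z0(1) sub_zero[OF flag_sub[OF Z0(1)]] by auto
  next
    case (step Y' \<sigma> g)
    note inner = step
    show ?case
    proof
      assume sub: "extend Y' g \<subseteq> Y"
      have gY: "g \<in> Y" using extend_new[OF flag_sub[OF inner(1)]] sub by blast
      have Y'Y: "Y' \<subseteq> Y" using extend_base sub by blast
      then obtain Z where Z: "flag Z" "Z0 \<subseteq> Z" "\<And>y. y \<in> Y' \<Longrightarrow> (\<lambda>x. f x * y x) \<in> Z"
        using inner(5) by blast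
      have "flag (extend Z (\<lambda>x. f x * g x))"
      proof (rule flag.step[OF Z(1) Ch_prod[OF \<open>\<tau> \<in> Ch\<close> inner(2)]])
        show "reg (\<lambda>x. f x * g x)" using \<open>reg f\<close> inner(3) by (rule reg_mult)
        fix a assume a: "a \<in> A"
        define w where "w = (\<lambda>x. R a f x - \<tau> a * f x)"
        define v where "v = (\<lambda>x. R a g x - \<sigma> a * g x)"
        have w: "w \<in> W" unfolding w_def
          using \<open>\<And>a. a \<in> A \<Longrightarrow> (\<lambda>x. R a f x - \<tau> a * f x) \<in> W\<close>[OF a] .
        have v: "v \<in> Y'" unfolding v_def using inner(4)[OF a] .
        have "(\<lambda>x. (w x * v x + \<tau> a * (f x * v x)) + \<sigma> a * (w x * g x)) \<in> Z"
          using Z w v gY Y'Y Z0(2) by (intro sub_combine flag_sub[OF Z(1)]) blast+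
        then show "(\<lambda>x. R a (\<lambda>x. f x * g x) x - \<tau> a * \<sigma> a * (f x * g x)) \<in> Z"
        proof (rule mem_cong)
          fix x
          have "R a (\<lambda>x. f x * g x) x = R a f x * R a g x" by (simp add: R_def)
          also have "\<dots> = (w x + \<tau> a * f x) * (v x + \<sigma> a * g x)" by (simp add: w_def v_def)
          finally show "R a (\<lambda>x. f x * g x) x - \<tau> a * \<sigma> a * (f x * g x) =
            (w x * v x + \<tau> a * (f x * v x)) + \<sigma> a * (w x * g x)"
            by (simp add: algebra_simps)
        qed
      qed
      moreover have "Z0 \<subseteq> extend Z (\<lambda>x. f x * g x)" using Z(2) extend_base by blast
      moreover have "(\<lambda>x. f x * y x) \<in> extend Z (\<lambda>x. f x * g x)" if "y \<in> extend Y' g" for y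
      proof -
        obtain v c where y: "y = (\<lambda>x. v x + c * g x)" "v \<in> Y'"
          using \<open>y \<in> extend Y' g\<close> unfolding extend_def by blast
        show ?thesis unfolding extend_def
          by (intro CollectI exI[of _ "\<lambda>x. f x * v x"] exI[of _ c])
            (use y(1) Z(3)[OF y(2)] in \<open>auto simp: distrib_left mult.left_commute\<close>)
      qed
      ultimately show "\<exists>Z. flag Z \<and> Z0 \<subseteq> Z \<and> (\<forall>y\<in>extend Y' g. (\<lambda>x. f x * y x) \<in> Z)" by blast
    qed
  qed
  from this[OF Y] obtain Z where Z: "flag Z" "Z0 \<subseteq> Z" "\<And>y. y \<in> Y \<Longrightarrow> (\<lambda>x. f x * y x) \<in> Z" by blast
  have "(\<lambda>x. w x * y x) \<in> Z" if "w \<in> extend W f" "y \<in> Y" for w y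
  proof -
    obtain v c where w: "w = (\<lambda>x. v x + c * f x)" "v \<in> W"
      using \<open>w \<in> extend W f\<close> unfolding extend_def by blast
    have "(\<lambda>x. v x * y x + c * (f x * y x)) \<in> Z"
      using Z Z0(2) w that(2) by (intro sub_combine flag_sub) blast+
    then show ?thesis by (rule mem_cong) (simp add: w algebra_simps)
  qed
  then show ?case using Z(1) by blast
qed

lemma in_flag_combine:
  assumes "in_flag f" "in_flag g" shows "in_flag (\<lambda>x. f x + c * g x)"
proof -
  obtain V W where "flag V" "f \<in> V" "flag W" "g \<in> W" using assms unfolding in_flag_def by blast
  moreover obtain Z where Z: "flag Z" "V \<subseteq> Z" "W \<subseteq> Z" using flag_join[OF calculation(1,3)] by blast
  ultimately have "(\<lambda>x. f x + c * g x) \<in> Z" by (intro sub_combine[OF flag_sub[OF Z(1)]]) auto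
  then show ?thesis using Z(1) unfolding in_flag_def by blast
qed

lemma in_flag_mult:
  assumes "in_flag f" "in_flag g" shows "in_flag (\<lambda>x. f x * g x)"
proof -
  obtain V W where "flag V" "f \<in> V" "flag W" "g \<in> W" using assms unfolding in_flag_def by blast
  then show ?thesis using flag_product[of W V] unfolding in_flag_def by blast
qed

lemma in_flag_zero: "in_flag (\<lambda>_. 0)"
  unfolding in_flag_def using flag.zero by blast

lemma in_flag_const: "in_flag (\<lambda>x. if x \<in> D then c else 0)"
proof -
  have "flag (extend {\<lambda>_. 0} (\<lambda>x. if x \<in> D then c else 0))"
    by (rule flag.step[OF flag.zero Ch_one])
      (auto simp: reg_def R_def act_D intro!: bexI[of _ "\<lambda>_. c"] Reg_const)
  then show ?thesis unfolding in_flag_def using extend_new[OF flag_sub[OF flag.zero]] by blast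
qed

lemma in_flag_sum: "finite I \<Longrightarrow> (\<And>i. i \<in> I \<Longrightarrow> in_flag (f i)) \<Longrightarrow> in_flag (\<lambda>x. \<Sum>i\<in>I. c i * f i x)"
proof (induction I rule: finite_induct)
  case empty then show ?case by (simp add: in_flag_zero)
next
  case (insert i I)
  then show ?case using in_flag_combine[of "\<lambda>x. \<Sum>i\<in>I. c i * f i x" "f i" "c i"]
    by (simp add: add.commute)
qed

lemma in_flag_prod: "finite I \<Longrightarrow> (\<And>i. i \<in> I \<Longrightarrow> in_flag (f i)) \<Longrightarrow> 
  in_flag (\<lambda>x. if x \<in> D then \<Prod>i\<in>I. f i x else 0)"
proof (induction I rule: finite_induct)
  case empty then show ?case using in_flag_const[of 1] by (simp cong: if_cong)
next
  case (insert i I)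
  then have "in_flag (\<lambda>x. f i x * (if x \<in> D then \<Prod>i\<in>I. f i x else 0))" by (intro in_flag_mult) auto
  moreover have "(\<lambda>x. f i x * (if x \<in> D then \<Prod>i\<in>I. f i x else 0)) =
    (\<lambda>x. if x \<in> D then \<Prod>i\<in>insert i I. f i x else 0)" using insert.hyps by auto
  ultimately show ?case by simp
qed

text \<open>Pass to the first step of the flag that contains \<open>f\<close>. This finds a character of \<open>A\<close> that
  describes the action on \<open>f\<close> up to lower terms.\<close>
lemma leading_character:
  assumes "flag W" "f \<in> W" "f \<noteq> (\<lambda>_. 0)"
  shows "\<exists>V \<tau>. flag V \<and> f \<notin> V \<and> \<tau> \<in> Ch \<and> (\<forall>a\<in>A. (\<lambda>x. R a f x - \<tau> a * f x) \<in> V)"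
  using assms
proof (induction rule: flag.induct)
  case zero then show ?case by simp
next
  case (step W \<tau> g)
  show ?case
  proof (cases "f \<in> W")
    case True then show ?thesis using step.IH step.prems(2) by blast
  next
    case False
    then show ?thesis using flag_step_diff[OF step.hyps(1,4) step.prems(1)] step.hyps(1,2) by blast
  qed
qed

text \<open>The diagonal entries of \<open>R a\<close> are nonzero, so the equation \<open>R a g = f\<close> can be solved by
  back substitution, without leaving an invariant subspace. This is how \<open>A\<close> is shown to be
  closed under inverses.\<close>
lemma flag_translate_surj:
  assumes "flag W" "a \<in> A"
  shows "\<lbrakk>sub I; I \<subseteq> W; \<And>f. f \<in> I \<Longrightarrow> R a f \<in> I; f \<in> I\<rbrakk> \<Longrightarrow> \<exists>g\<in>I. R a g = f"
  using assms(1)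
proof (induction arbitrary: I f rule: flag.induct)
  case zero
  then have "f = (\<lambda>_. 0)" by blast
  then have "R a f = f" by (auto simp: R_def)
  then show ?case using zero by blast
next
  case (step W \<tau> g)
  have W: "sub W" using step.hyps(1) by (rule flag_sub)
  have "sub (I \<inter> W)" using step.prems(1) W unfolding sub_def by blast
  moreover have "R a h \<in> I \<inter> W" if "h \<in> I \<inter> W" for h
    using that step.prems(3) flag_invariant[OF step.hyps(1) _ assms(2)] by blast
  ultimately have surj: "\<exists>g\<in>I \<inter> W. R a g = h" if "h \<in> I \<inter> W" for h
    using step.IH[of "I \<inter> W" h] that by blast
  let ?w = "\<lambda>x. R a f x - \<tau> a * f x"
  have "?w \<in> W"
    using flag_step_diff[OF step.hyps(1,4) _ assms(2)] step.prems(2,4) by blast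
  moreover have "(\<lambda>x. R a f x + - \<tau> a * f x) \<in> I"
    using sub_combine[OF step.prems(1) step.prems(3)[OF step.prems(4)] step.prems(4)] .
  ultimately obtain h where h: "h \<in> I" "R a h = ?w" using surj[of ?w] by auto
  have nz: "\<tau> a \<noteq> 0" using Ch_nonzero[OF step.hyps(2) assms(2)] .
  let ?g = "\<lambda>x. inverse (\<tau> a) * (f x - h x)"
  have "?g \<in> I" by (rule sub_scale[OF step.prems(1) sub_diff[OF step.prems(1) step.prems(4) h(1)]])
  moreover have "R a ?g = f"
  proof
    fix x
    have "R a ?g x = inverse (\<tau> a) * (R a f x - R a h x)" by (simp add: R_def)
    also have "\<dots> = f x" using nz by (simp add: h(2))
    finally show "R a ?g x = f x" .
  qed
  ultimately show ?case by blast
qed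

text \<open>A finite-dimensional space of functions has a basis that is dual to evaluation at suitable
  points. If \<open>w\<close> is outside a subspace with such a basis, subtract the interpolating function of
  \<open>w\<close>, choose a point \<open>z0\<close> where the difference is not zero, and correct the old basis to vanish
  at \<open>z0\<close>.\<close>
lemma dual_points:
  assumes "flag W"
  shows "\<lbrakk>sub U; U \<subseteq> W\<rbrakk> \<Longrightarrow> \<exists>(k::nat) u x. (\<forall>i<k. u i \<in> U \<and> x i \<in> D) \<and>
    (\<forall>i<k. \<forall>j<k. u i (x j) = (if i = j then 1 else 0)) \<and>
    (\<forall>w\<in>U. \<forall>z. w z = (\<Sum>i<k. w (x i) * u i z))"
  using assms
proof (induction arbitrary: U rule: flag.induct)
  case zero
  then show ?case by (intro exI[of _ 0]) auto
next
  case (step W \<tau> f)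
  note U = step.prems(1)
  have W: "sub W" using step.hyps(1) by (rule flag_sub)
  have "flag (extend W f)" using step.hyps by (intro flag.step) auto
  note supp = flag_supported[OF this]
  have "sub (U \<inter> W)" using U W unfolding sub_def by blast
  then have "\<exists>(k::nat) u x. (\<forall>i<k. u i \<in> U \<inter> W \<and> x i \<in> D) \<and>
      (\<forall>i<k. \<forall>j<k. u i (x j) = (if i = j then 1 else 0)) \<and>
      (\<forall>w\<in>U \<inter> W. \<forall>z. w z = (\<Sum>i<k. w (x i) * u i z))"
    by (rule step.IH) blast
  then obtain k u x where *: "(\<forall>i<k::nat. u i \<in> U \<inter> W \<and> x i \<in> D) \<and>
      (\<forall>i<k. \<forall>j<k. u i (x j) = (if i = j then 1 else 0)) \<and>
      (\<forall>w\<in>U \<inter> W. \<forall>z. w z = (\<Sum>i<k. w (x i) * u i z))"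
    by (elim exE)
  have ux: "\<And>i. i < k \<Longrightarrow> u i \<in> U \<inter> W \<and> x i \<in> D"
    and dual: "\<And>i j. i < k \<Longrightarrow> j < k \<Longrightarrow> u i (x j) = (if i = j then 1 else 0)"
    and repr: "\<And>w z. w \<in> U \<inter> W \<Longrightarrow> w z = (\<Sum>i<k. w (x i) * u i z)"
    using * by blast+
  show ?case
  proof (cases "U \<subseteq> W")
    case True
    then have "U \<inter> W = U" by blast
    then show ?thesis using ux dual repr by (intro exI[of _ k] exI[of _ u] exI[of _ x]) auto
  next
    case False
    then obtain w where w: "w \<in> U" "w \<notin> W" by blast
    have dsum: "(\<Sum>i<k. c i * u i (x j)) = c j" if "j < k" for c j
    proof -
      have "(\<Sum>i<k. c i * u i (x j)) = (\<Sum>i<k. if i = j then c i else 0)"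
        by (rule sum.cong) (simp_all add: dual that)
      then show ?thesis using that by simp
    qed
    have su: "(\<lambda>z. \<Sum>i<k. c i * u i z) \<in> U \<inter> W" for c
    proof (rule sub_sum[OF finite_lessThan \<open>sub (U \<inter> W)\<close>])
      fix i assume "i \<in> {..<k}"
      then have "u i \<in> U \<inter> W" using ux by blast
      then show "(\<lambda>z. c i * u i z) \<in> U \<inter> W" by (rule sub_scale[OF \<open>sub (U \<inter> W)\<close>])
    qed
    define w1 where "w1 = (\<lambda>z. w z - (\<Sum>i<k. w (x i) * u i z))"
    have w1: "w1 \<in> U" "w1 \<notin> W"
    proof -
      have s: "(\<lambda>z. \<Sum>i<k. w (x i) * u i z) \<in> U \<inter> W" by (rule su)
      show "w1 \<in> U" unfolding w1_def by (rule sub_diff[OF U w(1) IntD1[OF s]])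
      have "(\<lambda>z. w1 z + (\<Sum>i<k. w (x i) * u i z)) \<in> W" if "w1 \<in> W"
        by (rule sub_add[OF W that IntD2[OF s]])
      then show "w1 \<notin> W" using w(2) by (auto simp: w1_def)
    qed
    then have "w1 \<noteq> (\<lambda>_. 0)" using sub_zero[OF W] by blast
    then obtain z0 where z0: "w1 z0 \<noteq> 0" by auto
    then have z0D: "z0 \<in> D" using supp w1(1) step.prems(2) by blast
    define v where "v = (\<lambda>z. inverse (w1 z0) * w1 z)"
    have vU: "v \<in> U" unfolding v_def by (rule sub_scale[OF U w1(1)])
    have v1: "v z0 = 1" using z0 by (simp add: v_def)
    have vx: "v (x j) = 0" if "j < k" for j
      using dsum[OF that] by (simp add: v_def w1_def)
    have "(\<lambda>z. w1 z0 * v z) \<in> W" if "v \<in> W" using sub_scale[OF W that] .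
    moreover have "(\<lambda>z. w1 z0 * v z) = w1" using z0 by (simp add: v_def mult.assoc[symmetric])
    ultimately have vW: "v \<notin> W" using w1(2) by auto
    obtain v0 b where v0: "v = (\<lambda>z. v0 z + b * f z)" "v0 \<in> W"
      using vU step.prems(2) unfolding extend_def by blast
    have b: "b \<noteq> 0" using vW v0 by auto
    define u' where "u' i = (if i < k then (\<lambda>z. u i z - u i z0 * v z) else v)" for i
    define x' where "x' i = (if i < k then x i else z0)" for i
    have "u' i \<in> U" if "i < Suc k" for i
      using ux sub_diff[OF U _ sub_scale[OF U vU]] vU by (auto simp: u'_def)
    moreover have "x' i \<in> D" if "i < Suc k" for i using ux z0D by (auto simp: x'_def)
    moreover have "u' i (x' j) = (if i = j then 1 else 0)" if "i < Suc k" "j < Suc k" for i j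
      using that dual v1 vx by (auto simp: u'_def x'_def less_Suc_eq)
    moreover have "y z = (\<Sum>i<Suc k. y (x' i) * u' i z)" if y: "y \<in> U" for y z
    proof -
      obtain y0 c where y0: "y = (\<lambda>z. y0 z + c * f z)" "y0 \<in> W"
        using y step.prems(2) unfolding extend_def by blast
      define r where "r = (\<lambda>z. y z + - (c / b) * v z)"
      have "(\<lambda>z. y0 z + - (c / b) * v0 z) \<in> W" by (rule sub_combine[OF W y0(2) v0(2)])
      then have "r \<in> W" by (rule mem_cong) (use b in \<open>simp add: r_def y0(1) v0(1) field_simps\<close>)
      moreover have "r \<in> U" unfolding r_def by (rule sub_combine[OF U y vU])
      ultimately have r: "r z = (\<Sum>i<k. r (x i) * u i z)" for z using repr by blast
      have ry: "r (x i) = y (x i)" if "i < k" for i using vx[OF that] by (simp add: r_def)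
      have rz: "r z = (\<Sum>i<k. y (x i) * u i z)" for z
        unfolding r[of z] by (rule sum.cong) (auto simp: ry)
      have "(\<Sum>i<Suc k. y (x' i) * u' i z) = (\<Sum>i<k. y (x i) * (u i z - u i z0 * v z)) + y z0 * v z"
        by (simp add: u'_def x'_def)
      also have "(\<Sum>i<k. y (x i) * (u i z - u i z0 * v z)) = r z - r z0 * v z"
        unfolding rz by (simp add: right_diff_distrib sum_subtractf sum_distrib_right mult.assoc)
      finally show ?thesis using v1 by (simp add: r_def algebra_simps)
    qed
    ultimately show ?thesis by (intro exI[of _ "Suc k"] exI[of _ u'] exI[of _ x']) auto
  qed
qed

text \<open>Consequently a function outside a flag is separated from it by a finite combination of
  evaluations. This lets pointwise bounds replace bounds on coordinates.\<close>
lemma flag_separate: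
  assumes "flag W" "f \<notin> W" "\<And>x. x \<notin> D \<Longrightarrow> f x = 0"
  shows "\<exists>(k::nat) c x. (\<forall>i<k. x i \<in> D) \<and> (\<forall>w\<in>W. (\<Sum>i<k. c i * w (x i)) = 0) \<and> (\<Sum>i<k. c i * f (x i)) \<noteq> 0"
proof -
  have W: "sub W" using assms(1) by (rule flag_sub)
  obtain k u x where *: "(\<forall>i<k::nat. u i \<in> W \<and> x i \<in> D) \<and>
      (\<forall>i<k. \<forall>j<k. u i (x j) = (if i = j then 1 else 0)) \<and>
      (\<forall>w\<in>W. \<forall>z. w z = (\<Sum>i<k. w (x i) * u i z))"
    using dual_points[OF assms(1) W order_refl] by (elim exE)
  then have ux: "\<And>i. i < k \<Longrightarrow> u i \<in> W \<and> x i \<in> D"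
    and repr: "\<And>w z. w \<in> W \<Longrightarrow> w z = (\<Sum>i<k. w (x i) * u i z)"
    by blast+
  have su: "(\<lambda>z. \<Sum>i<k. f (x i) * u i z) \<in> W"
    by (rule sub_sum[OF _ W]) (auto intro!: sub_scale[OF W] simp: ux)
  have "f \<noteq> (\<lambda>z. \<Sum>i<k. f (x i) * u i z)" using su assms(2) by metis
  then obtain z0 where z0: "f z0 \<noteq> (\<Sum>i<k. f (x i) * u i z0)" by auto
  have "z0 \<in> D"
  proof (rule ccontr)
    assume "z0 \<notin> D"
    then have "u i z0 = 0" if "i < k" for i using flag_supported[OF assms(1)] ux that by blast
    then show False using z0 assms(3)[OF \<open>z0 \<notin> D\<close>] by simp
  qed
  define c where "c i = (if i < k then - u i z0 else 1)" for i
  define y where "y i = (if i < k then x i else z0)" for i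
  have eq: "(\<Sum>i<Suc k. c i * h (y i)) = h z0 - (\<Sum>i<k. h (x i) * u i z0)" for h
    by (simp add: c_def y_def sum_negf mult.commute)
  show ?thesis
    by (intro exI[of _ "Suc k"] exI[of _ c] exI[of _ y])
      (use eq[of f] eq repr z0 \<open>z0 \<in> D\<close> ux in \<open>auto simp: y_def simp del: sum.lessThan_Suc\<close>)
qed

end

section \<open>Bounded orbits of triangular groups\<close>

locale bounded_action = right_action +
  fixes G0 :: "('a \<Rightarrow> 'a) set"
  assumes G0_A: "G0 \<subseteq> A" and id_G0: "id \<in> G0"
    and comp_G0: "a \<in> G0 \<Longrightarrow> b \<in> G0 \<Longrightarrow> a \<circ> b \<in> G0"
    and inv_G0: "a \<in> G0 \<Longrightarrow> \<exists>b\<in>G0. a \<circ> b = id \<and> b \<circ> a = id"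
begin

lemma Ch_id: "\<tau> \<in> Ch \<Longrightarrow> \<tau> id = 1"
  using Ch_mult[OF _ id_A id_A] Ch_nonzero[OF _ id_A] by fastforce

lemma power_G0: "g \<in> G0 \<Longrightarrow> g ^^ j \<in> G0"
  by (induction j) (auto simp: id_def[symmetric] id_G0 comp_G0)

lemma Ch_power: "\<tau> \<in> Ch \<Longrightarrow> g \<in> G0 \<Longrightarrow> \<tau> (g ^^ j) = \<tau> g ^ j"
proof (induction j)
  case 0 then show ?case using Ch_id by (simp add: id_def[symmetric])
next
  case (Suc j)
  then show ?case using Ch_mult[OF Suc.prems(1)] power_G0 G0_A by (simp add: subset_iff)
qed

text \<open>The orbit of \<open>w\<close> under \<open>G0\<close> is pointwise bounded after division by the character \<open>\<tau>\<close>.\<close>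
definition dominated :: "(('a \<Rightarrow> 'a) \<Rightarrow> complex) \<Rightarrow> ('b \<Rightarrow> complex) \<Rightarrow> bool" where
  "dominated \<tau> w \<longleftrightarrow> (\<forall>x\<in>D. \<exists>C. \<forall>g\<in>G0. norm (w (act x g)) \<le> C * norm (\<tau> g))"

lemma dominated_combine:
  assumes "dominated \<tau> v" "dominated \<tau> w" shows "dominated \<tau> (\<lambda>x. v x + c * w x)"
  unfolding dominated_def
proof
  fix x assume "x \<in> D"
  then obtain C1 C2 where C: "\<And>g. g \<in> G0 \<Longrightarrow> norm (v (act x g)) \<le> C1 * norm (\<tau> g)"
    "\<And>g. g \<in> G0 \<Longrightarrow> norm (w (act x g)) \<le> C2 * norm (\<tau> g)"
    using assms unfolding dominated_def by blast
  have "norm (v (act x g) + c * w (act x g)) \<le> (C1 + norm c * C2) * norm (\<tau> g)" if "g \<in> G0" for g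
  proof -
    have "norm (v (act x g) + c * w (act x g)) \<le> norm (v (act x g)) + norm c * norm (w (act x g))"
      by (metis norm_mult norm_triangle_ineq)
    also have "\<dots> \<le> C1 * norm (\<tau> g) + norm c * (C2 * norm (\<tau> g))"
      by (intro add_mono mult_left_mono C that) auto
    finally show ?thesis by (simp add: algebra_simps)
  qed
  then show "\<exists>C. \<forall>g\<in>G0. norm (v (act x g) + c * w (act x g)) \<le> C * norm (\<tau> g)" by blast
qed

lemma dominated_translate:
  assumes "\<tau> \<in> Ch" "dominated \<tau> w" "a \<in> G0" shows "dominated \<tau> (R a w)"
  unfolding dominated_def
proof
  fix x assume x: "x \<in> D"
  then obtain C where C: "\<And>g. g \<in> G0 \<Longrightarrow> norm (w (act x g)) \<le> C * norm (\<tau> g)"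
    using assms(2) unfolding dominated_def by blast
  have "norm (R a w (act x g)) \<le> (C * norm (\<tau> a)) * norm (\<tau> g)" if g: "g \<in> G0" for g
  proof -
    have gA: "g \<in> A" "a \<in> A" using g assms(3) G0_A by auto
    have "R a w (act x g) = w (act x (g \<circ> a))" using x gA by (simp add: R_def act_D act_act)
    then show ?thesis using C[OF comp_G0[OF g assms(3)]] Ch_mult[OF assms(1) gA]
      by (simp add: norm_mult mult_ac)
  qed
  then show "\<exists>C. \<forall>g\<in>G0. norm (R a w (act x g)) \<le> C * norm (\<tau> g)" by blast
qed

lemma bounded_powers_le_one:
  fixes r K :: real
  assumes "\<And>j::nat. r ^ j \<le> K" shows "r \<le> 1"
proof (rule ccontr)
  assume "\<not> r \<le> 1"
  then obtain n where "K < r ^ n" using real_arch_pow[of r K] by auto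
  then show False using assms[of n] by simp
qed

text \<open>Evaluating a separating functional on \<open>R g w = \<sigma>(g) w + lower terms\<close> bounds \<open>\<bar>\<sigma>\<bar> / \<bar>\<tau>\<bar>\<close> on
  the group \<open>G0\<close>. A bounded multiplicative function on a group with positive values is 1: look
  at powers, and at the inverse.\<close>
lemma bounded_character:
  assumes \<tau>: "\<tau> \<in> Ch" and \<sigma>: "\<sigma> \<in> Ch" and W: "flag W" and w: "w \<notin> W" "\<And>x. x \<notin> D \<Longrightarrow> w x = 0"
    and dominated: "dominated \<tau> w" and diff: "\<And>g. g \<in> G0 \<Longrightarrow> (\<lambda>x. R g w x - \<sigma> g * w x) \<in> W" and g: "g \<in> G0"
  shows "norm (\<sigma> g) = norm (\<tau> g)"
proof -
  obtain k c x where x: "\<And>i. i < (k::nat) \<Longrightarrow> x i \<in> D" and zero: "\<And>v. v \<in> W \<Longrightarrow> (\<Sum>i<k. c i * v (x i)) = 0"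
    and nz: "(\<Sum>i<k. c i * w (x i)) \<noteq> 0"
    using flag_separate[OF W w] by blast
  have "\<forall>i\<in>{..<k}. \<exists>C. \<forall>g\<in>G0. norm (w (act (x i) g)) \<le> C * norm (\<tau> g)"
    using dominated x unfolding dominated_def by blast
  from bchoice[OF this] obtain C where
    C: "\<And>i g. i < k \<Longrightarrow> g \<in> G0 \<Longrightarrow> norm (w (act (x i) g)) \<le> C i * norm (\<tau> g)" by auto
  let ?L = "\<Sum>i<k. c i * w (x i)"
  define K where "K = (\<Sum>i<k. norm (c i) * C i) / norm ?L"
  have bound: "norm (\<sigma> g) \<le> K * norm (\<tau> g)" if g: "g \<in> G0" for g
  proof -
    have "(\<Sum>i<k. c i * (R g w (x i) - \<sigma> g * w (x i))) = 0" using zero[OF diff[OF g]] .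
    then have "(\<Sum>i<k. c i * R g w (x i)) = \<sigma> g * ?L"
      by (simp add: right_diff_distrib sum_subtractf sum_distrib_left mult.left_commute)
    then have "norm (\<sigma> g) * norm ?L = norm (\<Sum>i<k. c i * R g w (x i))" by (simp add: norm_mult)
    also have "\<dots> \<le> (\<Sum>i<k. norm (c i) * (C i * norm (\<tau> g)))"
      by (rule sum_norm_le) (auto simp: norm_mult R_def x intro!: mult_left_mono C[OF _ g])
    finally show ?thesis using nz
      by (simp add: K_def field_simps sum_distrib_left sum_distrib_right)
  qed
  have le: "norm (\<sigma> g) \<le> norm (\<tau> g)" if g: "g \<in> G0" for g
  proof -
    have nz: "norm (\<tau> g) > 0" using Ch_nonzero[OF \<tau>] g G0_A by auto
    have "(norm (\<sigma> g) / norm (\<tau> g)) ^ j \<le> K" for j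
      using bound[OF power_G0[OF g, of j]] nz
      by (simp add: Ch_power \<tau> \<sigma> g norm_power power_divide pos_divide_le_eq)
    from bounded_powers_le_one[OF this] show ?thesis using nz by (simp add: pos_divide_le_eq)
  qed
  obtain h where h: "h \<in> G0" "g \<circ> h = id" using inv_G0[OF g] by blast
  have A: "g \<in> A" "h \<in> A" using g h G0_A by auto
  have 1: "\<sigma> g * \<sigma> h = 1" "\<tau> g * \<tau> h = 1"
    using Ch_mult[OF \<sigma> A] Ch_mult[OF \<tau> A] h(2) Ch_id[OF \<tau>] Ch_id[OF \<sigma>] by simp_all
  then have "norm (\<sigma> g) * norm (\<sigma> h) = 1" "norm (\<tau> g) * norm (\<tau> h) = 1"
    by (metis norm_mult norm_one)+
  moreover have "norm (\<sigma> h) > 0" using Ch_nonzero \<sigma> A by auto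
  moreover have "norm (\<tau> g) * norm (\<sigma> h) \<le> norm (\<tau> g) * norm (\<tau> h)"
    using le[OF h(1)] by (rule mult_left_mono) simp
  ultimately have "norm (\<tau> g) * norm (\<sigma> h) \<le> norm (\<sigma> g) * norm (\<sigma> h)" by simp
  then have "norm (\<tau> g) \<le> norm (\<sigma> g)" using \<open>norm (\<sigma> h) > 0\<close> by (rule mult_right_le_imp_le)
  then show ?thesis using le[OF g] by simp
qed

text \<open>A Jordan block has unbounded powers: \<open>R (g\<^sup>j) w = c\<^sup>j w + j c\<^sup>j\<^sup>-\<^sup>1 n\<close>. The induction
  below uses the equation multiplied by \<open>c\<close>, which avoids the exponent \<open>j - 1\<close>.\<close>
lemma linear_growth:
  assumes \<tau>: "\<tau> \<in> Ch" and dominated: "dominated \<tau> w" and g: "g \<in> G0" and c: "norm c = norm (\<tau> g)"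
    and w: "R g w = (\<lambda>x. c * w x + n x)" and n: "R g n = (\<lambda>x. c * n x)" and x: "x \<in> D"
  shows "n x = 0"
proof (rule ccontr)
  assume nx: "n x \<noteq> 0"
  have A: "g ^^ j \<in> A" for j using power_G0[OF g] G0_A by blast
  have gA: "g \<in> A" using g G0_A by blast
  have R_Suc: "R (g ^^ Suc j) f = R (g ^^ j) (R g f)" for f j
    using R_comp[OF A gA, of j f] by (simp add: funpow_Suc_right del: funpow.simps)
  have nj: "R (g ^^ j) n y = c ^ j * n y" if "y \<in> D" for j y
  proof (induction j)
    case 0 then show ?case using that by (simp add: R_def id_def[symmetric] act_id)
  next
    case (Suc j)
    have "R (g ^^ Suc j) n y = c * R (g ^^ j) n y" unfolding R_Suc n R_scale ..
    then show ?case using Suc.IH by (simp del: funpow.simps)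
  qed
  have wj: "c * R (g ^^ j) w x = c ^ Suc j * w x + of_nat j * c ^ j * n x" for j
  proof (induction j)
    case 0 then show ?case using x by (simp add: R_def id_def[symmetric] act_id)
  next
    case (Suc j)
    have "R (g ^^ Suc j) w x = c * R (g ^^ j) w x + R (g ^^ j) n x"
      unfolding R_Suc w using R_linear[of "g ^^ j" n c w] by (simp add: add.commute)
    then show ?case using Suc nj[OF x, of j] by (simp add: algebra_simps del: funpow.simps)
  qed
  obtain C where C: "\<And>g. g \<in> G0 \<Longrightarrow> norm (w (act x g)) \<le> C * norm (\<tau> g)"
    using dominated x unfolding dominated_def by blast
  have c0: "norm c > 0" using c Ch_nonzero[OF \<tau> gA] by simp
  have "real j * norm (n x) \<le> norm c * (C + norm (w x))" for j
  proof -
    have "norm (of_nat j * c ^ j * n x) = norm (c * R (g ^^ j) w x - c ^ Suc j * w x)"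
      using wj[of j] by simp
    also have "\<dots> \<le> norm c * norm (R (g ^^ j) w x) + norm c ^ Suc j * norm (w x)"
      by (metis norm_triangle_ineq4 norm_mult norm_power)
    also have "norm (R (g ^^ j) w x) \<le> C * norm c ^ j"
      using C[OF power_G0[OF g, of j]] x c by (simp add: R_def Ch_power \<tau> g norm_power)
    finally have "norm c ^ j * (real j * norm (n x)) \<le> norm c ^ j * (norm c * (C + norm (w x)))"
      using c0 by (simp add: norm_mult norm_power algebra_simps)
    then show ?thesis using c0 by simp
  qed
  moreover obtain j where "norm c * (C + norm (w x)) < real j * norm (n x)"
    using reals_Archimedean3[of "norm (n x)"] nx by auto
  ultimately show False by (meson leD)
qed

definition eig :: "(('a \<Rightarrow> 'a) \<Rightarrow> complex) \<Rightarrow> (('a \<Rightarrow> 'a) \<Rightarrow> complex) \<Rightarrow> ('b \<Rightarrow> complex) set" where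
  "eig \<tau> \<sigma> = {f. dominated \<tau> f \<and> reg f \<and> (\<forall>g\<in>G0. R g f = (\<lambda>x. \<sigma> g * f x))}"

text \<open>Sums of eigenfunctions of \<open>G0\<close>, one for each character in the list; the list may have
  repetitions.\<close>
primrec eigsum :: "(('a \<Rightarrow> 'a) \<Rightarrow> complex) \<Rightarrow> (('a \<Rightarrow> 'a) \<Rightarrow> complex) list \<Rightarrow> ('b \<Rightarrow> complex) set" where
  "eigsum \<tau> [] = {\<lambda>_. 0}"
| "eigsum \<tau> (\<sigma> # cs) = {(\<lambda>x. u x + v x) |u v. u \<in> eig \<tau> \<sigma> \<and> v \<in> eigsum \<tau> cs}"

lemma sub_eig: "sub (eig \<tau> \<sigma>)"
  unfolding sub_def
proof (intro conjI ballI allI)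
  show "(\<lambda>_. 0) \<in> eig \<tau> \<sigma>" unfolding eig_def dominated_def using reg_zero
    by (auto simp: R_def intro!: exI[of _ 0])
  fix f g c assume fg: "f \<in> eig \<tau> \<sigma>" "g \<in> eig \<tau> \<sigma>"
  then show "(\<lambda>x. f x + c * g x) \<in> eig \<tau> \<sigma>"
    unfolding eig_def by (auto intro!: dominated_combine reg_combine simp: R_linear algebra_simps)
qed

lemma eigsum_ConsI: "u \<in> eig \<tau> \<sigma> \<Longrightarrow> v \<in> eigsum \<tau> cs \<Longrightarrow> (\<lambda>x. u x + v x) \<in> eigsum \<tau> (\<sigma> # cs)"
  by auto

lemma eigsum_subtract:
  assumes "g \<in> G0" shows "v \<in> eigsum \<tau> cs \<Longrightarrow> (\<lambda>x. R g v x - d * v x) \<in> eigsum \<tau> cs"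
proof (induction cs arbitrary: v)
  case Nil then show ?case by (auto simp: R_def)
next
  case (Cons \<sigma> cs)
  then obtain u w where v: "v = (\<lambda>x. u x + w x)" "u \<in> eig \<tau> \<sigma>" "w \<in> eigsum \<tau> cs" by auto
  have "(\<lambda>x. (\<sigma> g - d) * u x + (R g w x - d * w x)) \<in> eigsum \<tau> (\<sigma> # cs)"
    by (rule eigsum_ConsI[OF sub_scale[OF sub_eig v(2)] Cons.IH[OF v(3)]])
  moreover have "R g u = (\<lambda>x. \<sigma> g * u x)" using v(2) assms by (simp add: eig_def)
  ultimately show ?case
    using R_linear[of g u 1 w] by (elim mem_cong) (simp add: v(1) algebra_simps)
qed

lemma eigsum_kill:
  assumes "g \<in> G0" "v \<in> eigsum \<tau> (\<sigma> # cs)"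
  shows "(\<lambda>x. R g v x - \<sigma> g * v x) \<in> eigsum \<tau> cs"
proof -
  obtain u w where v: "v = (\<lambda>x. u x + w x)" "u \<in> eig \<tau> \<sigma>" "w \<in> eigsum \<tau> cs" using assms(2) by auto
  have "R g u = (\<lambda>x. \<sigma> g * u x)" using v(2) assms by (simp add: eig_def)
  then show ?thesis using eigsum_subtract[OF assms(1) v(3), of "\<sigma> g"] R_linear[of g u 1 w]
    by (elim mem_cong) (simp add: v(1) algebra_simps)
qed

lemma eigsum_fixed:
  assumes "g \<in> G0" "\<And>\<sigma>. \<sigma> \<in> set cs \<Longrightarrow> \<sigma> g = 1" "v \<in> eigsum \<tau> cs"
  shows "R g v = v"
  using assms(2,3)
proof (induction cs arbitrary: v)
  case Nil then show ?case by (auto simp: R_def)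
next
  case (Cons \<sigma> cs)
  then obtain u w where v: "v = (\<lambda>x. u x + w x)" "u \<in> eig \<tau> \<sigma>" "w \<in> eigsum \<tau> cs" by auto
  have "\<sigma> g = 1" using Cons.prems(1) by simp
  then have "R g u = u" using v(2) assms(1) by (simp add: eig_def)
  moreover have "R g w = w" using Cons.IH[OF _ v(3)] Cons.prems(1) by simp
  ultimately show ?case using R_linear[of g u 1 w] by (simp add: v(1))
qed

text \<open>Suppose that all \<open>R g w - \<sigma>(g) w\<close> are sums of eigenfunctions. A character \<open>\<rho>\<close> among theirs
  that differs from \<open>\<sigma>\<close> at \<open>h\<close> is removed by replacing \<open>w\<close> with \<open>R h w - \<rho>(h) w\<close>; this only
  multiplies \<open>w\<close> by the nonzero number \<open>\<sigma>(h) - \<rho>(h)\<close> modulo \<open>W\<close>. When only \<open>\<sigma>\<close> is left,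
  \<open>linear_growth\<close> shows that \<open>w\<close> is an eigenfunction.\<close>
lemma split_off_eigenvector:
  assumes \<tau>: "\<tau> \<in> Ch" and W: "flag W" and \<sigma>: "\<sigma> \<in> Ch"
    and norm: "\<And>g. g \<in> G0 \<Longrightarrow> norm (\<sigma> g) = norm (\<tau> g)"
    and f: "reg f" "\<And>a. a \<in> A \<Longrightarrow> (\<lambda>x. R a f x - \<sigma> a * f x) \<in> W"
    and commute: "\<And>w g h. w \<in> extend W f \<Longrightarrow> dominated \<tau> w \<Longrightarrow> g \<in> G0 \<Longrightarrow> h \<in> G0 \<Longrightarrow>
      R g (R h w) = R h (R g w)"
  shows "w \<in> extend W f \<Longrightarrow> dominated \<tau> w \<Longrightarrow>
    (\<And>g. g \<in> G0 \<Longrightarrow> (\<lambda>x. R g w x - \<sigma> g * w x) \<in> eigsum \<tau> (\<sigma> # cs)) \<Longrightarrow>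
    \<exists>c w'. c \<noteq> 0 \<and> w' \<in> eig \<tau> \<sigma> \<and> (\<lambda>x. w' x - c * w x) \<in> W"
proof (induction cs arbitrary: w)
  case Nil
  have flag': "flag (extend W f)" using W \<sigma> f by (rule flag.step)
  have "R g w = (\<lambda>x. \<sigma> g * w x)" if g: "g \<in> G0" for g
  proof -
    define n where "n = (\<lambda>x. R g w x - \<sigma> g * w x)"
    have "n \<in> eig \<tau> \<sigma>" using Nil.prems(3)[OF g] by (auto simp: n_def)
    then have "R g n = (\<lambda>x. \<sigma> g * n x)" using g by (simp add: eig_def)
    from linear_growth[OF \<tau> Nil.prems(2) g norm[OF g] _ this] have nD: "n x = 0" if "x \<in> D" for x
      using that by (simp add: n_def)
    have "n x = 0" if "x \<notin> D" for x
      using flag_supported[OF flag' Nil.prems(1) that] that by (simp add: n_def R_def)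
    with nD have "n x = 0" for x by blast
    then show ?thesis by (auto simp: n_def fun_eq_iff)
  qed
  then have "w \<in> eig \<tau> \<sigma>" using Nil.prems(2) flag_reg[OF flag' Nil.prems(1)] by (simp add: eig_def)
  then show ?case using sub_zero[OF flag_sub[OF W]] by (intro exI[of _ 1] exI[of _ w]) simp
next
  case (Cons \<rho> cs)
  have flag': "flag (extend W f)" using W \<sigma> f by (rule flag.step)
  show ?case
  proof (cases "\<forall>g\<in>G0. \<rho> g = \<sigma> g")
    case True
    then have eq: "eig \<tau> \<rho> = eig \<tau> \<sigma>" by (simp add: eig_def)
    have "eigsum \<tau> (\<sigma> # \<rho> # cs) \<subseteq> eigsum \<tau> (\<sigma> # cs)"
    proof
      fix v assume "v \<in> eigsum \<tau> (\<sigma> # \<rho> # cs)"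
      then obtain u u' y where v: "v = (\<lambda>x. u x + (u' x + y x))" "u \<in> eig \<tau> \<sigma>" "u' \<in> eig \<tau> \<sigma>"
        "y \<in> eigsum \<tau> cs" using eq by auto
      have "(\<lambda>x. (u x + u' x) + y x) \<in> eigsum \<tau> (\<sigma> # cs)"
        by (rule eigsum_ConsI[OF sub_add[OF sub_eig v(2,3)] v(4)])
      then show "v \<in> eigsum \<tau> (\<sigma> # cs)" by (rule mem_cong) (simp add: v(1) add.assoc)
    qed
    then show ?thesis using Cons.IH[OF Cons.prems(1,2)] Cons.prems(3) by blast
  next
    case False
    then obtain h where h: "h \<in> G0" "\<rho> h \<noteq> \<sigma> h" by blast
    have hA: "h \<in> A" using h G0_A by blast
    define w1 where "w1 = (\<lambda>x. R h w x - \<rho> h * w x)"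
    have w1E: "w1 \<in> extend W f"
      using sub_combine[OF flag_sub[OF flag'] flag_invariant[OF flag' Cons.prems(1) hA] Cons.prems(1), of "- \<rho> h"]
      by (simp add: w1_def)
    have w1bd: "dominated \<tau> w1"
      using dominated_combine[OF dominated_translate[OF \<tau> Cons.prems(2) h(1)] Cons.prems(2), of "- \<rho> h"]
      by (simp add: w1_def)
    have "(\<lambda>x. R g w1 x - \<sigma> g * w1 x) \<in> eigsum \<tau> (\<sigma> # cs)" if g: "g \<in> G0" for g
    proof -
      define v where "v = (\<lambda>x. R g w x - \<sigma> g * w x)"
      have "v \<in> eigsum \<tau> (\<sigma> # \<rho> # cs)" using Cons.prems(3)[OF g] by (simp add: v_def)
      then obtain u y where v: "v = (\<lambda>x. u x + y x)" "u \<in> eig \<tau> \<sigma>" "y \<in> eigsum \<tau> (\<rho> # cs)"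
        unfolding eigsum.simps(2)[of \<tau> \<sigma>] by blast
      have Ru: "R h u = (\<lambda>x. \<sigma> h * u x)" using v(2) h by (simp add: eig_def)
      have "(\<lambda>x. (\<sigma> h - \<rho> h) * u x + (R h y x - \<rho> h * y x)) \<in> eigsum \<tau> (\<sigma> # cs)"
        by (rule eigsum_ConsI[OF sub_scale[OF sub_eig v(2)] eigsum_kill[OF h(1) v(3)]])
      then have "(\<lambda>x. R h v x - \<rho> h * v x) \<in> eigsum \<tau> (\<sigma> # cs)"
        using R_linear[of h u 1 y] by (elim mem_cong) (simp add: v(1) Ru algebra_simps)
      then show ?thesis
      proof (rule mem_cong)
        fix x
        have "R g w1 x = R g (R h w) x - \<rho> h * R g w x" by (simp add: w1_def R_diff)
        moreover have "R h v x = R h (R g w) x - \<sigma> g * R h w x" by (simp add: v_def R_diff)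
        ultimately show "R g w1 x - \<sigma> g * w1 x = R h v x - \<rho> h * v x"
          using commute[OF Cons.prems(1,2) g h(1)] by (simp add: w1_def v_def algebra_simps)
      qed
    qed
    from Cons.IH[OF w1E w1bd this] obtain c w' where
      w': "c \<noteq> 0" "w' \<in> eig \<tau> \<sigma>" "(\<lambda>x. w' x - c * w1 x) \<in> W" by blast
    have "(\<lambda>x. R h w x - \<sigma> h * w x) \<in> W"
      using flag_step_diff[OF W f(2) Cons.prems(1) hA] by blast
    from sub_combine[OF flag_sub[OF W] w'(3) this, of c]
    have "(\<lambda>x. w' x - c * (\<sigma> h - \<rho> h) * w x) \<in> W"
      by (rule mem_cong) (simp add: w1_def algebra_simps)
    moreover have "c * (\<sigma> h - \<rho> h) \<noteq> 0" using w' h by simp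
    ultimately show ?thesis using w'(2) by blast
  qed
qed

text \<open>Bounded triangular representations are semisimple and the moduli of their characters
  agree. In the inductive step, a commutator \<open>k\<close> has value 1 under all characters, so
  \<open>R k w - w\<close> is fixed by \<open>R k\<close> by the induction hypothesis and vanishes by \<open>linear_growth\<close>. So
  translations commute on bounded elements of the next step, and \<open>split_off_eigenvector\<close>
  applies.\<close>
lemma bounded_decomposition:
  assumes \<tau>: "\<tau> \<in> Ch" and "flag W"
  shows "\<exists>cs. (\<forall>\<sigma>\<in>set cs. \<sigma> \<in> Ch \<and> (\<forall>g\<in>G0. norm (\<sigma> g) = norm (\<tau> g))) \<and>
    (\<forall>w\<in>W. dominated \<tau> w \<longrightarrow> w \<in> eigsum \<tau> cs)"
  using assms(2)
proof (induction rule: flag.induct)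
  case zero
  show ?case by (intro exI[of _ "[]"]) simp
next
  case (step W \<sigma> f)
  then obtain cs where cs: "\<And>\<rho>. \<rho> \<in> set cs \<Longrightarrow> \<rho> \<in> Ch"
      "\<And>\<rho> g. \<rho> \<in> set cs \<Longrightarrow> g \<in> G0 \<Longrightarrow> norm (\<rho> g) = norm (\<tau> g)"
    and dec: "\<And>w. w \<in> W \<Longrightarrow> dominated \<tau> w \<Longrightarrow> w \<in> eigsum \<tau> cs" by blast
  note W = step.hyps(1) and \<sigma> = step.hyps(2)
  have flag': "flag (extend W f)" using step.hyps by (rule flag.step)
  show ?case
  proof (cases "\<forall>w\<in>extend W f. dominated \<tau> w \<longrightarrow> w \<in> W")
    case True
    then show ?thesis using cs dec by blast
  next
    case False
    then obtain w0 where w0: "w0 \<in> extend W f" "dominated \<tau> w0" "w0 \<notin> W" by blast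
    have diffW: "(\<lambda>x. R g w x - \<sigma> g * w x) \<in> W" if "w \<in> extend W f" "g \<in> G0" for w g
      using flag_step_diff[OF W step.hyps(4) that(1)] that(2) G0_A by blast
    have norm: "norm (\<sigma> g) = norm (\<tau> g)" if "g \<in> G0" for g
      using bounded_character[OF \<tau> \<sigma> W w0(3) _ w0(2) diffW[OF w0(1)] that]
        flag_supported[OF flag' w0(1)] by blast
    have n: "(\<lambda>x. R g w x - \<sigma> g * w x) \<in> eigsum \<tau> cs" if "w \<in> extend W f" "dominated \<tau> w" "g \<in> G0" for w g
      using dec[OF diffW[OF that(1,3)]] dominated_combine[OF dominated_translate[OF \<tau> that(2,3)] that(2), of "- \<sigma> g"]
      by simp
    have commute: "R g (R h w) = R h (R g w)"
      if w: "w \<in> extend W f" "dominated \<tau> w" and g: "g \<in> G0" and h: "h \<in> G0" for w g h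
    proof -
      obtain g' h' where g': "g' \<in> G0" "g \<circ> g' = id" and h': "h' \<in> G0" "h \<circ> h' = id"
        using inv_G0 g h by blast
      define k where "k = g' \<circ> h' \<circ> g \<circ> h"
      have kG: "k \<in> G0" unfolding k_def by (intro comp_G0 g h g' h')
      have A: "g \<in> A" "h \<in> A" "g' \<in> A" "h' \<in> A" "k \<in> A" using g h g' h' kG G0_A by auto
      have k1: "\<rho> k = 1" if \<rho>: "\<rho> \<in> Ch" for \<rho>
      proof -
        have "\<rho> g * \<rho> g' = 1" "\<rho> h * \<rho> h' = 1"
          using Ch_mult[OF \<rho>] A g' h' Ch_id[OF \<rho>] by metis+
        moreover have "\<rho> k = \<rho> g' * \<rho> h' * \<rho> g * \<rho> h"
          unfolding k_def using A by (simp add: Ch_mult[OF \<rho>] comp_A)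
        moreover have "\<rho> g' * \<rho> h' * \<rho> g * \<rho> h = (\<rho> g * \<rho> g') * (\<rho> h * \<rho> h')" by (simp only: mult_ac)
        ultimately show ?thesis by simp
      qed
      define m where "m = (\<lambda>x. R k w x - w x)"
      have "m \<in> eigsum \<tau> cs" using n[OF w kG] k1[OF \<sigma>] by (simp add: m_def)
      then have Rm: "R k m = m" using eigsum_fixed[OF kG] k1 cs(1) by blast
      have "m x = 0" if "x \<in> D" for x
        by (rule linear_growth[OF \<tau> w(2) kG, of 1 m]) (use Rm that k1[OF \<tau>] in \<open>simp_all add: m_def\<close>)
      moreover have "m x = 0" if "x \<notin> D" for x
        using that flag_supported[OF flag' w(1)] by (simp add: m_def R_def)
      ultimately have Rk: "R k w = w" by (auto simp: m_def fun_eq_iff)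
      have eq: "(h \<circ> g) \<circ> k = g \<circ> h"
      proof
        fix x
        have "\<And>y. g (g' y) = y" "\<And>y. h (h' y) = y" using g' h' by (metis comp_apply id_apply)+
        then show "((h \<circ> g) \<circ> k) x = (g \<circ> h) x" by (simp add: k_def)
      qed
      have "R (g \<circ> h) w = R (h \<circ> g) (R k w)"
        unfolding eq[symmetric] by (rule R_comp) (use A comp_A in auto)
      then show ?thesis using A Rk by (simp add: R_comp)
    qed
    have "w \<in> eigsum \<tau> (\<sigma> # cs)" if w: "w \<in> extend W f" "dominated \<tau> w" for w
    proof -
      have "(\<lambda>x. R g w x - \<sigma> g * w x) \<in> eigsum \<tau> (\<sigma> # cs)" if "g \<in> G0" for g
        using eigsum_ConsI[OF sub_zero[OF sub_eig] n[OF w that]] by simp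
      from split_off_eigenvector[OF \<tau> W \<sigma> norm step.hyps(3,4) commute w this]
      obtain c w' where w': "c \<noteq> 0" "w' \<in> eig \<tau> \<sigma>" "(\<lambda>x. w' x - c * w x) \<in> W" by blast
      define v where "v = (\<lambda>x. w x + - inverse c * w' x)"
      have "v \<in> W" using sub_scale[OF flag_sub[OF W] w'(3), of "- inverse c"]
        by (rule mem_cong) (use w'(1) in \<open>simp add: v_def field_simps\<close>)
      moreover have "dominated \<tau> v" unfolding v_def using w(2) w'(2) by (intro dominated_combine) (auto simp: eig_def)
      ultimately have "v \<in> eigsum \<tau> cs" by (rule dec)
      then have "(\<lambda>x. inverse c * w' x + v x) \<in> eigsum \<tau> (\<sigma> # cs)"
        by (rule eigsum_ConsI[OF sub_scale[OF sub_eig w'(2)]])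
      then show ?thesis by (rule mem_cong) (simp add: v_def)
    qed
    then show ?thesis using cs \<sigma> norm by (intro exI[of _ "\<sigma> # cs"]) auto
  qed
qed

text \<open>The eigenfunction equations that \<open>bounded_decomposition\<close> provides on \<open>G0\<close> are regular in
  the group element and therefore hold on all of \<open>A\<close>, where the characters involved agree with
  \<open>\<tau>\<close> on \<open>S\<close>.\<close>
theorem bounded_semi_invariant:
  assumes \<tau>: "\<tau> \<in> Ch" and F: "in_flag F" and dominated: "dominated \<tau> F" and S: "S \<subseteq> A"
    and rigid: "\<And>\<sigma> s. \<sigma> \<in> Ch \<Longrightarrow> (\<And>g. g \<in> G0 \<Longrightarrow> norm (\<sigma> g) = norm (\<tau> g)) \<Longrightarrow> s \<in> S \<Longrightarrow> \<sigma> s = \<tau> s"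
    and dense: "\<And>p a. p \<in> Reg \<Longrightarrow> (\<And>g. g \<in> G0 \<Longrightarrow> p g = 0) \<Longrightarrow> a \<in> A \<Longrightarrow> p a = 0"
    and s: "s \<in> S"
  shows "R s F = (\<lambda>x. \<tau> s * F x)"
proof -
  obtain W where W: "flag W" "F \<in> W" using F unfolding in_flag_def by blast
  obtain cs where cs: "\<And>\<sigma>. \<sigma> \<in> set cs \<Longrightarrow> \<sigma> \<in> Ch"
      "\<And>\<sigma> g. \<sigma> \<in> set cs \<Longrightarrow> g \<in> G0 \<Longrightarrow> norm (\<sigma> g) = norm (\<tau> g)"
    and mem: "F \<in> eigsum \<tau> cs"
    using bounded_decomposition[OF \<tau> W(1)] W(2) dominated by blast
  have eig: "R s u x = \<tau> s * u x" if \<sigma>: "\<sigma> \<in> set cs" and u: "u \<in> eig \<tau> \<sigma>" for \<sigma> u x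
  proof (cases "x \<in> D")
    case True
    have ru: "reg u" and Ru: "\<And>g. g \<in> G0 \<Longrightarrow> R g u = (\<lambda>x. \<sigma> g * u x)"
      using u by (simp_all add: eig_def)
    obtain p where p: "p \<in> Reg" "\<And>a. a \<in> A \<Longrightarrow> u (act x a) = p a"
      using ru True unfolding reg_def by blast
    have q: "(\<lambda>a. p a + (- u x) * \<sigma> a) \<in> Reg"
      using p(1) cs(1)[OF \<sigma>] Ch_Reg by (intro Reg_add Reg_mult Reg_const) auto
    have "p g + (- u x) * \<sigma> g = 0" if g: "g \<in> G0" for g
      using fun_cong[OF Ru[OF g], of x] p(2)[of g] g G0_A True by (auto simp: R_def mult.commute)
    from dense[OF q this] have "p s + (- u x) * \<sigma> s = 0" using s S by blast
    then have "R s u x = \<sigma> s * u x" using p(2)[of s] s S True by (auto simp: R_def)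
    then show ?thesis using rigid[OF cs(1)[OF \<sigma>] cs(2)[OF \<sigma>] s] by simp
  next
    case False
    have "R id u = (\<lambda>x. \<sigma> id * u x)" using u id_G0 by (simp add: eig_def)
    from fun_cong[OF this, of x] have "u x = 0"
      using False Ch_id[OF cs(1)[OF \<sigma>]] by (simp add: R_def)
    then show ?thesis using False by (simp add: R_def)
  qed
  have "R s v x = \<tau> s * v x" if "v \<in> eigsum \<tau> ds" "set ds \<subseteq> set cs" for v x ds
    using that
  proof (induction ds arbitrary: v)
    case Nil then show ?case by (simp add: R_def)
  next
    case (Cons \<sigma> ds)
    then obtain u w where v: "v = (\<lambda>x. u x + w x)" "u \<in> eig \<tau> \<sigma>" "w \<in> eigsum \<tau> ds" by auto
    then have "R s w x = \<tau> s * w x" using Cons.IH Cons.prems(2) by simp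
    moreover have "R s u x = \<tau> s * u x" using eig[OF _ v(2)] Cons.prems(2) by simp
    ultimately show ?case using R_linear[of s u 1 w] by (simp add: v(1) algebra_simps)
  qed
  then show ?thesis using mem by blast
qed

end

section \<open>The complex Zariski closure of a triangular group\<close>

text \<open>A group that is triangular in two bases whose diagonal characters are complex conjugate to
  each other. It abstracts from the complexification of a real group, where the second basis is
  the conjugate of the first.\<close>
locale conjugate_triangular = complex_fin_dim sc + b1: dual_basis sc e l n + b2: dual_basis sc e' l' n
  for sc :: "complex \<Rightarrow> 'w::ab_group_add \<Rightarrow> 'w" and e l e' l' n +
  fixes G0 :: "('w \<Rightarrow> 'w) set"
  assumes G0_GL: "g \<in> G0 \<Longrightarrow> lin g \<and> bij g" and id_G0: "id \<in> G0"
    and comp_G0: "a \<in> G0 \<Longrightarrow> b \<in> G0 \<Longrightarrow> a \<circ> b \<in> G0"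
    and inv_G0: "a \<in> G0 \<Longrightarrow> \<exists>b\<in>G0. a \<circ> b = id \<and> b \<circ> a = id"
    and upper1: "g \<in> G0 \<Longrightarrow> b1.upper g" and upper2: "g \<in> G0 \<Longrightarrow> b2.upper g"
    and conj_diag: "g \<in> G0 \<Longrightarrow> j < n \<Longrightarrow> b2.diag j g = cnj (b1.diag j g)"
begin

abbreviation M :: "('w \<Rightarrow> 'w) set" where "M \<equiv> carrier (GL sc)"

definition right_mult :: "('w \<Rightarrow> 'w) \<Rightarrow> ('w \<Rightarrow> 'w) \<Rightarrow> 'w \<Rightarrow> 'w" where "right_mult x a = x \<circ> a"

abbreviation pol :: "(('w \<Rightarrow> 'w) \<Rightarrow> complex) \<Rightarrow> bool" where "pol \<equiv> polynomial_fun sc"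

text \<open>The Zariski closure of \<open>G0\<close>, in the form in which it is used.\<close>
definition A :: "('w \<Rightarrow> 'w) set" where
  "A = {a \<in> M. \<forall>p. pol p \<longrightarrow> (\<forall>g\<in>G0. p g = 0) \<longrightarrow> p a = 0}"

text \<open>The elements on which each diagonal character agrees with its conjugate character; for the
  complexification of a real group this cuts out what can be trigonalized over the reals.\<close>
definition B :: "('w \<Rightarrow> 'w) set" where
  "B = {a \<in> A. \<forall>j<n. b2.diag j a = b1.diag j a}"

lemma A_zero: "a \<in> A \<Longrightarrow> pol p \<Longrightarrow> (\<And>g. g \<in> G0 \<Longrightarrow> p g = 0) \<Longrightarrow> p a = 0"
  by (simp add: A_def)

lemma A_M: "a \<in> A \<Longrightarrow> a \<in> M" by (simp add: A_def)

lemma G0_A: "G0 \<subseteq> A" using G0_GL by (auto simp: A_def carrier_GL_iff)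

lemma M_comp: "a \<in> M \<Longrightarrow> b \<in> M \<Longrightarrow> a \<circ> b \<in> M"
  using Vector_Spaces.linear_compose[of sc sc b sc a] bij_comp[of b a] by (simp add: carrier_GL_iff)

lemma A_comp: assumes "a \<in> A" "b \<in> A" shows "a \<circ> b \<in> A"
  unfolding A_def
proof (rule CollectI, intro conjI allI impI)
  show "a \<circ> b \<in> M" using M_comp A_M assms by blast
  fix p assume p: "pol p" "\<forall>g\<in>G0. p g = 0"
  have "p (g \<circ> b) = 0" if g: "g \<in> G0" for g
  proof (rule A_zero[OF assms(2) polynomial_fun_left[OF p(1), of g]])
    show "lin g" using G0_GL[OF g] by simp
    show "p (g \<circ> h) = 0" if "h \<in> G0" for h using p(2) comp_G0[OF g that] by simp
  qed
  then show "p (a \<circ> b) = 0"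
    by (rule A_zero[OF assms(1) polynomial_fun_right[OF p(1), of b]])
qed

lemma A_upper: assumes "a \<in> A" shows "b1.upper a" "b2.upper a"
proof -
  show "b1.upper a" unfolding b1.upper_def
  proof (intro allI impI)
    fix i j assume "j < n" "i < n" "j < i"
    then show "l i (a (e j)) = 0"
      by (intro A_zero[OF assms polynomial_fun.coefficient[OF b1.l_lin], of i "e j"])
        (use upper1 in \<open>simp_all add: b1.upper_def\<close>)
  qed
  show "b2.upper a" unfolding b2.upper_def
  proof (intro allI impI)
    fix i j assume "j < n" "i < n" "j < i"
    then show "l' i (a (e' j)) = 0"
      by (intro A_zero[OF assms polynomial_fun.coefficient[OF b2.l_lin], of i "e' j"])
        (use upper2 in \<open>simp_all add: b2.upper_def\<close>)
  qed
qed

text \<open>Polynomial characters \<open>\<tau>\<close> of \<open>A\<close> for which the conjugate \<open>cnj \<circ> \<tau>\<close> on \<open>G0\<close> is the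
  restriction of a polynomial \<open>\<tau>'\<close> that agrees with \<open>\<tau>\<close> on \<open>B\<close>. They are closed under products
  and contain the diagonal characters.\<close>
definition Ch :: "(('w \<Rightarrow> 'w) \<Rightarrow> complex) set" where
  "Ch = {\<tau>. pol \<tau> \<and> (\<forall>a\<in>A. \<forall>b\<in>A. \<tau> (a \<circ> b) = \<tau> a * \<tau> b) \<and> (\<forall>a\<in>A. \<tau> a \<noteq> 0) \<and>
    (\<exists>\<tau>'. pol \<tau>' \<and> (\<forall>g\<in>G0. \<tau>' g = cnj (\<tau> g)) \<and> (\<forall>s\<in>B. \<tau>' s = \<tau> s))}"

lemma Ch_I:
  assumes "pol \<tau>" "\<And>a b. a \<in> A \<Longrightarrow> b \<in> A \<Longrightarrow> \<tau> (a \<circ> b) = \<tau> a * \<tau> b"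
    "\<And>a. a \<in> A \<Longrightarrow> \<tau> a \<noteq> 0" "pol \<tau>'" "\<And>g. g \<in> G0 \<Longrightarrow> \<tau>' g = cnj (\<tau> g)" "\<And>s. s \<in> B \<Longrightarrow> \<tau>' s = \<tau> s"
  shows "\<tau> \<in> Ch"
proof -
  have "\<exists>\<tau>'. pol \<tau>' \<and> (\<forall>g\<in>G0. \<tau>' g = cnj (\<tau> g)) \<and> (\<forall>s\<in>B. \<tau>' s = \<tau> s)"
    by (rule exI[of _ \<tau>']) (simp add: assms)
  then show ?thesis unfolding Ch_def using assms(1-3) by simp
qed

lemma diag_Ch: assumes j: "j < n" shows "b1.diag j \<in> Ch"
proof (rule Ch_I[of _ "b2.diag j"])
  show "b1.diag j (a \<circ> b) = b1.diag j a * b1.diag j b" if ab: "a \<in> A" "b \<in> A" for a b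
  proof (rule b1.diag_mult[OF A_upper(1)[OF ab(1)] _ A_upper(1)[OF ab(2)] j])
    show "lin a" using A_M[OF ab(1)] by (simp add: carrier_GL_iff)
  qed
  show "b1.diag j a \<noteq> 0" if a: "a \<in> A" for a
  proof (rule b1.diag_nonzero[OF A_upper(1)[OF a] _ _ j])
    show "lin a" "inj a" using A_M[OF a] by (simp_all add: carrier_GL_iff bij_is_inj)
  qed
  show "b2.diag j g = cnj (b1.diag j g)" if "g \<in> G0" for g using conj_diag that j by blast
  show "b2.diag j s = b1.diag j s" if "s \<in> B" for s using j that by (simp add: B_def)
  show "pol (b1.diag j)" "pol (b2.diag j)" by (rule b1.polynomial_diag[OF j] b2.polynomial_diag[OF j])+
qed

lemma Ch_one': "(\<lambda>_. 1) \<in> Ch"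
proof (rule Ch_I[of _ "\<lambda>_. 1"])
  show "pol (\<lambda>_. 1)" by (rule polynomial_fun.const)
  then show "pol (\<lambda>_. 1)" .
qed simp_all

lemma Ch_prod': assumes "\<tau> \<in> Ch" "\<sigma> \<in> Ch" shows "(\<lambda>a. \<tau> a * \<sigma> a) \<in> Ch"
proof -
  obtain \<tau>' where \<tau>': "pol \<tau>'" "\<forall>g\<in>G0. \<tau>' g = cnj (\<tau> g)" "\<forall>s\<in>B. \<tau>' s = \<tau> s"
    using assms(1) unfolding Ch_def mem_Collect_eq by (elim conjE exE)
  obtain \<sigma>' where \<sigma>': "pol \<sigma>'" "\<forall>g\<in>G0. \<sigma>' g = cnj (\<sigma> g)" "\<forall>s\<in>B. \<sigma>' s = \<sigma> s"
    using assms(2) unfolding Ch_def mem_Collect_eq by (elim conjE exE)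
  have mult: "pol \<tau>" "pol \<sigma>" "\<And>a b. a \<in> A \<Longrightarrow> b \<in> A \<Longrightarrow> \<tau> (a \<circ> b) = \<tau> a * \<tau> b"
    "\<And>a b. a \<in> A \<Longrightarrow> b \<in> A \<Longrightarrow> \<sigma> (a \<circ> b) = \<sigma> a * \<sigma> b"
    "\<And>a. a \<in> A \<Longrightarrow> \<tau> a \<noteq> 0" "\<And>a. a \<in> A \<Longrightarrow> \<sigma> a \<noteq> 0"
    using assms by (simp_all add: Ch_def)
  show ?thesis
  proof (rule Ch_I[of _ "\<lambda>a. \<tau>' a * \<sigma>' a"])
    show "pol (\<lambda>a. \<tau> a * \<sigma> a)" "pol (\<lambda>a. \<tau>' a * \<sigma>' a)"
      by (rule polynomial_fun.mult; fact)+
  qed (use mult \<tau>' \<sigma>' in simp_all)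
qed

sublocale S: right_action A M right_mult Ch "{p. pol p}"
proof unfold_locales
  show "id \<in> A" using id_G0 G0_A by blast
qed (use A_comp M_comp A_M Ch_prod' Ch_one' in \<open>auto simp: Ch_def right_mult_def o_assoc intro: polynomial_fun.intros\<close>)

text \<open>Expanding \<open>a (e j)\<close> in the basis shows that the functions \<open>x \<mapsto> L (x (e j))\<close> for increasing
  \<open>j\<close> form a flag with characters \<open>diag j\<close>.\<close>
lemma coefficient_in_flag:
  assumes L: "linf L" shows "S.in_flag (\<lambda>x. if x \<in> M then L (x v) else 0)"
proof -
  define f where "f j = (\<lambda>x. if x \<in> M then L (x (e j)) else 0)" for j
  have "j \<le> n \<longrightarrow> (\<exists>W. S.flag W \<and> (\<forall>i<j. f i \<in> W))" for j
  proof (induction j)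
    case 0 show ?case using S.flag.zero by blast
  next
    case (Suc j)
    show ?case
    proof
      assume j: "Suc j \<le> n"
      then obtain W where W: "S.flag W" "\<forall>i<j. f i \<in> W" using Suc Suc_leD by blast
      have "S.flag (S.extend W (f j))"
      proof (rule S.flag.step[OF W(1)])
        show "b1.diag j \<in> Ch" using j by (intro diag_Ch) auto
        show "S.reg (f j)" unfolding S.reg_def
        proof
          fix x assume x: "x \<in> M"
          have "linf (L \<circ> x)" by (rule Vector_Spaces.linear_compose[OF _ L]) (use x carrier_GL_iff in simp)
          from polynomial_fun.coefficient[OF this, of "e j"]
          have "pol (\<lambda>a. L (x (a (e j))))" by (simp add: o_def)
          moreover have "f j (right_mult x a) = L (x (a (e j)))" if "a \<in> A" for a
            using M_comp[OF x A_M[OF that]] by (simp add: f_def right_mult_def)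
          ultimately show "\<exists>p\<in>{p. pol p}. \<forall>a\<in>A. f j (right_mult x a) = p a"
            by (intro bexI[of _ "\<lambda>a. L (x (a (e j)))"]) simp_all
        qed
        fix a assume a: "a \<in> A"
        have "(\<lambda>x. \<Sum>i\<in>{..<j}. l i (a (e j)) * f i x) \<in> W"
          by (rule S.sub_sum[OF _ S.flag_sub[OF W(1)]])
            (use W(2) S.sub_scale[OF S.flag_sub[OF W(1)]] in auto)
        then show "(\<lambda>x. S.R a (f j) x - b1.diag j a * f j x) \<in> W"
        proof (rule S.mem_cong)
          fix x
          show "S.R a (f j) x - b1.diag j a * f j x = (\<Sum>i\<in>{..<j}. l i (a (e j)) * f i x)"
          proof (cases "x \<in> M")
            case False then show ?thesis by (auto simp: S.R_def f_def)
          next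
            case True
            have Lx: "linf (\<lambda>v. L (x v))"
              using Vector_Spaces.linear_compose[of sc sc x "(*)" L] True L by (simp add: o_def carrier_GL_iff)
            have "S.R a (f j) x = L (x (a (e j)))"
              using True M_comp[OF True A_M[OF a]] by (simp add: S.R_def f_def right_mult_def)
            also have "\<dots> = (\<Sum>i<n. l i (a (e j)) * L (x (e i)))" by (rule b1.apply_expand[OF Lx])
            also have "\<dots> = (\<Sum>i<Suc j. l i (a (e j)) * L (x (e i)))"
              using j A_upper(1)[OF a] by (intro sum.mono_neutral_right) (auto simp: b1.upper_def)
            finally show ?thesis using True by (simp add: f_def b1.diag_def)
          qed
        qed
      qed
      moreover have "f i \<in> S.extend W (f j)" if "i < Suc j" for i
        using that W S.extend_base S.extend_new[OF S.flag_sub[OF W(1)]] by (auto simp: less_Suc_eq)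
      ultimately show "\<exists>W. S.flag W \<and> (\<forall>i<Suc j. f i \<in> W)" by blast
    qed
  qed
  then obtain W where W: "S.flag W" "\<And>i. i < n \<Longrightarrow> f i \<in> W" by blast
  have "(\<lambda>x. \<Sum>i\<in>{..<n}. l i v * f i x) \<in> W"
    by (rule S.sub_sum[OF _ S.flag_sub[OF W(1)]])
      (use W(2) S.sub_scale[OF S.flag_sub[OF W(1)]] in auto)
  then have "(\<lambda>x. if x \<in> M then L (x v) else 0) \<in> W"
  proof (rule S.mem_cong)
    fix x
    have "L (x v) = (\<Sum>i<n. l i v * L (x (e i)))" if "x \<in> M"
      using b1.apply_expand[of "\<lambda>v. L (x v)" v] Vector_Spaces.linear_compose[of sc sc x "(*)" L] that L
      by (simp add: o_def carrier_GL_iff)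
    then show "(if x \<in> M then L (x v) else 0) = (\<Sum>i\<in>{..<n}. l i v * f i x)"
      by (auto simp: f_def)
  qed
  then show ?thesis using W(1) unfolding S.in_flag_def by blast
qed

lemma polynomial_in_flag:
  assumes "pol p" shows "S.in_flag (\<lambda>x. if x \<in> M then p x else 0)"
  using assms
proof induction
  case (const c) show ?case by (rule S.in_flag_const)
next
  case (coefficient L v) then show ?case by (rule coefficient_in_flag)
next
  case (add p q)
  have "(\<lambda>x. (if x \<in> M then p x else 0) + 1 * (if x \<in> M then q x else 0)) = (\<lambda>x. if x \<in> M then p x + q x else 0)"
    by auto
  then show ?case using S.in_flag_combine[OF add.IH, of 1] by simp
next
  case (mult p q)
  have "(\<lambda>x. (if x \<in> M then p x else 0) * (if x \<in> M then q x else 0)) = (\<lambda>x. if x \<in> M then p x * q x else 0)"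
    by auto
  then show ?case using S.in_flag_mult[OF mult.IH] by simp
qed

text \<open>The polynomials in a flag that vanish on \<open>G0\<close> form a space stable under \<open>R a\<close>, so \<open>R a\<close>
  maps it onto itself. Writing \<open>p = R a q\<close> gives \<open>p(a\<^sup>-\<^sup>1) = q(1) = 0\<close>.\<close>
lemma A_inverse:
  assumes a: "a \<in> A" and b: "b \<in> M" "b \<circ> a = id" shows "b \<in> A"
  unfolding A_def
proof (rule CollectI, intro conjI allI impI)
  show "b \<in> M" by (rule b(1))
  fix p assume p: "pol p" "\<forall>g\<in>G0. p g = 0"
  let ?p = "\<lambda>x. if x \<in> M then p x else 0"
  obtain W where W: "S.flag W" "?p \<in> W" using polynomial_in_flag[OF p(1)] unfolding S.in_flag_def by blast
  define I where "I = {q \<in> W. \<forall>g\<in>G0. q g = 0}"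
  have "S.sub I" using S.flag_sub[OF W(1)] unfolding I_def S.sub_def by auto
  moreover have "I \<subseteq> W" by (auto simp: I_def)
  moreover have "S.R a q \<in> I" if q: "q \<in> I" for q
  proof -
    have qW: "q \<in> W" and q0: "\<And>g. g \<in> G0 \<Longrightarrow> q g = 0" using q by (auto simp: I_def)
    have "id \<in> M" using S.id_A A_M by blast
    then obtain r where r: "pol r" "\<forall>c\<in>A. q (right_mult id c) = r c"
      using S.flag_reg[OF W(1) qW] unfolding S.reg_def by blast
    have "r g = 0" if "g \<in> G0" for g using that q0[OF that] bspec[OF r(2), of g] G0_A by (auto simp: right_mult_def)
    from A_zero[OF _ r(1) this] have "q c = 0" if "c \<in> A" for c
      using that r(2) by (auto simp: right_mult_def)
    then have "S.R a q g = 0" if "g \<in> G0" for g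
      using A_comp[of g a] a G0_A that by (auto simp: S.R_def right_mult_def)
    then show ?thesis using S.flag_invariant[OF W(1) qW a] by (simp add: I_def)
  qed
  moreover have "?p \<in> I" using W(2) p(2) by (auto simp: I_def)
  ultimately obtain q where q: "q \<in> I" "S.R a q = ?p"
    using S.flag_translate_surj[OF W(1) a] by blast
  have "p b = S.R a q b" using q(2) b by simp
  also have "\<dots> = q id" using b by (simp add: S.R_def right_mult_def)
  also have "\<dots> = 0" using q(1) id_G0 by (simp add: I_def)
  finally show "p b = 0" .
qed

section \<open>Chevalley's line and compactness\<close>

text \<open>On \<open>G0\<close> the hypothesis is the polynomial equation \<open>\<sigma>\<sigma>' = \<tau>\<tau>'\<close>, which extends to \<open>A\<close> and
  becomes \<open>\<sigma>\<^sup>2 = \<tau>\<^sup>2\<close> on \<open>B\<close>. The sets where \<open>\<sigma> = \<tau>\<close> and \<open>\<sigma> = - \<tau>\<close> are closed and disjoint, and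
  the first contains the identity.\<close>
lemma equal_modulus_rigid:
  assumes \<sigma>: "\<sigma> \<in> Ch" and \<tau>: "\<tau> \<in> Ch" and norm: "\<And>g. g \<in> G0 \<Longrightarrow> norm (\<sigma> g) = norm (\<tau> g)"
    and S: "S \<subseteq> B" "id \<in> S" "connectedin (zariski sc) S" and s: "s \<in> S"
  shows "\<sigma> s = \<tau> s"
proof -
  obtain \<tau>' where \<tau>': "pol \<tau>'" "\<forall>g\<in>G0. \<tau>' g = cnj (\<tau> g)" "\<forall>s\<in>B. \<tau>' s = \<tau> s"
    using \<tau> unfolding Ch_def mem_Collect_eq by (elim conjE exE)
  obtain \<sigma>' where \<sigma>': "pol \<sigma>'" "\<forall>g\<in>G0. \<sigma>' g = cnj (\<sigma> g)" "\<forall>s\<in>B. \<sigma>' s = \<sigma> s"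
    using \<sigma> unfolding Ch_def mem_Collect_eq by (elim conjE exE)
  have pol: "pol \<sigma>" "pol \<tau>" using \<sigma> \<tau> by (auto simp: Ch_def)
  have BA: "B \<subseteq> A" by (auto simp: B_def)
  have sq: "\<sigma> b * \<sigma> b = \<tau> b * \<tau> b" if b: "b \<in> B" for b
  proof -
    have P: "pol (\<lambda>a. \<sigma> a * \<sigma>' a - \<tau> a * \<tau>' a)"
      by (intro polynomial_fun_diff polynomial_fun.mult pol \<sigma>'(1) \<tau>'(1))
    have "\<sigma> g * \<sigma>' g - \<tau> g * \<tau>' g = 0" if "g \<in> G0" for g
      using \<sigma>'(2) \<tau>'(2) norm[OF that] that by (simp add: complex_norm_square[symmetric])
    from A_zero[OF _ P this] have "\<sigma> b * \<sigma>' b - \<tau> b * \<tau>' b = 0" using b BA by blast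
    then show ?thesis using \<sigma>'(3) \<tau>'(3) b by simp
  qed
  define E1 where "E1 = {a \<in> M. \<sigma> a - \<tau> a = 0}"
  define E2 where "E2 = {a \<in> M. \<sigma> a + \<tau> a = 0}"
  have cl: "closedin (zariski sc) E1" "closedin (zariski sc) E2"
    unfolding E1_def E2_def
    by (intro closedin_zariski_zero_set polynomial_fun_diff polynomial_fun.add pol)+
  have nz: "\<tau> b \<noteq> 0" if "b \<in> B" for b using \<tau> that BA by (auto simp: Ch_def)
  have "b \<in> E1 \<union> E2" if b: "b \<in> B" for b
  proof -
    have "(\<sigma> b - \<tau> b) * (\<sigma> b + \<tau> b) = 0" using sq[OF b] by (simp add: algebra_simps)
    then have "\<sigma> b - \<tau> b = 0 \<or> \<sigma> b + \<tau> b = 0" by (simp only: mult_eq_0_iff)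
    then show ?thesis using b BA A_M by (auto simp: E1_def E2_def)
  qed
  then have cover: "S \<subseteq> E1 \<union> E2" using S(1) by blast
  have disj: "E1 \<inter> E2 \<inter> S = {}"
  proof (rule ccontr)
    assume "E1 \<inter> E2 \<inter> S \<noteq> {}"
    then obtain b where b: "b \<in> S" "b \<in> E1" "b \<in> E2" by blast
    then have "\<sigma> b = \<tau> b" "\<sigma> b + \<tau> b = 0" by (simp_all add: E1_def E2_def)
    then show False using nz[of b] b(1) S(1) by auto
  qed
  have "\<sigma> id = 1" "\<tau> id = 1"
    using S.Ch_mult[OF \<sigma> S.id_A S.id_A] S.Ch_nonzero[OF \<sigma> S.id_A]
      S.Ch_mult[OF \<tau> S.id_A S.id_A] S.Ch_nonzero[OF \<tau> S.id_A] by simp_all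
  then have "E1 \<inter> S \<noteq> {}" using S(2) A_M[OF S.id_A] by (auto simp: E1_def)
  then have "E2 \<inter> S = {}" using S(3) cl cover disj unfolding connectedin_closedin by blast
  then show ?thesis using s cover by (auto simp: E1_def)
qed

text \<open>All coordinates range over the group, although only finitely many of them matter for a
  given determinant.\<close>
definition tuples :: "(nat \<Rightarrow> 'w \<Rightarrow> 'w) set" where "tuples = {z. \<forall>i. z i \<in> M}"

definition tuple_act :: "(nat \<Rightarrow> 'w \<Rightarrow> 'w) \<Rightarrow> ('w \<Rightarrow> 'w) \<Rightarrow> nat \<Rightarrow> 'w \<Rightarrow> 'w" where
  "tuple_act z a = (\<lambda>i. right_mult (z i) a)"

sublocale T: bounded_action A tuples tuple_act Ch "{p. pol p}" G0
proof unfold_locales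
  fix x a b assume x: "x \<in> tuples" and a: "a \<in> A"
  show "tuple_act x a \<in> tuples" using x S.act_D[OF _ a] by (simp add: tuples_def tuple_act_def)
  show "tuple_act (tuple_act x a) b = tuple_act x (a \<circ> b)" 
    by (simp add: tuple_act_def right_mult_def o_assoc)
next
  fix x :: "nat \<Rightarrow> 'w \<Rightarrow> 'w" show "tuple_act x id = x" by (simp add: tuple_act_def right_mult_def)
qed (fact S.comp_A S.id_A S.Ch_mult S.Ch_nonzero S.Ch_prod S.Ch_one S.Ch_Reg S.Reg_const S.Reg_add S.Reg_mult
    G0_A id_G0 comp_G0 inv_G0)+

definition pull :: "nat \<Rightarrow> (('w \<Rightarrow> 'w) \<Rightarrow> complex) \<Rightarrow> (nat \<Rightarrow> 'w \<Rightarrow> 'w) \<Rightarrow> complex" where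
  "pull t f = (\<lambda>z. if z \<in> tuples then f (z t) else 0)"

lemma pull_R: assumes a: "a \<in> A" shows "T.R a (pull t f) = pull t (S.R a f)"
proof
  fix z
  show "T.R a (pull t f) z = pull t (S.R a f) z"
  proof (cases "z \<in> tuples")
    case True
    then have "z t \<in> M" by (simp add: tuples_def)
    then show ?thesis using True T.act_D[OF True a]
      by (simp add: T.R_def pull_def S.R_def) (simp add: tuple_act_def)
  qed (simp add: T.R_def pull_def)
qed

lemma pull_flag:
  assumes "S.flag W" shows "\<exists>V. T.flag V \<and> (\<forall>f\<in>W. pull t f \<in> V)"
  using assms
proof (induction rule: S.flag.induct)
  case zero
  have "pull t (\<lambda>_. 0) = (\<lambda>_. 0)" by (auto simp: pull_def)
  then show ?case using T.flag.zero by (intro exI[of _ "{\<lambda>_. 0}"]) simp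
next
  case (step W \<tau> f)
  then obtain V where V: "T.flag V" "\<And>w. w \<in> W \<Longrightarrow> pull t w \<in> V" by blast
  have "T.flag (T.extend V (pull t f))"
  proof (rule T.flag.step[OF V(1) step.hyps(2)])
    show "T.reg (pull t f)" unfolding T.reg_def
    proof
      fix z assume z: "z \<in> tuples"
      then have "z t \<in> M" by (simp add: tuples_def)
      then obtain p where p: "pol p" "\<forall>a\<in>A. f (right_mult (z t) a) = p a"
        using step.hyps(3) unfolding S.reg_def by blast
      have "pull t f (tuple_act z a) = p a" if "a \<in> A" for a
        using p(2) that T.act_D[OF z that] by (simp add: pull_def) (simp add: tuple_act_def)
      then show "\<exists>p\<in>{p. pol p}. \<forall>a\<in>A. pull t f (tuple_act z a) = p a" using p(1) by blast
    qed
    fix a assume a: "a \<in> A"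
    from V(2)[OF step.hyps(4)[OF a]]
    show "(\<lambda>x. T.R a (pull t f) x - \<tau> a * pull t f x) \<in> V"
      by (rule T.mem_cong) (simp add: pull_R[OF a], simp add: pull_def)
  qed
  moreover have "pull t g \<in> T.extend V (pull t f)" if g: "g \<in> S.extend W f" for g
  proof -
    obtain w c where w: "g = (\<lambda>x. w x + c * f x)" "w \<in> W" using g unfolding S.extend_def by blast
    have "pull t g = (\<lambda>z. pull t w z + c * pull t f z)" by (auto simp: w(1) pull_def)
    then show ?thesis unfolding T.extend_def using V(2)[OF w(2)] by blast
  qed
  ultimately show ?case by blast
qed

text \<open>The assumption \<open>bdd\<close> is all that is kept of the compactness of \<open>G/H\<close>: a quotient \<open>p/\<tau>\<close>
  that is right invariant under \<open>H0\<close> is bounded on \<open>G0\<close>. The assumptions on \<open>S\<close> are those of the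
  identity component of \<open>B\<close>.\<close>
theorem vanishing_on_split_part:
  assumes H0: "H0 \<subseteq> G0" "id \<in> H0" "\<And>a b. a \<in> H0 \<Longrightarrow> b \<in> H0 \<Longrightarrow> a \<circ> b \<in> H0"
    and bdd: "\<And>p \<tau>. pol p \<Longrightarrow> \<tau> \<in> Ch \<Longrightarrow>
      (\<And>g h. g \<in> G0 \<Longrightarrow> h \<in> H0 \<Longrightarrow> p (g \<circ> h) * \<tau> g = p g * \<tau> (g \<circ> h)) \<Longrightarrow>
      \<exists>C. \<forall>g\<in>G0. norm (p g) \<le> C * norm (\<tau> g)"
    and S: "S \<subseteq> B" "id \<in> S" "connectedin (zariski sc) S"
    and p: "pol p" "\<And>h. h \<in> H0 \<Longrightarrow> p h = 0" and s: "s \<in> S"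
  shows "p s = 0"
proof -
  have BA: "B \<subseteq> A" by (auto simp: B_def)
  have sA: "s \<in> A" using s S BA by blast
  have sM: "s \<in> M" using A_M[OF sA] .
  let ?p = "\<lambda>x. if x \<in> M then p x else 0"
  obtain W where W: "S.flag W" "?p \<in> W" using polynomial_in_flag[OF p(1)] unfolding S.in_flag_def by blast
  define U where "U = {q \<in> W. \<forall>h\<in>H0. q h = 0}"
  have subU: "S.sub U" using S.flag_sub[OF W(1)] unfolding U_def S.sub_def by auto
  have UW: "U \<subseteq> W" by (auto simp: U_def)
  have H0A: "H0 \<subseteq> A" using H0(1) G0_A by blast
  have RU: "S.R h q \<in> U" if h: "h \<in> H0" and q: "q \<in> U" for h q
  proof -
    have "S.R h q k = 0" if k: "k \<in> H0" for k
      using H0(3)[OF k h] q by (simp add: S.R_def right_mult_def U_def)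
    then show ?thesis using S.flag_invariant[OF W(1)] q h H0A by (auto simp: U_def)
  qed
  have pU: "?p \<in> U" using W(2) p(2) by (auto simp: U_def)
  obtain k u x where *: "(\<forall>i<k::nat. u i \<in> U \<and> x i \<in> M) \<and>
      (\<forall>i<k. \<forall>j<k. u i (x j) = (if i = j then 1 else 0)) \<and>
      (\<forall>w\<in>U. \<forall>z. w z = (\<Sum>i<k. w (x i) * u i z))"
    using S.dual_points[OF W(1) subU UW] by (elim exE)
  have ux: "\<And>i. i < k \<Longrightarrow> u i \<in> U" "\<And>i. i < k \<Longrightarrow> x i \<in> M"
    and dual: "\<And>i j. i < k \<Longrightarrow> j < k \<Longrightarrow> u i (x j) = (if i = j then 1 else 0)"
    and repr: "\<And>w z. w \<in> U \<Longrightarrow> w z = (\<Sum>i<k. w (x i) * u i z)"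
    using * by blast+
  define D where "D z = mat k k (\<lambda>(i, j). u i (z j))" for z :: "nat \<Rightarrow> 'w \<Rightarrow> 'w"
  define F where "F z = (if z \<in> tuples then Determinant.det (D z) else 0)" for z
  have D: "D z \<in> carrier_mat k k" for z by (simp add: D_def)
  have det_D: "Determinant.det (D z) =
      (\<Sum>\<pi>\<in>{\<pi>. \<pi> permutes {0..<k}}. signof \<pi> * (\<Prod>i\<in>{0..<k}. u i (z (\<pi> i))))" for z
    unfolding det_def'[OF D]
    by (intro sum.cong prod.cong arg_cong2[where f = "(*)"] refl)
      (auto simp: D_def permutes_in_image[of _ "{0..<k}"] dest: permutes_in_image[THEN iffD2] )
  have tfF: "T.in_flag F"
  proof -
    have "T.in_flag (\<lambda>z. \<Sum>\<pi>\<in>{\<pi>. \<pi> permutes {0..<k}}.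
        signof \<pi> * (if z \<in> tuples then \<Prod>i\<in>{0..<k}. pull (\<pi> i) (u i) z else 0))"
    proof (intro T.in_flag_sum T.in_flag_prod)
      fix \<pi> i assume "\<pi> \<in> {\<pi>. \<pi> permutes {0..<k}}" "i \<in> {0..<k}"
      then have "u i \<in> W" using ux(1) UW by auto
      then show "T.in_flag (pull (\<pi> i) (u i))" using pull_flag[OF W(1), of "\<pi> i"] unfolding T.in_flag_def by blast
    qed (simp_all add: finite_permutations)
    also have "(\<lambda>z. \<Sum>\<pi>\<in>{\<pi>. \<pi> permutes {0..<k}}.
        signof \<pi> * (if z \<in> tuples then \<Prod>i\<in>{0..<k}. pull (\<pi> i) (u i) z else 0)) = F"
      by (auto simp: F_def det_D pull_def fun_eq_iff intro!: sum.cong)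
    finally show ?thesis .
  qed
  \<comment> \<open>The entries from \<open>k\<close> on do not enter the determinant; any value in the group does.\<close>
  define x0 where "x0 j = (if j < k then x j else id)" for j
  have idM: "id \<in> M" using A_M[OF S.id_A] .
  have x0: "x0 \<in> tuples" using ux(2) idM by (simp add: tuples_def x0_def)
  have "D x0 = 1\<^sub>m k" by (rule eq_matI) (auto simp: D_def x0_def dual)
  then have F1: "F x0 = 1" using x0 by (simp add: F_def)
  \<comment> \<open>The \<open>u\<^sub>i\<close> being dual to the \<open>x\<^sub>j\<close>, this is the determinant of \<open>R h\<close> on \<open>U\<close>.\<close>
  define cc where "cc h = Determinant.det (mat k k (\<lambda>(i, j). S.R h (u i) (x j)))" for h
  have FH: "T.R h F = (\<lambda>z. cc h * F z)" if h: "h \<in> H0" for h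
  proof
    fix z
    show "T.R h F z = cc h * F z"
    proof (cases "z \<in> tuples")
      case False then show ?thesis by (simp add: T.R_def F_def)
    next
      case True
      have hA: "h \<in> A" using h H0A by blast
      have "D (tuple_act z h) = mat k k (\<lambda>(i, j). S.R h (u i) (x j)) * D z"
      proof (rule eq_matI)
        fix i j assume "i < dim_row (mat k k (\<lambda>(i, j). S.R h (u i) (x j)) * D z)"
          "j < dim_col (mat k k (\<lambda>(i, j). S.R h (u i) (x j)) * D z)"
        then have ij: "i < k" "j < k" by (auto simp: D_def)
        have "z j \<in> M" using True by (simp add: tuples_def)
        then have "D (tuple_act z h) $$ (i, j) = S.R h (u i) (z j)"
          using ij by (simp add: D_def S.R_def tuple_act_def)
        also have "\<dots> = (\<Sum>m<k. S.R h (u i) (x m) * u m (z j))"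
          by (rule repr[OF RU[OF h ux(1)[OF ij(1)]]])
        also have "\<dots> = (mat k k (\<lambda>(i, j). S.R h (u i) (x j)) * D z) $$ (i, j)"
          using ij by (simp add: D_def scalar_prod_def atLeast0LessThan)
        finally show "D (tuple_act z h) $$ (i, j) = (mat k k (\<lambda>(i, j). S.R h (u i) (x j)) * D z) $$ (i, j)" .
      qed (simp_all add: D_def)
      then have "Determinant.det (D (tuple_act z h)) = cc h * Determinant.det (D z)"
        unfolding cc_def using det_mult[OF _ D[of z], of "mat k k (\<lambda>(i, j). S.R h (u i) (x j))"] by simp
      then show ?thesis using True T.act_D[OF True hA] by (simp add: T.R_def F_def)
    qed
  qed
  obtain Z where Z: "T.flag Z" "F \<in> Z" using tfF unfolding T.in_flag_def by blast
  have "F \<noteq> (\<lambda>_. 0)" using F1 by auto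
  from T.leading_character[OF Z this] obtain V \<tau> where V: "T.flag V" "F \<notin> V" "\<tau> \<in> Ch"
    "\<And>a. a \<in> A \<Longrightarrow> (\<lambda>z. T.R a F z - \<tau> a * F z) \<in> V" by blast
  \<comment> \<open>Otherwise \<open>F\<close> would be a multiple of \<open>R h F - \<tau>(h) F\<close>, which is in \<open>V\<close>.\<close>
  have cc: "cc h = \<tau> h" if h: "h \<in> H0" for h
  proof (rule ccontr)
    assume ne: "cc h \<noteq> \<tau> h"
    have "(\<lambda>z. T.R h F z - \<tau> h * F z) \<in> V" using V(4) h H0A by blast
    from T.sub_scale[OF T.flag_sub[OF V(1)] this, of "inverse (cc h - \<tau> h)"]
    have "F \<in> V" by (rule T.mem_cong) (use ne in \<open>simp add: FH[OF h] field_simps\<close>)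
    then show False using V(2) by blast
  qed
  have bdF: "T.dominated \<tau> F" unfolding T.dominated_def
  proof
    fix z assume z: "z \<in> tuples"
    obtain q where q: "pol q" "\<And>a. a \<in> A \<Longrightarrow> F (tuple_act z a) = q a"
      using T.flag_reg[OF Z] z unfolding T.reg_def by blast
    have "q (g \<circ> h) * \<tau> g = q g * \<tau> (g \<circ> h)" if g: "g \<in> G0" and h: "h \<in> H0" for g h
    proof -
      have gA: "g \<in> A" and hA: "h \<in> A" using g h G0_A H0A by auto
      have zg: "tuple_act z g \<in> tuples" by (rule T.act_D[OF z gA])
      have "q (g \<circ> h) = F (tuple_act (tuple_act z g) h)"
        using q(2)[OF A_comp[OF gA hA]] T.act_act[OF z gA hA] by simp
      also have "\<dots> = T.R h F (tuple_act z g)" using zg by (simp add: T.R_def)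
      also have "\<dots> = \<tau> h * q g" by (simp add: FH[OF h] cc[OF h] q(2)[OF gA])
      finally show ?thesis using T.Ch_mult[OF V(3) gA hA] by simp
    qed
    from bdd[OF q(1) V(3) this] obtain C where "\<forall>g\<in>G0. norm (q g) \<le> C * norm (\<tau> g)" by blast
    then show "\<exists>C. \<forall>g\<in>G0. norm (F (tuple_act z g)) \<le> C * norm (\<tau> g)"
      using q(2) G0_A by (intro exI[of _ C]) auto
  qed
  have SA: "S \<subseteq> A" using S(1) BA by blast
  have RF: "T.R s F = (\<lambda>z. \<tau> s * F z)"
  proof (rule T.bounded_semi_invariant[OF V(3) tfF bdF SA _ _ s])
    show "\<sigma> t = \<tau> t" if "\<sigma> \<in> Ch" "\<And>g. g \<in> G0 \<Longrightarrow> norm (\<sigma> g) = norm (\<tau> g)" "t \<in> S" for \<sigma> t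
      using equal_modulus_rigid[OF that(1) V(3) that(2) S that(3)] by simp
    show "q a = 0" if "q \<in> {p. pol p}" "\<And>g. g \<in> G0 \<Longrightarrow> q g = 0" "a \<in> A" for q a
      using A_zero[OF that(3) _ that(2)] that(1) by simp
  qed
  obtain t where t: "t \<in> M" "t \<circ> s = id" using inverse_GL[OF sM] by blast
  \<comment> \<open>Put 1 in place \<open>i\<close> and \<open>x\<^sub>j s\<^sup>-\<^sup>1\<close> in the others. There \<open>F\<close> vanishes, and translation by
    \<open>s\<close> leads to the tuple \<open>x\<close> with \<open>s\<close> in place \<open>i\<close>, where duality gives \<open>F\<close> the value
    \<open>u\<^sub>i(s)\<close>.\<close>
  have us: "u i s = 0" if i: "i < k" for i
  proof -
    define z where "z = (\<lambda>j. if j = i then id else right_mult (x0 j) t)"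
    have z: "z \<in> tuples"
      using x0 idM M_comp[OF _ t(1)] by (auto simp: tuples_def z_def right_mult_def)
    have uid: "u m id = 0" if "m < k" for m using ux(1)[OF that] H0(2) by (simp add: U_def)
    have "Determinant.det (D z) = 0" unfolding det_D
    proof (rule sum.neutral, rule ballI)
      fix \<pi> assume "\<pi> \<in> {\<pi>. \<pi> permutes {0..<k}}"
      then have \<pi>: "\<pi> permutes {0..<k}" by simp
      then have "i \<in> \<pi> ` {0..<k}" using i by (simp add: permutes_image)
      then obtain m where m: "m < k" "i = \<pi> m" by auto
      then have "u m (z (\<pi> m)) = 0" by (simp add: z_def uid)
      then have "(\<Prod>i\<in>{0..<k}. u i (z (\<pi> i))) = 0" using m(1) by (intro prod_zero) auto
      then show "signof \<pi> * (\<Prod>i\<in>{0..<k}. u i (z (\<pi> i))) = 0" by simp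
    qed
    then have "F z = 0" using z by (simp add: F_def)
    then have "F (tuple_act z s) = 0" using fun_cong[OF RF, of z] z by (simp add: T.R_def)
    then have det0: "Determinant.det (D (tuple_act z s)) = 0"
      using T.act_D[OF z sA] by (simp add: F_def)
    have zs: "tuple_act z s j = (if j = i then s else x0 j)" for j
      using t(2) by (auto simp: tuple_act_def z_def right_mult_def o_assoc[symmetric])
    have "Determinant.det (D (tuple_act z s)) =
        (\<Sum>\<pi>\<in>{\<pi>. \<pi> permutes {0..<k}}. if \<pi> = id then u i s else 0)" unfolding det_D
    proof (rule sum.cong[OF refl])
      fix \<pi> assume "\<pi> \<in> {\<pi>. \<pi> permutes {0..<k}}"
      then have \<pi>: "\<pi> permutes {0..<k}" by simp
      show "signof \<pi> * (\<Prod>m\<in>{0..<k}. u m (tuple_act z s (\<pi> m))) = (if \<pi> = id then u i s else 0)"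
      proof (cases "\<pi> = id")
        case True
        have "(\<Prod>m\<in>{0..<k}. u m (tuple_act z s (\<pi> m))) = (\<Prod>m\<in>{0..<k}. if m = i then u i s else 1)"
          by (rule prod.cong) (auto simp: True zs x0_def dual)
        then show ?thesis using i True by simp
      next
        case False
        then obtain m where m: "\<pi> m \<noteq> m" by (auto simp: fun_eq_iff)
        then have "m \<in> {0..<k}" using permutes_not_in[OF \<pi>, of m] by blast
        then have mk: "m < k" "\<pi> m < k" using permutes_in_image[OF \<pi>, of m] by simp_all
        have "\<exists>m<k. \<pi> m \<noteq> m \<and> \<pi> m \<noteq> i"
        proof (cases "\<pi> m = i")
          case False then show ?thesis using m mk by blast
        next
          case True
          have "\<pi> i \<noteq> i" using True m permutes_inj[OF \<pi>] by (metis injD)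
          then show ?thesis using i by blast
        qed
        then obtain m' where m': "m' < k" "\<pi> m' \<noteq> m'" "\<pi> m' \<noteq> i" by blast
        have "\<pi> m' < k" using permutes_in_image[OF \<pi>, of m'] m' by simp
        then have "u m' (tuple_act z s (\<pi> m')) = 0" using m' by (simp add: zs x0_def dual)
        then have "(\<Prod>m\<in>{0..<k}. u m (tuple_act z s (\<pi> m))) = 0" using m'(1) by (intro prod_zero) auto
        then show ?thesis using False by simp
      qed
    qed
    also have "\<dots> = u i s"
      by (simp add: finite_permutations permutes_id)
    finally show ?thesis using det0 by simp
  qed
  have "?p s = (\<Sum>i<k. ?p (x i) * u i s)" by (rule repr[OF pU])
  then show ?thesis using us sM by simp
qed

section \<open>The identity component of the subgroup \<open>B\<close>\<close>

text \<open>The identity component of \<open>B\<close> in the Zariski topology.\<close>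
definition B0 :: "('w \<Rightarrow> 'w) set" where
  "B0 = \<Union>{T. connectedin (zariski sc) T \<and> T \<subseteq> B \<and> id \<in> T}"

lemma B_comp: assumes "a \<in> B" "b \<in> B" shows "a \<circ> b \<in> B"
proof -
  have ab: "a \<in> A" "b \<in> A" and eq: "\<And>j. j < n \<Longrightarrow> b2.diag j a = b1.diag j a"
    "\<And>j. j < n \<Longrightarrow> b2.diag j b = b1.diag j b" using assms by (auto simp: B_def)
  have "lin a" using A_M[OF ab(1)] by (simp add: carrier_GL_iff)
  then show ?thesis unfolding B_def
    using A_comp[OF ab] b1.diag_mult[OF A_upper(1)[OF ab(1)] _ A_upper(1)[OF ab(2)]]
      b2.diag_mult[OF A_upper(2)[OF ab(1)] _ A_upper(2)[OF ab(2)]] eq by simp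
qed

lemma id_B: "id \<in> B"
  using S.id_A by (auto simp: B_def b1.diag_def b2.diag_def b1.l_dual b2.l_dual)

lemma B_inverse: assumes "a \<in> B" shows "inv_into UNIV a \<in> B"
proof -
  let ?b = "inv_into UNIV a"
  have a: "a \<in> A" and eq: "\<And>j. j < n \<Longrightarrow> b2.diag j a = b1.diag j a" using assms by (auto simp: B_def)
  have aG: "a \<in> carrier (GL sc)" by (rule A_M[OF a])
  have b: "?b \<in> A" by (rule A_inverse[OF a]) (use inverse_GL[OF aG] in simp_all)
  have la: "lin a" using A_M[OF a] by (simp add: carrier_GL_iff)
  have "b2.diag j ?b = b1.diag j ?b" if j: "j < n" for j
  proof -
    have "b1.diag j a * b1.diag j ?b = 1" "b2.diag j a * b2.diag j ?b = 1"
      using b1.diag_mult[OF A_upper(1)[OF a] la A_upper(1)[OF b] j]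
        b2.diag_mult[OF A_upper(2)[OF a] la A_upper(2)[OF b] j] inverse_GL(3)[OF aG] j
      by (simp_all add: b1.diag_def[of j id] b2.diag_def[of j id] b1.l_dual b2.l_dual)
    then have "b1.diag j a * b2.diag j ?b = b1.diag j a * b1.diag j ?b" "b1.diag j a \<noteq> 0"
      using eq[OF j] by auto
    then show ?thesis by simp
  qed
  then show ?thesis using b by (simp add: B_def)
qed

lemma B0_connected: "connectedin (zariski sc) B0"
  unfolding B0_def
proof (rule connectedin_Union)
  show "\<Inter>{T. connectedin (zariski sc) T \<and> T \<subseteq> B \<and> id \<in> T} \<noteq> {}" by blast
qed blast

lemma B0_sub: "B0 \<subseteq> B" by (auto simp: B0_def)

lemma B_GL: "B \<subseteq> carrier (GL sc)" using A_M by (auto simp: B_def)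

lemma id_B0: "id \<in> B0"
proof -
  have "connectedin (zariski sc) {id}" using id_B B_GL by (auto simp: connectedin_sing topspace_zariski)
  then show ?thesis unfolding B0_def using id_B by blast
qed

lemma B0_max: "connectedin (zariski sc) T \<Longrightarrow> T \<subseteq> B \<Longrightarrow> id \<in> T \<Longrightarrow> T \<subseteq> B0"
  unfolding B0_def by blast

lemma A_closure: "A = zariski sc closure_of G0"
proof -
  have sub: "G0 \<subseteq> carrier (GL sc)" using G0_GL by (auto simp: carrier_GL_iff)
  from zariski_closure_of[OF sub] show ?thesis unfolding A_def by (rule sym)
qed

lemma B_closed: "closedin (zariski sc) B"
proof -
  define K where "K j = {a \<in> carrier (GL sc). b2.diag j a - b1.diag j a = 0}" for j
  have K: "closedin (zariski sc) (K j)" if "j < n" for j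
    unfolding K_def
    by (rule closedin_zariski_zero_set[OF polynomial_fun_diff[OF b2.polynomial_diag[OF that] b1.polynomial_diag[OF that]]])
  have A: "closedin (zariski sc) A" unfolding A_closure by simp
  have "B = \<Inter>(insert A (K ` {..<n}))"
  proof (rule Set.set_eqI)
    fix a
    have "a \<in> carrier (GL sc)" if "a \<in> A" by (rule A_M[OF that])
    then show "a \<in> B \<longleftrightarrow> a \<in> \<Inter>(insert A (K ` {..<n}))"
      by (cases "a \<in> A") (auto simp: B_def K_def)
  qed
  moreover have "closedin (zariski sc) (\<Inter>(insert A (K ` {..<n})))"
  proof (rule closedin_Inter)
    show "closedin (zariski sc) T" if "T \<in> insert A (K ` {..<n})" for T using that A K by blast
  qed simp
  ultimately show ?thesis by simp
qed

lemma B0_closed: "closedin (zariski sc) B0"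
proof -
  have sub: "B0 \<subseteq> topspace (zariski sc)" using B0_sub B_GL by (auto simp: topspace_zariski)
  have "zariski sc closure_of B0 \<subseteq> B0"
    using connectedin_closure_of[OF B0_connected] closure_of_minimal[OF B0_sub B_closed]
      closure_of_subset[OF sub] id_B0 by (intro B0_max) auto
  then show ?thesis using closure_of_subset[OF sub] closure_of_eq by (metis subset_antisym)
qed

text \<open>A left translate of \<open>B0\<close> that contains the identity is connected and lies in \<open>B\<close>, hence in
  \<open>B0\<close>.\<close>
lemma B0_left_div: assumes "x \<in> B0" "y \<in> B0" shows "inv_into UNIV x \<circ> y \<in> B0"
proof -
  have xB: "x \<in> B" using assms B0_sub by blast
  have xG: "x \<in> carrier (GL sc)" using xB B_GL by blast
  let ?f = "\<lambda>y. inv_into UNIV x \<circ> y"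
  have "connectedin (zariski sc) (?f ` B0)"
    by (rule connectedin_continuous_map_image[OF continuous_translation[OF inverse_GL(1)[OF xG]] B0_connected])
  moreover have "?f ` B0 \<subseteq> B" using B_comp[OF B_inverse[OF xB]] B0_sub by blast
  moreover have "id \<in> ?f ` B0" using inverse_GL(2)[OF xG] assms(1) by (metis imageI)
  ultimately show ?thesis using B0_max assms(2) by blast
qed

lemma B0_subgroup: "subgroup B0 (GL sc)"
proof
  show sub: "B0 \<subseteq> carrier (GL sc)" using B0_sub B_GL by blast
  show "\<one>\<^bsub>GL sc\<^esub> \<in> B0" using id_B0 by (simp add: GL_def)
  have inv: "inv_into UNIV x \<in> B0" if "x \<in> B0" for x
    using B0_left_div[OF that id_B0] by simp
  show "inv\<^bsub>GL sc\<^esub> x \<in> B0" if "x \<in> B0" for x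
    using inv[OF that] inv_GL[of x] that sub by auto
  show "x \<otimes>\<^bsub>GL sc\<^esub> y \<in> B0" if "x \<in> B0" "y \<in> B0" for x y
  proof -
    have "bij x" using that(1) sub by (auto simp: carrier_GL_iff)
    then show ?thesis using B0_left_div[OF inv[OF that(1)] that(2)]
      by (simp add: inv_inv_eq GL_def)
  qed
qed

end

section \<open>The maximal split subgroup of a complexified real group\<close>

lemma continuous_map_euclidean_iff:
  "continuous_map X euclidean f \<longleftrightarrow> (\<forall>x\<in>topspace X. (f \<longlongrightarrow> f x) (atin X x))"
  by (simp add: continuous_map_atin)

locale fin_dim_real =
  fixes Bs :: "'v::real_vector set"
  assumes finite_Bs: "finite Bs" and span_Bs: "span Bs = UNIV"
begin

abbreviation "cspan \<equiv> module.span (cscale :: complex \<Rightarrow> 'v \<times> 'v \<Rightarrow> 'v \<times> 'v)"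

lemma complex_span_subspace: "module.subspace cscale (span Q \<times> span (Q :: 'v set))"
proof -
  interpret V: vector_space "cscale :: complex \<Rightarrow> 'v \<times> 'v \<Rightarrow> 'v \<times> 'v" by (rule vector_space_cscale)
  show ?thesis
    by (rule V.subspaceI)
      (auto simp: cscale_def zero_prod_def intro: real_vector.span_zero real_vector.span_add
        real_vector.span_diff real_vector.span_scale)
qed

lemma complex_span_real: "cspan ((\<lambda>b. (b, 0)) ` Q) = span Q \<times> span Q"
proof -
  interpret V: vector_space "cscale :: complex \<Rightarrow> 'v \<times> 'v \<Rightarrow> 'v \<times> 'v" by (rule vector_space_cscale)
  have "cspan ((\<lambda>b. (b, 0)) ` Q) \<subseteq> span Q \<times> span Q"
    by (rule V.span_minimal[OF _ complex_span_subspace])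
      (auto intro: real_vector.span_base real_vector.span_zero)
  moreover have re: "(v, 0) \<in> cspan ((\<lambda>b. (b, 0)) ` Q)" if "v \<in> real_vector.span Q" for v
    using that
  proof (induction rule: real_vector.span_induct_alt)
    case base show ?case using V.span_zero by (simp add: zero_prod_def)
  next
    case (step c x y)
    have "cscale (complex_of_real c) (x, 0) + (y, 0) \<in> cspan ((\<lambda>b. (b, 0)) ` Q)"
      by (intro V.span_add V.span_scale V.span_base step imageI)
    moreover have "cscale (complex_of_real c) (x, 0) + (y, 0) = (c *\<^sub>R x + y, 0)" by (simp add: cscale_def)
    ultimately show ?case by (simp only:)
  qed
  moreover have "(v, w) \<in> cspan ((\<lambda>b. (b, 0)) ` Q)" if "v \<in> real_vector.span Q" "w \<in> real_vector.span Q" for v w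
  proof -
    have "(v, 0) + cscale \<i> (w, 0) \<in> cspan ((\<lambda>b. (b, 0)) ` Q)"
      by (intro V.span_add V.span_scale re that)
    moreover have "(v, 0) + cscale \<i> (w, 0) = (v, w)" by (simp add: cscale_def)
    ultimately show ?thesis by (simp only:)
  qed
  ultimately show ?thesis by blast
qed

sublocale C: complex_fin_dim "cscale :: complex \<Rightarrow> 'v \<times> 'v \<Rightarrow> 'v \<times> 'v"
proof (intro complex_fin_dim.intro complex_fin_dim_axioms.intro vector_space_cscale)
  show "\<exists>B. finite B \<and> cspan B = UNIV"
    using complex_span_real[of Bs] finite_Bs span_Bs by (intro exI[of _ "(\<lambda>b. (b, 0)) ` Bs"]) simp
qed

end

definition conj_vec :: "'v \<times> 'v \<Rightarrow> 'v \<times> 'v::real_vector" where "conj_vec = (\<lambda>(v, w). (v, - w))"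

lemma conj_vec_simps [simp]: "conj_vec (conj_vec x) = x" "conj_vec (x + y) = conj_vec x + conj_vec y"
  "conj_vec (cscale c x) = cscale (cnj c) (conj_vec x)" "conj_vec 0 = 0" "conj_vec (x - y) = conj_vec x - conj_vec y"
  "conj_vec (v, w) = (v, - w)"
  by (auto simp: conj_vec_def cscale_def zero_prod_def split: prod.splits)

lemma conj_vec_sum: "conj_vec (sum f I) = (\<Sum>i\<in>I. conj_vec (f i))"
  by (induction I rule: infinite_finite_induct) simp_all

lemma conj_vec_complexify:
  assumes "linear f" shows "conj_vec (complexify f x) = complexify f (conj_vec x)"
  by (cases x) (simp add: complexify_def linear_neg[OF assms])

lemma complexify_comp: "complexify (f \<circ> g) = complexify f \<circ> complexify g"
  by (auto simp: complexify_def fun_eq_iff)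

lemma complexify_id: "complexify id = id"
  by (simp add: complexify_def prod.map_id0)

lemma GL_real_iff: "f \<in> carrier (GL (*\<^sub>R)) \<longleftrightarrow> linear f \<and> bij f"
  by (simp add: GL_def linear_def)

text \<open>A group of real operators whose complexification is triangular in some complex basis.
  Complex conjugation commutes with the complexified operators, so the conjugate basis is
  triangular as well.\<close>
locale real_triangular = fin_dim_real Bs + b: dual_basis "cscale :: complex \<Rightarrow> 'v \<times> 'v \<Rightarrow> 'v \<times> 'v" e l n
  for Bs :: "'v::real_vector set" and e l n +
  fixes R :: "('v \<Rightarrow> 'v) set"
  assumes R_GL: "R \<subseteq> carrier (GL (*\<^sub>R))" and id_R: "id \<in> R"
    and comp_R: "a \<in> R \<Longrightarrow> b \<in> R \<Longrightarrow> a \<circ> b \<in> R"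
    and inv_R: "a \<in> R \<Longrightarrow> \<exists>b\<in>R. a \<circ> b = id \<and> b \<circ> a = id"
    and upper_R: "a \<in> R \<Longrightarrow> b.upper (complexify a)"
begin

abbreviation e' where "e' \<equiv> \<lambda>j. conj_vec (e j)"
abbreviation l' where "l' \<equiv> \<lambda>i v. cnj (l i (conj_vec v))"

sublocale b': dual_basis cscale e' l' n
proof (intro dual_basis.intro dual_basis_axioms.intro C.complex_fin_dim_axioms)
  show "C.linf (l' i)" if "i < n" for i
    using C.linf_simps(1,3)[OF b.l_lin[OF that]]
    by (simp add: Vector_Spaces.linear_iff vector_space_cscale C.vector_space_mult del: split_paired_All)
  show "l' i (e' j) = (if i = j then 1 else 0)" if "i < n" "j < n" for i j
    using b.l_dual[OF that] by simp
  fix v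
  have "conj_vec v = (\<Sum>i<n. cscale (l i (conj_vec v)) (e i))" by (rule b.expand)
  then have "conj_vec (conj_vec v) = conj_vec (\<Sum>i<n. cscale (l i (conj_vec v)) (e i))" by (rule arg_cong)
  then show "v = (\<Sum>i<n. cscale (l' i v) (e' i))" by (simp add: conj_vec_sum)
qed

sublocale CT: conjugate_triangular cscale e l e' l' n "complexify ` R"
proof (intro conjugate_triangular.intro conjugate_triangular_axioms.intro C.complex_fin_dim_axioms
    b.dual_basis_axioms b'.dual_basis_axioms)
  have conj: "conj_vec (g (e' j)) = g (e j)" if g: "g \<in> complexify ` R" for g j
  proof -
    obtain f where f: "f \<in> R" "g = complexify f" using g by blast
    have "linear f" using f(1) R_GL GL_real_iff by blast
    then show ?thesis by (simp add: f(2) conj_vec_complexify)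
  qed
  show "C.lin g \<and> bij g" if g: "g \<in> complexify ` R" for g
  proof -
    obtain f where f: "f \<in> R" "g = complexify f" using g by blast
    show ?thesis using complexify_GL[OF subsetD[OF R_GL f(1)]] unfolding f(2) by (simp add: GL_def)
  qed
  show "id \<in> complexify ` R" using imageI[OF id_R, of complexify] by (simp add: complexify_id)
  show "a \<circ> c \<in> complexify ` R" if "a \<in> complexify ` R" "c \<in> complexify ` R" for a c
    using that comp_R by (auto simp: complexify_comp[symmetric])
  show "\<exists>c\<in>complexify ` R. a \<circ> c = id \<and> c \<circ> a = id" if a: "a \<in> complexify ` R" for a
  proof -
    obtain f where f: "f \<in> R" "a = complexify f" using a by blast
    obtain h where h: "h \<in> R" "f \<circ> h = id" "h \<circ> f = id" using inv_R[OF f(1)] by blast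
    show ?thesis using h f(2)
      by (intro bexI[of _ "complexify h"]) (simp_all add: complexify_comp[symmetric] complexify_id)
  qed
  show up: "b.upper g" if "g \<in> complexify ` R" for g using that upper_R by auto
  show "b'.upper g" if "g \<in> complexify ` R" for g
    using up[OF that] conj[OF that] by (simp add: b.upper_def b'.upper_def)
  show "b'.diag j g = cnj (b.diag j g)" if "g \<in> complexify ` R" for g j
    using conj[OF that] by (simp add: b.diag_def b'.diag_def)
qed

lemma conj_E: assumes "j \<le> n" shows "conj_vec v \<in> b'.E j \<longleftrightarrow> v \<in> b.E j"
  unfolding b'.mem_E[OF assms] b.mem_E[OF assms] by simp

text \<open>Let \<open>F i\<close> be the steps of an invariant real flag, and \<open>i\<close> minimal such that
  \<open>F i \<inter> E (Suc j)\<close> is not in \<open>E j\<close>. A vector \<open>v\<close> in this difference is an eigenvector modulo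
  \<open>E j\<close> both with eigenvalue \<open>diag j s\<close> and with the eigenvalue \<open>t\<close> of \<open>s\<close> on \<open>F i\<close> modulo the
  previous step. As \<open>F i\<close> is real, the conjugate of \<open>v\<close> shows in the same way that \<open>t\<close> is the
  diagonal entry in the conjugate basis.\<close>
lemma trigonalizable_sub_B:
  assumes S: "S \<subseteq> CT.A" and trig: "trigonalizable_over_reals S"
  shows "S \<subseteq> CT.B"
proof
  fix s assume s: "s \<in> S"
  have sA: "s \<in> CT.A" using s S by blast
  have lin: "C.lin s" using CT.A_M[OF sA] by (simp add: C.carrier_GL_iff)
  obtain bs :: "'v list" where bs: "span (set bs) = UNIV"
    and up: "\<And>j. j < length bs \<Longrightarrow> s (bs ! j, 0) \<in> cspan ((\<lambda>b. (b, 0)) ` set (take (Suc j) bs))"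
    using trig s unfolding trigonalizable_over_reals_def by blast
  define F where "F i = cspan ((\<lambda>b. (b, 0)) ` set (take i bs))" for i
  have subF: "C.subspace (F i)" for i unfolding F_def by (rule C.subspace_span)
  have F_conj: "conj_vec v \<in> F i" if "v \<in> F i" for v i
    using that unfolding F_def complex_span_real by (auto simp: real_vector.span_neg)
  have F_mono: "F i \<subseteq> F k" if "i \<le> k" for i k
    unfolding F_def by (intro C.span_mono image_mono set_take_subset_set_take that)
  have F_Suc: "x \<in> F (Suc i) \<longleftrightarrow> (\<exists>k. x - cscale k (bs ! i, 0) \<in> F i)" if "i < length bs" for i x
  proof -
    have "F (Suc i) = C.span (insert (bs ! i, 0) ((\<lambda>b. (b, 0)) ` set (take i bs)))"
      using that by (simp add: F_def take_Suc_conv_app_nth)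
    then show ?thesis by (simp only: C.span_breakdown_eq F_def)
  qed
  have sF: "s v \<in> F i" if i: "i \<le> length bs" and v: "v \<in> F i" for v i
    using v unfolding F_def[of i]
  proof (induction rule: C.span_induct_alt)
    case base then show ?case by (simp add: C.lin_simps[OF lin] C.span_zero)
  next
    case (step c x y)
    then obtain m where m: "m < i" "m < length bs" "x = (bs ! m, 0)" by (auto simp: in_set_conv_nth)
    then have "s x \<in> F (Suc m)" using up by (simp add: F_def)
    then have "s x \<in> F i" using F_mono[of "Suc m" i] m by auto
    then show ?case using step.IH
      by (simp add: C.lin_simps[OF lin] C.span_add C.span_scale F_def)
  qed
  have "b'.diag j s = b.diag j s" if j: "j < n" for j
  proof -
    have jn: "Suc j \<le> n" "j \<le> n" using j by auto
    have ej: "e j \<in> b.E (Suc j)" "e j \<notin> b.E j"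
      using b.l_dual[OF j] b.l_dual[OF _ j] j by (auto simp: b.mem_E[OF jn(1)] b.mem_E[OF jn(2)])
    have "F (length bs) = UNIV" unfolding F_def complex_span_real by (simp add: bs)
    then have ex: "\<not> F (length bs) \<inter> b.E (Suc j) \<subseteq> b.E j" using ej by blast
    define i where "i = (LEAST i. \<not> F i \<inter> b.E (Suc j) \<subseteq> b.E j)"
    have i: "\<not> F i \<inter> b.E (Suc j) \<subseteq> b.E j" unfolding i_def using ex by (rule LeastI)
    have imin: "F k \<inter> b.E (Suc j) \<subseteq> b.E j" if "k < i" for k
      using not_less_Least[of k "\<lambda>i. \<not> F i \<inter> b.E (Suc j) \<subseteq> b.E j"] that unfolding i_def by blast
    have il: "i \<le> length bs" unfolding i_def using ex by (rule Least_le)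
    have "i \<noteq> 0"
    proof
      assume "i = 0"
      then have "F i = {0}" by (simp add: F_def)
      then show False using i C.subspace_0[OF b.subspace_E] by auto
    qed
    then obtain m where m: "i = Suc m" by (cases i) auto
    have ml: "m < length bs" "m < i" using il m by auto
    obtain v where v: "v \<in> F i" "v \<in> b.E (Suc j)" "v \<notin> b.E j" using i by blast
    let ?\<beta> = "(bs ! m, 0) :: 'v \<times> 'v"
    have "s ?\<beta> \<in> F (Suc m)" using up[OF ml(1)] by (simp add: F_def)
    then obtain t where t: "s ?\<beta> - cscale t ?\<beta> \<in> F m"
      unfolding F_Suc[OF ml(1)] by (elim exE)
    have eig: "s w - cscale t w \<in> F m" if w: "w \<in> F i" for w
    proof -
      obtain c where c: "w - cscale c ?\<beta> \<in> F m"
        using w unfolding m F_Suc[OF ml(1)] by (elim exE)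
      have "s (w - cscale c ?\<beta>) - cscale t (w - cscale c ?\<beta>) + cscale c (s ?\<beta> - cscale t ?\<beta>) \<in> F m"
        by (rule C.subspace_add[OF subF C.subspace_diff[OF subF sF[OF _ c] C.subspace_scale[OF subF c]]
              C.subspace_scale[OF subF t]]) (use ml(1) in simp)
      then show ?thesis
        by (simp add: C.lin_simps[OF lin] C.scale_right_diff_distrib mult.commute)
    qed
    have "s v - cscale t v \<in> b.E (Suc j)"
      by (intro C.subspace_diff[OF b.subspace_E] C.subspace_scale[OF b.subspace_E] v(2)
          b.upper_E[OF CT.A_upper(1)[OF sA] lin jn(1) v(2)])
    then have 1: "s v - cscale t v \<in> b.E j" using imin[OF ml(2)] eig[OF v(1)] by blast
    have 2: "s v - cscale (b.diag j s) v \<in> b.E j"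
      by (rule b.upper_diag_E[OF CT.A_upper(1)[OF sA] lin j v(2)])
    have "cscale (b.diag j s - t) v \<in> b.E j"
      using C.subspace_diff[OF b.subspace_E 1 2] by (simp add: C.scale_left_diff_distrib)
    then have "b.diag j s = t"
      using v(3) C.subspace_scale[OF b.subspace_E, of "cscale (b.diag j s - t) v" j "inverse (b.diag j s - t)"]
      by (cases "b.diag j s - t = 0") auto
    moreover have "b'.diag j s = t"
    proof -
      let ?v = "conj_vec v"
      define w where "w = s ?v - cscale t ?v"
      have v': "?v \<in> b'.E (Suc j)" "?v \<notin> b'.E j" using v conj_E jn by auto
      have "s ?v - cscale t ?v \<in> b'.E (Suc j)"
        by (intro C.subspace_diff[OF b'.subspace_E] C.subspace_scale[OF b'.subspace_E] v'(1)
            b'.upper_E[OF CT.A_upper(2)[OF sA] lin jn(1) v'(1)])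
      moreover have "s ?v - cscale t ?v \<in> F m" by (rule eig[OF F_conj[OF v(1)]])
      ultimately have "w \<in> b'.E (Suc j)" "w \<in> F m" by (simp_all only: w_def)
      then have "conj_vec w \<in> F m \<inter> b.E (Suc j)"
        using F_conj conj_E[OF jn(1), of "conj_vec w"] by simp
      then have "conj_vec w \<in> b.E j" using imin[OF ml(2)] by blast
      then have 1: "s ?v - cscale t ?v \<in> b'.E j"
        using conj_E[OF jn(2), of "conj_vec w"] by (simp add: w_def)
      have 2: "s ?v - cscale (b'.diag j s) ?v \<in> b'.E j"
        by (rule b'.upper_diag_E[OF CT.A_upper(2)[OF sA] lin j v'(1)])
      have "cscale (b'.diag j s - t) ?v \<in> b'.E j"
        using C.subspace_diff[OF b'.subspace_E 1 2] by (simp add: C.scale_left_diff_distrib)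
      then show ?thesis
        using v'(2) C.subspace_scale[OF b'.subspace_E, of "cscale (b'.diag j s - t) ?v" j "inverse (b'.diag j s - t)"]
        by (cases "b'.diag j s - t = 0") auto
    qed
    ultimately show ?thesis by simp
  qed
  then show "s \<in> CT.B" using sA by (simp add: CT.B_def)
qed

text \<open>Drop the vectors that depend on earlier ones: a spanning list becomes a basis with the
  same steps of its flag.\<close>
lemma extract_basis:
  fixes zs :: "'v list"
  shows "\<exists>bs. distinct bs \<and> independent (set bs) \<and> span (set bs) = span (set zs) \<and>
    (\<forall>j<length bs. \<exists>m<length zs. bs ! j = zs ! m \<and> span (set (take (Suc j) bs)) = span (set (take (Suc m) zs)))"
proof (induction zs rule: rev_induct)
  case Nil
  show ?case by (intro exI[of _ "[]"]) (simp add: real_vector.independent_empty)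
next
  case (snoc z zs)
  then obtain bs where bs: "distinct bs" "independent (set bs)" "span (set bs) = span (set zs)"
    and pick: "\<And>j. j < length bs \<Longrightarrow> \<exists>m<length zs. bs ! j = zs ! m \<and>
      span (set (take (Suc j) bs)) = span (set (take (Suc m) zs))" by blast
  have pick': "\<exists>m<length (zs @ [z]). bs ! j = (zs @ [z]) ! m \<and>
      span (set (take (Suc j) bs)) = span (set (take (Suc m) (zs @ [z])))" if j: "j < length bs" for j
  proof -
    obtain m where "m < length zs" "bs ! j = zs ! m" "span (set (take (Suc j) bs)) = span (set (take (Suc m) zs))"
      using pick[OF j] by blast
    then show ?thesis by (intro exI[of _ m]) (simp add: nth_append)
  qed
  have ins: "span (insert z (set bs)) = span (insert z (set zs))"
    unfolding span_insert bs(3) ..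
  show ?case
  proof (cases "z \<in> span (set zs)")
    case True
    then have "span (set (zs @ [z])) = span (set zs)" by (simp add: span_redundant)
    then show ?thesis using bs pick' by (intro exI[of _ bs]) simp
  next
    case False
    then have z: "z \<notin> span (set bs)" using bs(3) by simp
    then have "z \<notin> set bs" using real_vector.span_base by blast
    moreover have "independent (insert z (set bs))" using bs(2) z by (simp add: real_vector.independent_insert)
    moreover have "\<exists>m<length (zs @ [z]). (bs @ [z]) ! j = (zs @ [z]) ! m \<and>
      span (set (take (Suc j) (bs @ [z]))) = span (set (take (Suc m) (zs @ [z])))"
      if j: "j < length (bs @ [z])" for j
    proof (cases "j < length bs")
      case True then show ?thesis using pick'[OF True] by (simp add: nth_append)
    next
      case False
      then have "j = length bs" using j by simp
      then show ?thesis using ins by (intro exI[of _ "length zs"]) simp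
    qed
    ultimately show ?thesis using bs(1) ins by (intro exI[of _ "bs @ [z]"]) simp
  qed
qed

text \<open>For \<open>s\<close> in \<open>B\<close>, the vectors \<open>e k\<close> and their conjugates are eigenvectors for the same
  number \<open>d\<close> modulo the earlier ones. So are their combinations, the real vectors \<open>fst (e k)\<close>
  and \<open>snd (e k)\<close>. The list of all these vectors spans an invariant real flag.\<close>
lemma B_trigonalizable: "trigonalizable_over_reals CT.B"
proof -
  define zs where "zs k = concat (map (\<lambda>j. [fst (e j), snd (e j)]) [0..<k])" for k
  have zs_Suc: "zs (Suc k) = zs k @ [fst (e k), snd (e k)]" for k by (simp add: zs_def)
  define F where "F xs = cspan ((\<lambda>b. (b, 0)) ` set xs)" for xs :: "'v list"
  have subF: "C.subspace (F xs)" for xs unfolding F_def by (rule C.subspace_span)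
  have F_prod: "F xs = span (set xs) \<times> span (set xs)" for xs
    unfolding F_def by (rule complex_span_real)
  have e_mem: "e i \<in> F (zs k) \<and> e' i \<in> F (zs k)" if "i < k" for i k
  proof -
    have "fst (e i) \<in> set (zs k)" "snd (e i) \<in> set (zs k)" using that by (auto simp: zs_def)
    then have "fst (e i) \<in> span (set (zs k))" "snd (e i) \<in> span (set (zs k))" "- snd (e i) \<in> span (set (zs k))"
      by (simp_all add: real_vector.span_base real_vector.span_neg)
    then show ?thesis unfolding F_prod by (cases "e i") simp
  qed
  have E_sub: "b.E k \<subseteq> F (zs k)" "b'.E k \<subseteq> F (zs k)" for k
    unfolding b.E_def b'.E_def by (rule C.span_minimal[OF _ subF]; use e_mem in auto)+
  have full: "span (set (zs n)) = UNIV"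
  proof -
    have "v \<in> span (set (zs n))" for v
    proof -
      have "(v, 0) \<in> b.E n" by (simp add: b.mem_E[OF order_refl])
      then show ?thesis using E_sub(1)[of n] unfolding F_prod by auto
    qed
    then show ?thesis by auto
  qed
  have step: "s (zs k ! m, 0) \<in> F (take (Suc m) (zs k))"
    if "k \<le> n" "m < length (zs k)" "s \<in> CT.B" for k m s
    using that(1,2)
  proof (induction k arbitrary: m)
    case 0 then show ?case by (simp add: zs_def)
  next
    case (Suc k)
    have k: "k < n" using Suc.prems by simp
    have sA: "s \<in> CT.A" and diag: "b'.diag k s = b.diag k s" using that(3) k by (auto simp: CT.B_def)
    have lin: "C.lin s" using CT.A_M[OF sA] by (simp add: C.carrier_GL_iff)
    define d where "d = b.diag k s"
    obtain p q where pq: "e k = (p, q)" by (cases "e k")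
    have "e k \<in> b.E (Suc k)" "e' k \<in> b'.E (Suc k)"
      unfolding b.E_def b'.E_def by (auto intro: C.span_base)
    then have 1: "s (p, q) - cscale d (p, q) \<in> F (zs k)" and 2: "s (p, - q) - cscale d (p, - q) \<in> F (zs k)"
      using b.upper_diag_E[OF CT.A_upper(1)[OF sA] lin k, of "e k"]
        b'.upper_diag_E[OF CT.A_upper(2)[OF sA] lin k, of "e' k"] E_sub[of k] diag
      by (auto simp: d_def pq)
    define N where "N v = s v - cscale d v" for v
    have N_add: "N (v + w) = N v + N w" and N_diff: "N (v - w) = N v - N w" for v w
      by (simp_all add: N_def C.lin_simps[OF lin] C.scale_right_distrib C.scale_right_diff_distrib)
    have N_scale: "N (cscale c v) = cscale c (N v)" for c v
      by (simp add: N_def C.lin_simps[OF lin] C.scale_right_diff_distrib mult.commute)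
    have 1: "N (p, q) \<in> F (zs k)" and 2: "N (p, - q) \<in> F (zs k)" using 1 2 by (simp_all only: N_def)
    have p: "s (p, 0) - cscale d (p, 0) \<in> F (zs k)"
    proof -
      have "(p, 0) = cscale (1/2) ((p, q) + (p, - q))" by (simp add: cscale_def scaleR_2[symmetric])
      then have "N (p, 0) = cscale (1/2) (N (p, q) + N (p, - q))" by (simp only: N_scale N_add)
      also have "\<dots> \<in> F (zs k)"
        by (intro C.subspace_scale[OF subF] C.subspace_add[OF subF] 1 2)
      finally show ?thesis by (simp only: N_def)
    qed
    have q: "s (q, 0) - cscale d (q, 0) \<in> F (zs k)"
    proof -
      have "(q, 0) = cscale (- \<i>/2) ((p, q) - (p, - q))" by (simp add: cscale_def scaleR_2[symmetric])
      then have "N (q, 0) = cscale (- \<i>/2) (N (p, q) - N (p, - q))" by (simp only: N_scale N_diff)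
      also have "\<dots> \<in> F (zs k)"
        by (intro C.subspace_scale[OF subF] C.subspace_diff[OF subF] 1 2)
      finally show ?thesis by (simp only: N_def)
    qed
    have mono: "F xs \<subseteq> F (xs @ ys)" for xs ys unfolding F_def by (intro C.span_mono) auto
    have fin: "s (r, 0) \<in> F (xs @ [r])" if "s (r, 0) - cscale d (r, 0) \<in> F xs" for r xs
    proof -
      have "(r, 0) \<in> F (xs @ [r])" unfolding F_def by (intro C.span_base) auto
      then have "(s (r, 0) - cscale d (r, 0)) + cscale d (r, 0) \<in> F (xs @ [r])"
        using that mono[of xs "[r]"] by (intro C.subspace_add[OF subF] C.subspace_scale[OF subF]) auto
      then show ?thesis by simp
    qed
    consider "m < length (zs k)" | "m = length (zs k)" | "m = Suc (length (zs k))"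
      using Suc.prems by (auto simp: zs_Suc less_Suc_eq)
    then show ?case
    proof cases
      case 1
      then show ?thesis using Suc.IH[OF _ 1] Suc.prems by (simp add: zs_Suc nth_append)
    next
      case 2
      then show ?thesis using fin[OF p] by (simp add: zs_Suc nth_append pq)
    next
      case 3
      have "s (q, 0) - cscale d (q, 0) \<in> F (zs k @ [p])" using q mono[of "zs k" "[p]"] by blast
      from fin[OF this] show ?thesis using 3 by (simp add: zs_Suc nth_append pq)
    qed
  qed
  obtain bs where bs: "distinct bs" "independent (set bs)" "span (set bs) = span (set (zs n))"
    and pick: "\<And>j. j < length bs \<Longrightarrow> \<exists>m<length (zs n). bs ! j = zs n ! m \<and>
      span (set (take (Suc j) bs)) = span (set (take (Suc m) (zs n)))"
    using extract_basis[of "zs n"] by blast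
  have "s (bs ! j, 0) \<in> cspan ((\<lambda>b. (b, 0)) ` set (take (Suc j) bs))"
    if s: "s \<in> CT.B" and j: "j < length bs" for s j
  proof -
    obtain m where m: "m < length (zs n)" "bs ! j = zs n ! m"
      "span (set (take (Suc j) bs)) = span (set (take (Suc m) (zs n)))" using pick[OF j] by blast
    show ?thesis using step[OF order_refl m(1) s] unfolding F_def complex_span_real m(2,3) .
  qed
  then show ?thesis unfolding trigonalizable_over_reals_def using bs full by (intro exI[of _ bs]) simp
qed

lemma max_split_eq: "max_split_subgroup CT.A = CT.B0"
  unfolding max_split_subgroup_def
proof (rule Greatest_equality)
  have "trigonalizable_over_reals CT.B0"
    using B_trigonalizable CT.B0_sub unfolding trigonalizable_over_reals_def by (meson subsetD)
  then show "subgroup CT.B0 (GL cscale) \<and> CT.B0 \<subseteq> CT.A \<and> closedin (zariski cscale) CT.B0 \<and>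
      connectedin (zariski cscale) CT.B0 \<and> trigonalizable_over_reals CT.B0"
    using CT.B0_subgroup CT.B0_sub CT.B0_closed CT.B0_connected by (auto simp: CT.B_def)
  fix S assume S: "subgroup S (GL cscale) \<and> S \<subseteq> CT.A \<and> closedin (zariski cscale) S \<and>
    connectedin (zariski cscale) S \<and> trigonalizable_over_reals S"
  have "id \<in> S" using S subgroup.one_closed[of S "GL cscale"] by (simp add: GL_def)
  then show "S \<subseteq> CT.B0" using S trigonalizable_sub_B CT.B0_max by blast
qed

end

section \<open>Density of uniform subgroups\<close>

context fin_dim_real
begin

text \<open>A complex functional on \<open>V \<times> V\<close> is made up of four real functionals on \<open>V\<close>, the real and
  imaginary parts of its restrictions to the two factors.\<close>
lemma continuous_polynomial:
  fixes \<rho> :: "'g \<Rightarrow> 'v \<Rightarrow> 'v"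
  assumes cont: "\<And>(L :: 'v \<Rightarrow> real) v. Vector_Spaces.linear (*\<^sub>R) (*) L \<Longrightarrow> continuous_map X euclideanreal (\<lambda>g. L (\<rho> g v))"
    and p: "polynomial_fun cscale p"
  shows "continuous_map X euclidean (\<lambda>g. p (complexify (\<rho> g)))"
  using p
proof induction
  case (const c) show ?case by simp
next
  case (coefficient L x)
  obtain v w where x: "x = (v, w)" by (cases x)
  have L: "L (a + b) = L a + L b" "L (cscale c a) = c * L a" for a b c
    using C.linf_simps[OF coefficient] by auto
  have Ladd: "L (a + b, 0) = L (a, 0) + L (b, 0)" "L (0, a + b) = L (0, a) + L (0, b)" for a b :: 'v
    using L(1)[of "(a, 0)" "(b, 0)"] L(1)[of "(0, a)" "(0, b)"] by simp_all
  have Lsc: "L (r *\<^sub>R a, 0) = of_real r * L (a, 0)" "L (0, r *\<^sub>R a) = of_real r * L (0, a)" for r and a :: 'v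
    using L(2)[of "of_real r" "(a, 0)"] L(2)[of "of_real r" "(0, a)"] by (simp_all add: cscale_def)
  have vs: "vector_space ((*) :: real \<Rightarrow> real \<Rightarrow> real)" by unfold_locales (auto simp: algebra_simps)
  have "Vector_Spaces.linear (*\<^sub>R) (*) (\<lambda>a. Re (L (a, 0)))" "Vector_Spaces.linear (*\<^sub>R) (*) (\<lambda>a. Im (L (a, 0)))"
    "Vector_Spaces.linear (*\<^sub>R) (*) (\<lambda>a. Re (L (0, a)))" "Vector_Spaces.linear (*\<^sub>R) (*) (\<lambda>a. Im (L (0, a)))"
    unfolding Vector_Spaces.linear_iff by (simp_all add: vs real_vector.vector_space_axioms Ladd Lsc)
  from this[THEN cont]
  have c: "continuous_map X euclidean (\<lambda>g. Re (L (\<rho> g u, 0)))" "continuous_map X euclidean (\<lambda>g. Im (L (\<rho> g u, 0)))"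
    "continuous_map X euclidean (\<lambda>g. Re (L (0, \<rho> g u)))" "continuous_map X euclidean (\<lambda>g. Im (L (0, \<rho> g u)))" for u
    by blast+
  have "L (complexify (\<rho> g) x) =
      Complex (Re (L (\<rho> g v, 0)) + Re (L (0, \<rho> g w))) (Im (L (\<rho> g v, 0)) + Im (L (0, \<rho> g w)))" for g
    using L(1)[of "(\<rho> g v, 0)" "(0, \<rho> g w)"]
    by (simp add: x complexify_def complex_eq_iff)
  then show ?case using c[of v] c[of w] unfolding continuous_map_euclidean_iff
    by (auto simp del: Complex_eq intro!: tendsto_Complex tendsto_add)
next
  case (add p q)
  then show ?case unfolding continuous_map_euclidean_iff by (auto intro!: tendsto_intros)
next
  case (mult p q)
  then show ?case unfolding continuous_map_euclidean_iff by (auto intro!: tendsto_intros)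
qed

text \<open>So a real polynomial that vanishes on \<open>\<rho>(H)\<close> extends to a complex one that vanishes on the
  complexification.\<close>
lemma complexify_polynomial:
  assumes "polynomial_fun ((*\<^sub>R) :: real \<Rightarrow> 'v \<Rightarrow> 'v) p"
  shows "\<exists>q. polynomial_fun cscale q \<and> (\<forall>x. linear x \<longrightarrow> q (complexify x) = complex_of_real (p x))"
  using assms
proof induction
  case (const c)
  show ?case by (intro exI[of _ "\<lambda>_. complex_of_real c"]) (simp add: polynomial_fun.const)
next
  case (coefficient L v)
  have L: "L (a + b) = L a + L b" "L (r *\<^sub>R a) = r * L a" for a b r
    using coefficient by (simp_all add: Vector_Spaces.linear_iff)
  have L0: "L 0 = 0" using L(2)[of 0 0] by simp
  have Ld: "L (a - b) = L a - L b" for a b using L(1)[of a "- 1 *\<^sub>R b"] L(2)[of "-1" b] by simp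
  define K where "K = (\<lambda>(a, b). complex_of_real (L a) + \<i> * complex_of_real (L b))"
  have "C.linf K" unfolding Vector_Spaces.linear_iff
    by (auto simp: K_def vector_space_cscale C.vector_space_mult L Ld cscale_def complex_eq_iff)
  from polynomial_fun.coefficient[OF this, of "(v, 0)"]
  show ?case
    by (intro exI[of _ "\<lambda>f. K (f (v, 0))"]) (simp add: K_def complexify_def linear_0 L0)
next
  case (add p q)
  then obtain p' q' where "polynomial_fun cscale p'" "\<forall>x. linear x \<longrightarrow> p' (complexify x) = complex_of_real (p x)"
    "polynomial_fun cscale q'" "\<forall>x. linear x \<longrightarrow> q' (complexify x) = complex_of_real (q x)" by blast
  then show ?case by (intro exI[of _ "\<lambda>f. p' f + q' f"]) (simp add: polynomial_fun.add)
next
  case (mult p q)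
  then obtain p' q' where "polynomial_fun cscale p'" "\<forall>x. linear x \<longrightarrow> p' (complexify x) = complex_of_real (p x)"
    "polynomial_fun cscale q'" "\<forall>x. linear x \<longrightarrow> q' (complexify x) = complex_of_real (q x)" by blast
  then show ?case by (intro exI[of _ "\<lambda>f. p' f * q' f"]) (simp add: polynomial_fun.mult)
qed

end

theorem theorem1p1:
  fixes G :: "('g, 'm) monoid_scheme"
    and X :: "'g topology"
    and charts :: "('g set \<times> ('g \<Rightarrow> 'e::real_normed_vector)) set"
    and H :: "'g set"
    and \<rho> :: "'g \<Rightarrow> 'v \<Rightarrow> 'v::real_vector"
  assumes "lie_group G X charts"
    and "connected_space X"
    and "solvable G"
    and "uniform_subgroup G X H"
    and "\<exists>B::'v set. finite B \<and> span B = UNIV"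
    and "continuous_representation G X \<rho>"
  shows "max_trigonalizable_subgroup (\<rho> ` carrier G) \<subseteq> zariski (*\<^sub>R) closure_of (\<rho> ` H)"
proof -
  interpret lie_group G X charts by fact
  obtain Bs :: "'v set" where "finite Bs" "span Bs = UNIV" using assms(5) by blast
  then interpret fin_dim_real Bs by unfold_locales
  have hom: "\<rho> \<in> hom G (GL (*\<^sub>R))"
    and cont: "\<And>L v. Vector_Spaces.linear (*\<^sub>R) (*) L \<Longrightarrow> continuous_map X euclideanreal (\<lambda>g. L (\<rho> g v))"
    using assms(6) by (auto simp: continuous_representation_def)
  have \<rho>_GL: "\<rho> g \<in> carrier (GL (*\<^sub>R))" if "g \<in> carrier G" for g
    using hom that by (rule hom_in_carrier)
  have \<rho>_mult: "\<rho> (g \<otimes>\<^bsub>G\<^esub> h) = \<rho> g \<circ> \<rho> h" if "g \<in> carrier G" "h \<in> carrier G" for g h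
    using hom_mult[OF hom that] by (simp add: GL_def)
  have \<rho>_one: "\<rho> \<one>\<^bsub>G\<^esub> = id"
  proof
    fix v
    have b: "bij (\<rho> \<one>\<^bsub>G\<^esub>)" using \<rho>_GL[OF one_closed] by (simp add: GL_real_iff)
    have "\<rho> \<one>\<^bsub>G\<^esub> (\<rho> \<one>\<^bsub>G\<^esub> v) = \<rho> \<one>\<^bsub>G\<^esub> v"
      using fun_cong[OF \<rho>_mult[OF one_closed one_closed], of v] by simp
    then show "\<rho> \<one>\<^bsub>G\<^esub> v = id v" using b by (simp add: bij_is_inj inj_eq)
  qed
  have \<rho>_inv: "\<rho> g \<circ> \<rho> (inv\<^bsub>G\<^esub> g) = id" "\<rho> (inv\<^bsub>G\<^esub> g) \<circ> \<rho> g = id" if "g \<in> carrier G" for g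
    using \<rho>_mult[of g "inv\<^bsub>G\<^esub> g"] \<rho>_mult[of "inv\<^bsub>G\<^esub> g" g] that by (simp_all add: \<rho>_one)
  define T where "T g = complexify (\<rho> g)" for g
  have T_lin: "C.lin (T g)" if "g \<in> carrier G" for g
    using complexify_GL[OF \<rho>_GL[OF that]] unfolding C.carrier_GL_iff T_def by (rule conjunct1)
  have T_mult: "T (g \<otimes>\<^bsub>G\<^esub> h) v = T g (T h v)" if "g \<in> carrier G" "h \<in> carrier G" for g h v
    by (simp add: T_def \<rho>_mult[OF that] complexify_comp)
  have T_one: "T \<one>\<^bsub>G\<^esub> v = v" for v by (simp add: T_def \<rho>_one complexify_id)
  have poly_cont: "continuous_map X euclidean (\<lambda>g. p (T g))" if "polynomial_fun cscale p" for p
    unfolding T_def using cont that by (rule continuous_polynomial[where \<rho> = \<rho>])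
  have T_cont: "continuous_map X euclidean (\<lambda>g. L (T g v))" if "C.linf L" for L v
    by (rule poly_cont[OF polynomial_fun.coefficient[OF that]])
  have "\<exists>e l n. dual_basis cscale e l n \<and>
      (\<forall>g\<in>carrier G. \<forall>j<n. T g (e j) \<in> cspan (e ` {..<Suc j}))"
    using is_group topspace_eq_carrier mult_continuous inv_continuous T_lin T_mult T_one T_cont assms(2,3)
    by (rule C.triangular_basis)
  then obtain e l n where el: "dual_basis (cscale :: complex \<Rightarrow> 'v \<times> 'v \<Rightarrow> 'v \<times> 'v) e l n"
    and tri: "\<forall>g\<in>carrier G. \<forall>j<n. T g (e j) \<in> cspan (e ` {..<Suc j})" by (elim exE conjE)
  interpret b: dual_basis "cscale :: complex \<Rightarrow> 'v \<times> 'v \<Rightarrow> 'v \<times> 'v" e l n by (rule el)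
  interpret real_triangular Bs e l n "\<rho> ` carrier G"
  proof unfold_locales
    show "\<rho> ` carrier G \<subseteq> carrier (GL (*\<^sub>R))" using \<rho>_GL by blast
    show "id \<in> \<rho> ` carrier G" using imageI[OF one_closed, of \<rho>] by (simp add: \<rho>_one)
    show "a \<circ> c \<in> \<rho> ` carrier G" if ac: "a \<in> \<rho> ` carrier G" "c \<in> \<rho> ` carrier G" for a c
      using ac by (auto simp: \<rho>_mult[symmetric])
    show "\<exists>c\<in>\<rho> ` carrier G. a \<circ> c = id \<and> c \<circ> a = id" if a: "a \<in> \<rho> ` carrier G" for a
    proof -
      obtain g where g: "g \<in> carrier G" "a = \<rho> g" using a by blast
      then show ?thesis using \<rho>_inv[OF g(1)] by (intro bexI[of _ "\<rho> (inv\<^bsub>G\<^esub> g)"]) auto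
    qed
    show "b.upper (complexify a)" if a: "a \<in> \<rho> ` carrier G" for a
      using a tri by (auto simp: b.upper_iff b.E_def T_def)
  qed
  have H: "subgroup H G" and compact: "compact_space (quotient_topology X (\<lambda>x. x <#\<^bsub>G\<^esub> H))"
    using assms(4) by (simp_all add: uniform_subgroup_def)
  have HG: "H \<subseteq> carrier G" using H by (rule subgroup.subset)
  let ?G0 = "complexify ` \<rho> ` carrier G"
  let ?H0 = "complexify ` \<rho> ` H"
  have bdd: "\<exists>C. \<forall>g\<in>?G0. norm (p g) \<le> C * norm (\<tau> g)"
    if p: "polynomial_fun cscale p" and \<tau>: "\<tau> \<in> CT.Ch"
      and inv: "\<And>g h. g \<in> ?G0 \<Longrightarrow> h \<in> ?H0 \<Longrightarrow> p (g \<circ> h) * \<tau> g = p g * \<tau> (g \<circ> h)" for p \<tau>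
  proof -
    have nz: "\<tau> (T g) \<noteq> 0" if "g \<in> carrier G" for g
      using CT.S.Ch_nonzero[OF \<tau>] CT.G0_A that unfolding T_def by blast
    have pol: "polynomial_fun cscale \<tau>" using \<tau> CT.S.Ch_Reg by blast
    define f where "f g = p (T g) / \<tau> (T g)" for g
    have "continuous_map X euclidean f"
      using poly_cont[OF p] poly_cont[OF pol] nz
      unfolding continuous_map_euclidean_iff f_def topspace_eq_carrier
      by (auto intro!: tendsto_divide)
    moreover have "f x = f y" if xy: "x \<in> topspace X" "y \<in> topspace X" and eq: "x <#\<^bsub>G\<^esub> H = y <#\<^bsub>G\<^esub> H" for x y
    proof -
      have xyG: "x \<in> carrier G" "y \<in> carrier G" using xy topspace_eq_carrier by auto
      have "x \<otimes>\<^bsub>G\<^esub> \<one>\<^bsub>G\<^esub> \<in> x <#\<^bsub>G\<^esub> H" using subgroup.one_closed[OF H] by (auto simp: l_coset_def)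
      then obtain h where h: "h \<in> H" "x = y \<otimes>\<^bsub>G\<^esub> h"
        using eq xyG by (auto simp: l_coset_def)
      have Tx: "T x = T y \<circ> T h"
        using h HG xyG T_mult by (auto simp: fun_eq_iff)
      have "p (T y \<circ> T h) * \<tau> (T y) = p (T y) * \<tau> (T y \<circ> T h)"
        using xyG h unfolding T_def by (intro inv) auto
      then show ?thesis using nz[OF xyG(1)] nz[OF xyG(2)] unfolding f_def Tx
        by (simp add: field_simps)
    qed
    ultimately have "bounded (f ` topspace X)"
      by (rule bounded_range_of_compact_quotient[OF compact])
    then obtain C where C: "\<And>g. g \<in> carrier G \<Longrightarrow> norm (f g) \<le> C"
      unfolding bounded_iff topspace_eq_carrier by blast
    have "norm (p (T g)) \<le> C * norm (\<tau> (T g))" if "g \<in> carrier G" for g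
      using C[OF that] nz[OF that] by (simp add: f_def norm_divide pos_divide_le_eq)
    then show ?thesis unfolding T_def by blast
  qed
  show ?thesis
  proof
    fix f assume f: "f \<in> max_trigonalizable_subgroup (\<rho> ` carrier G)"
    have fcl: "f \<in> zariski (*\<^sub>R) closure_of (\<rho> ` carrier G)"
      and fB: "complexify f \<in> CT.B0"
      using f unfolding max_trigonalizable_subgroup_def CT.A_closure[symmetric] max_split_eq by auto
    have fGL: "f \<in> carrier (GL (*\<^sub>R))" using fcl by (simp add: in_closure_of topspace_zariski)
    have HGL: "\<rho> ` H \<subseteq> carrier (GL (*\<^sub>R))" using HG \<rho>_GL by blast
    have "p f = 0" if p: "polynomial_fun (*\<^sub>R) p" "\<forall>s\<in>\<rho> ` H. p s = 0" for p
    proof -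
      obtain q where q: "polynomial_fun cscale q"
        "\<forall>x. linear x \<longrightarrow> q (complexify x) = complex_of_real (p x)"
        using complexify_polynomial[OF p(1)] by blast
      have "q (complexify f) = 0"
      proof (rule CT.vanishing_on_split_part[of ?H0 CT.B0, OF _ _ _ bdd CT.B0_sub CT.id_B0 CT.B0_connected q(1) _ fB])
        show "?H0 \<subseteq> ?G0" using HG by blast
        show "id \<in> ?H0" using imageI[OF imageI[OF subgroup.one_closed[OF H]], of complexify \<rho>]
          by (simp add: \<rho>_one complexify_id)
        show "a \<circ> c \<in> ?H0" if ac: "a \<in> ?H0" "c \<in> ?H0" for a c
        proof -
          obtain g h where gh: "g \<in> H" "h \<in> H" "a = complexify (\<rho> g)" "c = complexify (\<rho> h)" using ac by blast
          have "a \<circ> c = complexify (\<rho> (g \<otimes>\<^bsub>G\<^esub> h))"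
            unfolding gh(3,4) using \<rho>_mult[of g h] gh(1,2) HG by (simp add: complexify_comp subset_iff)
          then show ?thesis using subgroup.m_closed[OF H gh(1,2)] by blast
        qed
        show "q h = 0" if h: "h \<in> ?H0" for h
        proof -
          obtain k where k: "k \<in> H" "h = complexify (\<rho> k)" using h by blast
          have "linear (\<rho> k)" using \<rho>_GL[of k] k(1) HG by (auto simp: GL_real_iff)
          then show ?thesis using q(2) p(2) k by simp
        qed
      qed
      moreover have "linear f" using fGL by (simp add: GL_real_iff)
      ultimately show ?thesis using q(2) by simp
    qed
    then show "f \<in> zariski (*\<^sub>R) closure_of (\<rho> ` H)"
      unfolding zariski_closure_of[OF HGL] using fGL by blast
  qed
qed

end
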